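(* Let either $\ell\in\{0,1\}$ and $r>3/2$, or $\ell=2$ and $r>4$. Then there exists $C_r>0$ such that for all $\kappa\in(0,\infty)$, all integers $N\ge2$ and all $F\in\mathcal H^r$, $$|I_\kappa(F)-I_{\kappa,N}^{\rm gl}(F)|\le C_r\,\kappa^{-\ell}\,N^{\eta(\ell)-r}\,\|F\|_{\mathcal H^r},$$ where $\eta(0)=0$, $\eta(1)=3/2$, $\eta(2)=4$.
   Context: Functions on the unit sphere $\mathbb S^2$ are identified with functions $F:\mathbb R^2\to\mathbb C$ of $(\theta,\phi)$ via $F=F^\circ\circ p$, where $p(\theta,\phi)=(\sin\theta\cos\phi,\sin\theta\sin\phi,\cos\theta)$ and $F^\circ$ is a function on $\mathbb S^2$; such $F$ satisfy $F(\theta+2\pi,\phi)=F(\theta,\phi+2\pi)=F(\theta,\phi)$ and $F(-\theta,\phi+\pi)=F(\theta,\phi)$. $\mathcal C$ denotes the set of those $F$ with $F^\circ$ continuous. Sobolev spaces. $P_n^m(x)=\frac{(-1)^n}{2^nn!}(1-x^2)^{m/2}\frac{d^{m+n}}{dx^{m+n}}(1-x^2)^n$ and, for $0\le m\le n$, $Q_n^m(\theta)=\big(\frac{2n+1}{2}\frac{(n-m)!}{(n+m)!}\big)^{1/2}P_n^m(\cos\theta)$, $Q_n^{-m}=Q_n^m$; $e_m(\phi)=\frac1{\sqrt{2\pi}}\exp(\mathrm i m\phi)$ for $m\in\mathbb Z$; $Y_n^m(\theta,\phi)=(-1)^{(m+|m|)/2}Q_n^m(\theta)e_m(\phi)$ for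 $|m|\le n$. $\mathcal H^0$ is the space of (classes of a.e. equal) measurable functions $F:\mathbb R^2\to\mathbb C$ satisfying $F(\theta+2\pi,\phi)=F(\theta,\phi+2\pi)=F(\theta,\phi)$ and $F(-\theta,\phi+\pi)=F(\theta,\phi)$, and $\|F\|_{\mathcal H^0}^2=\int_0^\pi\int_0^{2\pi}|F|^2\sin\theta\,d\phi\,d\theta<\infty$. With $\widehat F_{n,m}=\int_0^\pi\int_0^{2\pi}F\,\overline{Y_n^m}\sin\theta\,d\phi\,d\theta$, for $s\ge0$, $\|F\|_{\mathcal H^s}^2=\sum_{n=0}^\infty\sum_{m=-n}^n(n+\frac12)^{2s}|\widehat F_{n,m}|^2$ and $\mathcal H^s=\{F\in\mathcal H^0:\|F\|_{\mathcal H^s}<\infty\}$. For $r>1$ elements of $\mathcal H^r$ are identified with their continuous representatives in $\mathcal C$. Interpolation. $\mathbb D_M^{\rm e}=\mathrm{span}\{\cos n\theta:0\le n\le M\}$, $\mathbb D_M^{\rm o}=\mathrm{span}\{\sin\theta\cos n\theta:0\le n\le M\}$. For $N\ge2$ (standing assumption), $\mathcal X_N$ is the set of all functions $\sum_{-N<m\le N}p_m(\theta)\exp(\mathrm i m\phi)$ with $p_m\in\mathbb D_N^{\rm e}$ for even $m$, $p_m(0)=p_m(\pi)=0$ for even $m\neq0$, and $p_m\in\mathbb D_{N-2}^{\rm o}$ for odd $m$. Let $-1=\eta_0<\eta_1<\dots<\eta_N=1$ be the Gauss-Lobatto nodes ($\eta_1,\dots,\eta_{N-1}$ are the roots of $P_N'$,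 $P_N$ the Legendre polynomial of degree $N$) and $\theta_j=\arccos\eta_{N-j}$, $j=0,\dots,N$. For $F\in\mathcal C$, $\mathcal Q_N^{\rm gl}F$ is the unique element of $\mathcal X_N$ with $(\mathcal Q_N^{\rm gl}F)(\theta_j,\frac{k\pi}N)=F(\theta_j,\frac{k\pi}N)$ for $j=0,\dots,N$ and $k=-N+1,\dots,N$. Integrals. $I_\kappa(F)=\int_0^\pi\int_0^{2\pi}F(\theta,\phi)\exp(\mathrm i\kappa\cos\theta)\sin\theta\,d\phi\,d\theta$ and $I_{\kappa,N}^{\rm gl}(F)=\int_0^\pi\int_0^{2\pi}(\mathcal Q_N^{\rm gl}F)(\theta,\phi)\exp(\mathrm i\kappa\cos\theta)\sin\theta\,d\phi\,d\theta$. *)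

theory Defs
  imports "HOL-Analysis.Analysis" "HOL-Computational_Algebra.Polynomial"
begin

definition sph_param :: "real \<times> real \<Rightarrow> real ^ 3" where
  "sph_param = (\<lambda>(\<theta>, \<phi>). vector [sin \<theta> * cos \<phi>, sin \<theta> * sin \<phi>, cos \<theta>])"

definition sph_cont :: "(real \<times> real \<Rightarrow> complex) set" where
  "sph_cont = {F. \<exists>F0. continuous_on (sphere 0 1) F0 \<and> F = F0 \<circ> sph_param}"

definition sph_symmetric :: "(real \<times> real \<Rightarrow> complex) \<Rightarrow> bool" where
  "sph_symmetric F \<longleftrightarrow> (\<forall>\<theta> \<phi>.
     F (\<theta> + 2 * pi, \<phi>) = F (\<theta>, \<phi>) \<and> F (\<theta>, \<phi> + 2 * pi) = F (\<theta>, \<phi>) \<and>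
     F (- \<theta>, \<phi> + pi) = F (\<theta>, \<phi>))"

text \<open>The iterated integral of \<open>F sin \<theta>\<close> over \<open>\<phi> \<in> [0, 2\<pi>]\<close> and \<open>\<theta> \<in> [0, \<pi>]\<close> is taken as one
  Lebesgue integral over the rectangle, so that it makes sense for Lebesgue (not only Borel)
  measurable integrands.\<close>

definition sph_integral :: "(real \<times> real \<Rightarrow> complex) \<Rightarrow> complex" where
  "sph_integral F =
     (LINT x:{0..pi} \<times> {0..2 * pi}|lebesgue. F x * complex_of_real (sin (fst x)))"

text \<open>\<open>d^k/dx^k (1 - x^2)^n\<close> as a polynomial.\<close>

definition rodrigues :: "nat \<Rightarrow> nat \<Rightarrow> real poly" where
  "rodrigues k n = (pderiv ^^ k) ([:1, 0, -1:] ^ n)"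

text \<open>The factor \<open>(1 - x^2)^(m/2)\<close> is written \<open>sqrt (1 - x^2) ^ m\<close>, because \<open>0 powr 0 = 0\<close> would give
  the wrong value at \<open>x = 1\<close> and \<open>x = -1\<close> for \<open>m = 0\<close>; the function is only used for \<open>\<bar>x\<bar> \<le> 1\<close>.\<close>

definition assoc_legendre :: "nat \<Rightarrow> nat \<Rightarrow> real \<Rightarrow> real" where
  "assoc_legendre n m x =
     (-1) ^ n / (2 ^ n * fact n) * sqrt (1 - x\<^sup>2) ^ m * poly (rodrigues (m + n) n) x"

definition Q_fun :: "nat \<Rightarrow> nat \<Rightarrow> real \<Rightarrow> real" where
  "Q_fun n m \<theta> =
     sqrt ((2 * real n + 1) / 2 * (fact (n - m) / fact (n + m))) * assoc_legendre n m (cos \<theta>)"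

definition e_fun :: "int \<Rightarrow> real \<Rightarrow> complex" where
  "e_fun m \<phi> = exp (\<i> * of_int m * of_real \<phi>) / of_real (sqrt (2 * pi))"

definition sph_harm :: "nat \<Rightarrow> int \<Rightarrow> real \<times> real \<Rightarrow> complex" where
  "sph_harm n m = (\<lambda>(\<theta>, \<phi>).
     (-1) ^ nat ((m + \<bar>m\<bar>) div 2) * of_real (Q_fun n (nat \<bar>m\<bar>) \<theta>) * e_fun m \<phi>)"

text \<open>\<open>L2_sphere\<close> and \<open>sobolev s\<close> are sets of functions, not of classes: they contain every
  representative (with the required symmetries) of every class.\<close>

definition L2_sphere :: "(real \<times> real \<Rightarrow> complex) set" where
  "L2_sphere = {F. F \<in> borel_measurable lebesgue \<and> sph_symmetric F \<and>
     set_integrable lebesgue ({0..pi} \<times> {0..2 * pi}) (\<lambda>x. (cmod (F x))\<^sup>2 * sin (fst x))}"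

definition sph_coeff :: "(real \<times> real \<Rightarrow> complex) \<Rightarrow> nat \<Rightarrow> int \<Rightarrow> complex" where
  "sph_coeff F n m = sph_integral (\<lambda>x. F x * cnj (sph_harm n m x))"

definition sobolev_term :: "real \<Rightarrow> (real \<times> real \<Rightarrow> complex) \<Rightarrow> nat \<Rightarrow> real" where
  "sobolev_term s F n =
     (\<Sum>m = - int n..int n. (real n + 1/2) powr (2 * s) * (cmod (sph_coeff F n m))\<^sup>2)"

definition sobolev :: "real \<Rightarrow> (real \<times> real \<Rightarrow> complex) set" where
  "sobolev s = {F \<in> L2_sphere. summable (sobolev_term s F)}"

definition sobolev_norm :: "real \<Rightarrow> (real \<times> real \<Rightarrow> complex) \<Rightarrow> real" where
  "sobolev_norm s F = sqrt (\<Sum>n. sobolev_term s F n)"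

text \<open>For \<open>r > 1\<close> every class in the Sobolev space of order \<open>r\<close> has exactly one representative in
  \<open>sph_cont\<close>; this is the function whose point values are used for interpolation.\<close>

definition cont_rep :: "(real \<times> real \<Rightarrow> complex) \<Rightarrow> real \<times> real \<Rightarrow> complex" where
  "cont_rep F = (THE G. G \<in> sph_cont \<and> (AE x in lebesgue. G x = F x))"

text \<open>The two sets are spans over the complex numbers.\<close>

definition D_even :: "nat \<Rightarrow> (real \<Rightarrow> complex) set" where
  "D_even M = {p. \<exists>c :: nat \<Rightarrow> complex. p = (\<lambda>\<theta>. \<Sum>n\<le>M. c n * of_real (cos (real n * \<theta>)))}"

definition D_odd :: "nat \<Rightarrow> (real \<Rightarrow> complex) set" where
  "D_odd M =
     {p. \<exists>c :: nat \<Rightarrow> complex. p = (\<lambda>\<theta>. \<Sum>n\<le>M. c n * of_real (sin \<theta> * cos (real n * \<theta>)))}"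

definition X_space :: "nat \<Rightarrow> (real \<times> real \<Rightarrow> complex) set" where
  "X_space N = {G. \<exists>p :: int \<Rightarrow> real \<Rightarrow> complex.
     (\<forall>m \<in> {- int N<..int N}.
        (even m \<longrightarrow> p m \<in> D_even N) \<and>
        (even m \<and> m \<noteq> 0 \<longrightarrow> p m 0 = 0 \<and> p m pi = 0) \<and>
        (odd m \<longrightarrow> p m \<in> D_odd (N - 2))) \<and>
     G = (\<lambda>(\<theta>, \<phi>). \<Sum>m \<in> {- int N<..int N}. p m \<theta> * exp (\<i> * of_int m * of_real \<phi>))}"

definition legendre_poly :: "nat \<Rightarrow> real poly" where
  "legendre_poly n = smult ((-1) ^ n / (2 ^ n * fact n)) (rodrigues n n)"

text \<open>The derivative of the Legendre polynomial of degree \<open>N \<ge> 1\<close> has \<open>N - 1\<close> simple roots, all in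
  the open interval \<open>(-1, 1)\<close>, so the list has \<open>N + 1\<close> entries.\<close>

definition gl_node :: "nat \<Rightarrow> nat \<Rightarrow> real" where
  "gl_node N j =
     sorted_list_of_set ({-1, 1} \<union> {x. poly (pderiv (legendre_poly N)) x = 0}) ! j"

definition gl_angle :: "nat \<Rightarrow> nat \<Rightarrow> real" where
  "gl_angle N j = arccos (gl_node N (N - j))"

definition gl_interp :: "nat \<Rightarrow> (real \<times> real \<Rightarrow> complex) \<Rightarrow> real \<times> real \<Rightarrow> complex" where
  "gl_interp N F = (THE G. G \<in> X_space N \<and>
     (\<forall>j \<in> {0..N}. \<forall>k \<in> {- int N + 1..int N}.
        G (gl_angle N j, of_int k * pi / real N) = F (gl_angle N j, of_int k * pi / real N)))"

definition osc_integral :: "real \<Rightarrow> (real \<times> real \<Rightarrow> complex) \<Rightarrow> complex" where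
  "osc_integral \<kappa> F = sph_integral (\<lambda>x. F x * exp (\<i> * of_real (\<kappa> * cos (fst x))))"

definition gl_osc_integral :: "real \<Rightarrow> nat \<Rightarrow> (real \<times> real \<Rightarrow> complex) \<Rightarrow> complex" where
  "gl_osc_integral \<kappa> N F = osc_integral \<kappa> (gl_interp N F)"

definition loss_exponent :: "nat \<Rightarrow> real" where
  "loss_exponent l = (if l = 0 then 0 else if l = 1 then 3/2 else 4)"

end

theory Submission
  imports Defs
begin

text \<open>Integration over \<open>\<phi>\<close> annihilates every order \<open>m \<noteq> 0\<close>, so the exact integral only sees the
  zonal coefficients of \<open>F\<close>, and the integral of the interpolant only sees its zonal component, which
  interpolates at the Gauss-Lobatto nodes the zonal part plus the aliased orders \<open>m = 2 N j\<close>,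
  \<open>j \<noteq> 0\<close>. These orders are even, so all functions involved are polynomials in \<open>x = cos \<theta>\<close>. As
  interpolation reproduces degree \<open>N\<close>, the error is \<open>sqrt (2 \<pi>)\<close> times the integral over
  \<open>[-1, 1]\<close> of \<open>(t - L (t + a)) exp (\<i> \<kappa> x)\<close>, where \<open>t\<close> is the zonal part of degree above \<open>N\<close>,
  \<open>a\<close> the aliased part, and \<open>L\<close> the interpolation operator of degree \<open>N\<close>.

  The \<open>L\<^sup>2\<close> norm of \<open>L h\<close> is at most the discrete norm of \<open>h\<close> at the nodes. The spacing of the
  nodes (an energy estimate) and the bound \<open>C sqrt (1 - x\<^sup>2) / N\<close> for the weights (a Sonin function)
  turn the discrete norm into \<open>\<parallel>h\<parallel>\<^sup>2 + N powr - 2 \<parallel>sqrt (1 - x\<^sup>2) h'\<parallel>\<^sup>2\<close> plus endpoint terms, whence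
  \<open>\<parallel>L (t + a)\<parallel> \<le> C N powr - r\<close> for \<open>r > 3/2\<close>. The factor \<open>\<kappa> powr - l\<close> comes from \<open>l\<close> integrations by
  parts (the first boundary term vanishes, since \<open>a\<close> does so at the endpoints and \<open>L\<close> interpolates
  there); the derivatives cost \<open>N powr \<eta>\<close> by Markov-type inequalities, applied to \<open>L (t + a)\<close> directly
  and to \<open>t\<close> on dyadic blocks of degrees. The general \<open>F\<close> is the limit of its partial sums, by
  completeness of the spherical harmonics.\<close>

section \<open>Legendre polynomials and their derivatives\<close>

text \<open>The obstacle is the discrete norm: point values are not controlled by the
  \<open>L^2\<close> norm. The energy with weight \<open>1 - x^2\<close> is the right supplement
  because Legendre's equation diagonalises it on zonal functions and bounds it by
  \<open>n (n + 1)\<close> on higher orders. The threshold \<open>r > 3/2\<close> comes from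
  aliasing: the orders \<open>2 N j\<close> and \<open>- 2 N j\<close> contribute
  \<open>j powr (1 - r)\<close> times their share of the norm, and these factors are square summable
  for \<open>r > 3/2\<close>. The condition \<open>r > \<eta>\<close> makes the dyadic blocks
  summable. The exponent 4 is two uses of an \<open>L^2\<close> Markov inequality,
  \<open>K^2\<close> each. The exponent 3/2 arises as \<open>sqrt (K^2 K)\<close>: the integral of
  \<open>p'^2\<close> against the weight \<open>1 - x^2 + 1 / K^2\<close> is of order
  \<open>K^2\<close>, that of the inverse weight is bounded by a multiple of \<open>K\<close>. All
  estimates concern real polynomials, real and imaginary parts of the coefficients being treated
  separately, with constants independent of the cutoff \<open>M\<close>. The objects given by
  descriptions, \<open>cont_rep\<close> and \<open>gl_interp\<close>, are replaced by explicit
  formulas; for the former this needs completeness, as \<open>F\<close> determines its continuous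
  representative only almost everywhere.\<close>

lemma real_poly_eqI: "(\<And>x. poly p x = poly q x) \<Longrightarrow> p = (q :: real poly)"
  using poly_eq_poly_eq_iff[of p q] by blast

text \<open>Leibniz' rule stops after two terms because \<open>X\<close> has vanishing second
  derivative. For \<open>k = 0\<close> the factor \<open>real k\<close> removes the term in which
  \<open>k - 1\<close> is truncated.\<close>

lemma higher_pderiv_X_mult:
  fixes p :: "real poly"
  shows "(pderiv ^^ k) ([:0, 1:] * p) =
    [:0, 1:] * (pderiv ^^ k) p + smult (real k) ((pderiv ^^ (k - 1)) p)"
proof (induction k)
  case (Suc k)
  have "(pderiv ^^ Suc k) ([:0, 1:] * p) = pderiv ([:0, 1:] * (pderiv ^^ k) p + smult (real k) ((pderiv ^^ (k - 1)) p))"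
    using Suc.IH by simp
  also have "\<dots> = [:0, 1:] * (pderiv ^^ Suc k) p + smult (real (Suc k)) ((pderiv ^^ (Suc k - 1)) p)"
    by (cases k; rule real_poly_eqI)
       (simp_all add: pderiv_add pderiv_mult pderiv_smult pderiv_pCons algebra_simps del: mult_pCons_left)
  finally show ?case .
qed simp

abbreviation sqw :: "real poly" where
  "sqw \<equiv> [:1, 0, -1:]"

lemma pderiv_sqw: "pderiv sqw = [:0, -2:]"
  by (simp add: pderiv_pCons)

lemma higher_pderiv_sqw_mult:
  fixes p :: "real poly"
  shows "(pderiv ^^ k) (sqw * p) = sqw * (pderiv ^^ k) p
    - smult (2 * real k) ([:0, 1:] * (pderiv ^^ (k - 1)) p)
    - smult (real k * real (k - 1)) ((pderiv ^^ (k - 2)) p)"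
proof -
  have "sqw * p = p - [:0, 1:] * ([:0, 1:] * p)"
    by (simp add: algebra_simps)
  then have *: "(pderiv ^^ k) (sqw * p) = (pderiv ^^ k) p - (pderiv ^^ k) ([:0, 1:] * ([:0, 1:] * p))"
    by (metis (no_types, lifting) diff_conv_add_uminus higher_pderiv_add higher_pderiv_smult smult_minus_left smult_1_left)
  show ?thesis
    unfolding * higher_pderiv_X_mult
    by (cases k) (rule real_poly_eqI; simp add: algebra_simps numeral_2_eq_2)+
qed

text \<open>The associated Legendre function of order \<open>m\<close> without its factor
  \<open>(1 - x^2)^(m/2)\<close>; this keeps every order polynomial.\<close>

definition dleg :: "nat \<Rightarrow> nat \<Rightarrow> real poly" where
  "dleg m n = (pderiv ^^ m) (legendre_poly n)"

lemma dleg_0: "dleg 0 n = legendre_poly n"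
  by (simp add: dleg_def)

lemma pderiv_dleg: "pderiv (dleg m n) = dleg (Suc m) n"
  by (simp add: dleg_def)

lemma pderiv_rodrigues: "pderiv (rodrigues k n) = rodrigues (Suc k) n"
  by (simp add: rodrigues_def)

lemma dleg_eq_rodrigues: "dleg m n = smult ((-1) ^ n / (2 ^ n * fact n)) (rodrigues (m + n) n)"
  by (simp add: dleg_def legendre_poly_def higher_pderiv_smult rodrigues_def funpow_add)

text \<open>The function \<open>u = (1 - x^2)^n\<close> satisfies
  \<open>(1 - x^2) u' + 2 n x u = 0\<close>. Differentiating this \<open>k + 1\<close> times gives
  the equation, so the induction step is one application of \<open>pderiv\<close>.\<close>

lemma rodrigues_ode:
  "(1 - x\<^sup>2) * poly (rodrigues (k + 2) n) x + 2 * (real n - real k - 1) * x * poly (rodrigues (k + 1) n) x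
    + (real k + 1) * (2 * real n - real k) * poly (rodrigues k n) x = 0"
proof -
  define E where "E k = sqw * rodrigues (k + 2) n
     + smult (2 * (real n - real k - 1)) ([:0, 1:] * rodrigues (k + 1) n)
     + smult ((real k + 1) * (2 * real n - real k)) (rodrigues k n)" for k
  have "E k = 0"
  proof (induction k)
    case 0
    have 1: "sqw * rodrigues 1 n + smult (2 * real n) ([:0, 1:] * rodrigues 0 n) = 0"
    proof (cases n)
      case 0
      then show ?thesis by (simp add: rodrigues_def)
    next
      case (Suc j)
      show ?thesis
        by (rule real_poly_eqI, simp add: rodrigues_def Suc pderiv_power_Suc pderiv_sqw del: power_Suc)
           (simp add: algebra_simps power2_eq_square)
    qed
    have "E 0 = pderiv (sqw * rodrigues 1 n + smult (2 * real n) ([:0, 1:] * rodrigues 0 n))"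
      by (rule real_poly_eqI)
         (simp add: E_def pderiv_add pderiv_mult pderiv_smult pderiv_minus pderiv_pCons pderiv_rodrigues numeral_2_eq_2 algebra_simps)
    then show ?case using 1 by simp
  next
    case (Suc k)
    have "E (Suc k) = pderiv (E k)"
      by (rule real_poly_eqI)
         (simp add: E_def pderiv_add pderiv_mult pderiv_smult pderiv_minus pderiv_pCons pderiv_rodrigues numeral_2_eq_2 algebra_simps)
    then show ?case using Suc by simp
  qed
  then have "poly (E k) x = 0" by simp
  then show ?thesis by (simp add: E_def power2_eq_square algebra_simps)
qed

lemma dleg_ode:
  "(1 - x\<^sup>2) * poly (dleg (m + 2) n) x - 2 * (real m + 1) * x * poly (dleg (m + 1) n) x
    + (real n - real m) * (real n + real m + 1) * poly (dleg m n) x = 0"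
proof -
  obtain c where c: "dleg k n = smult c (rodrigues (k + n) n)" for k
    using dleg_eq_rodrigues by blast
  have "c * ((1 - x\<^sup>2) * poly (rodrigues (m + n + 2) n) x - 2 * (real m + 1) * x * poly (rodrigues (m + n + 1) n) x
    + (real n - real m) * (real n + real m + 1) * poly (rodrigues (m + n) n) x) = 0"
    using rodrigues_ode[of x "m + n" n] by (simp add: algebra_simps)
  then show ?thesis by (simp add: c algebra_simps)
qed

lemma degree_sqw_power: "degree (sqw ^ n) = 2 * n"
  by (simp add: degree_power_eq)

lemma rodrigues_nonzero: "k \<le> 2 * n \<Longrightarrow> rodrigues k n \<noteq> 0"
proof
  assume k: "k \<le> 2 * n" and z: "rodrigues k n = 0"
  have "coeff (rodrigues k n) (2 * n - k) = pochhammer (of_nat (Suc (2 * n - k))) k * coeff (sqw ^ n) (2 * n)"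
    using k by (simp add: rodrigues_def coeff_higher_pderiv)
  moreover have "coeff (sqw ^ n) (2 * n) \<noteq> 0"
    using leading_coeff_0_iff[of "sqw ^ n"] by (simp add: degree_sqw_power)
  moreover have "pochhammer (of_nat (Suc (2 * n - k)) :: real) k \<noteq> 0"
    by (metis less_irrefl of_nat_0_less_iff pochhammer_pos zero_less_Suc)
  ultimately show False using z by simp
qed

lemma degree_dleg: "degree (dleg m n) = n - m"
  by (simp add: dleg_eq_rodrigues rodrigues_def degree_higher_pderiv degree_sqw_power)

lemma dleg_nonzero: "m \<le> n \<Longrightarrow> dleg m n \<noteq> 0"
  using rodrigues_nonzero[of "m + n" n] by (simp add: dleg_eq_rodrigues)

lemma dleg_eq_0: "n < m \<Longrightarrow> dleg m n = 0"
proof -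
  assume "n < m"
  then obtain d where d: "m = Suc n + d" by (metis add_Suc_right add_Suc less_imp_Suc_add)
  have "degree (dleg n n) = 0" by (simp add: degree_dleg)
  then have "dleg (Suc n) n = 0"
    by (metis pderiv_dleg pderiv_eq_0_iff)
  moreover have "dleg (Suc n + d) n = (pderiv ^^ d) (dleg (Suc n) n)"
    by (simp only: dleg_def add.commute[of "Suc n"] funpow_add comp_apply)
  ultimately show ?thesis using d by simp
qed

text \<open>One derivative of \<open>(1 - x^2)^(n+1)\<close> is
  \<open>- 2 (n + 1) x (1 - x^2)^n\<close>; the remaining \<open>k\<close> derivatives follow
  Leibniz' rule for the factor \<open>x\<close>.\<close>

lemma rodrigues_Suc_Suc:
  "rodrigues (Suc k) (Suc n) = smult (- 2 * real (Suc n)) ([:0, 1:] * rodrigues k n + smult (real k) (rodrigues (k - 1) n))"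
proof -
  have "pderiv (sqw ^ Suc n) = smult (- 2 * real (Suc n)) ([:0, 1:] * sqw ^ n)"
    by (intro real_poly_eqI) (simp only: pderiv_power_Suc pderiv_sqw, simp add: algebra_simps)
  then have "rodrigues (Suc k) (Suc n) = (pderiv ^^ k) (smult (- 2 * real (Suc n)) ([:0, 1:] * sqw ^ n))"
    unfolding rodrigues_def funpow_Suc_right comp_apply by (rule arg_cong)
  then show ?thesis
    by (simp only: higher_pderiv_smult higher_pderiv_X_mult rodrigues_def)
qed

text \<open>Expresses the normalising constants of two consecutive degrees by a single
  \<open>c\<close>, so that recurrences can be proved for \<open>rodrigues\<close> and then
  scaled.\<close>

lemma dleg_scaling:
  obtains c where "\<And>k. dleg k n = smult c (rodrigues (k + n) n)"
    and "\<And>k. dleg k (Suc n) = smult (- c / (2 * (real n + 1))) (rodrigues (k + Suc n) (Suc n))"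
proof
  show "dleg k n = smult ((-1) ^ n / (2 ^ n * fact n)) (rodrigues (k + n) n)" for k
    by (rule dleg_eq_rodrigues)
  have "(-1) ^ Suc n / (2 ^ Suc n * fact (Suc n)) = - ((-1) ^ n / (2 ^ n * fact n)) / (2 * (real n + 1))"
    by (simp add: field_simps)
  then show "dleg k (Suc n) = smult (- ((-1) ^ n / (2 ^ n * fact n)) / (2 * (real n + 1)))
      (rodrigues (k + Suc n) (Suc n))" for k
    by (simp only: dleg_eq_rodrigues)
qed

lemma dleg_Suc_Suc:
  "poly (dleg 1 (Suc n)) x = x * poly (dleg 1 n) x + (real n + 1) * poly (dleg 0 n) x"
proof -
  obtain c where c: "\<And>k. dleg k n = smult c (rodrigues (k + n) n)"
    "\<And>k. dleg k (Suc n) = smult (- c / (2 * (real n + 1))) (rodrigues (k + Suc n) (Suc n))"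
    using dleg_scaling[of n] by blast
  have r: "poly (rodrigues (Suc (Suc n)) (Suc n)) x = - (2 * (real n + 1)) *
      (x * poly (rodrigues (Suc n) n) x + (real n + 1) * poly (rodrigues n n) x)"
    by (simp add: rodrigues_Suc_Suc[of "Suc n" n] algebra_simps)
  have "real n + 1 \<noteq> 0" by linarith
  then have "- c / (2 * (real n + 1)) * poly (rodrigues (Suc (Suc n)) (Suc n)) x =
     c * (x * poly (rodrigues (Suc n) n) x + (real n + 1) * poly (rodrigues n n) x)"
    unfolding r by (simp only: minus_mult_minus mult_minus_left mult_minus_right minus_divide_left[symmetric]
      times_divide_eq_left nonzero_mult_div_cancel_left) (simp add: field_simps)
  then show ?thesis
    by (simp add: c algebra_simps)
qed

text \<open>\<open>rodrigues (Suc n) (Suc n)\<close> is computed twice: by differentiating the power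
  once and by Leibniz' rule for \<open>sqw * sqw ^ n\<close>. Eliminating
  \<open>rodrigues (n - 1) n\<close> from the two expressions leaves the recurrence.\<close>

lemma sqw_dleg_1:
  "(1 - x\<^sup>2) * poly (dleg 1 n) x = (real n + 1) * (x * poly (dleg 0 n) x - poly (dleg 0 (Suc n)) x)"
proof -
  have r1: "poly (rodrigues (Suc n) (Suc n)) x = - 2 * (real n + 1) * (x * poly (rodrigues n n) x + n * poly (rodrigues (n - 1) n) x)"
    by (simp add: rodrigues_Suc_Suc algebra_simps)
  have "rodrigues (Suc n) (Suc n) = (pderiv ^^ Suc n) (sqw * sqw ^ n)"
    by (simp only: rodrigues_def power_Suc)
  then have r2: "poly (rodrigues (Suc n) (Suc n)) x = (1 - x\<^sup>2) * poly (rodrigues (Suc n) n) x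
     - 2 * (real n + 1) * x * poly (rodrigues n n) x - (real n + 1) * n * poly (rodrigues (n - 1) n) x"
    by (simp only: higher_pderiv_sqw_mult) (simp add: rodrigues_def power2_eq_square algebra_simps)
  have r3: "(1 - x\<^sup>2) * poly (rodrigues (Suc n) n) x =
     (real n + 1) * x * poly (rodrigues n n) x + poly (rodrigues (Suc n) (Suc n)) x / 2"
    using r1 r2 by (simp add: algebra_simps)
  obtain c where c: "\<And>k. dleg k n = smult c (rodrigues (k + n) n)"
    "\<And>k. dleg k (Suc n) = smult (- c / (2 * (real n + 1))) (rodrigues (k + Suc n) (Suc n))"
    using dleg_scaling[of n] by blast
  define a where "a = real n + 1"
  have "a \<noteq> 0" unfolding a_def by linarith
  then have d: "(real n + 1) * poly (dleg 0 (Suc n)) x = - c * (poly (rodrigues (Suc n) (Suc n)) x / 2)"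
    unfolding c(2) a_def[symmetric] by simp
  have "(1 - x\<^sup>2) * poly (dleg 1 n) x = c * ((1 - x\<^sup>2) * poly (rodrigues (Suc n) n) x)"
    by (simp add: c(1))
  also have "\<dots> = c * ((real n + 1) * x * poly (rodrigues n n) x + poly (rodrigues (Suc n) (Suc n)) x / 2)"
    by (simp only: r3)
  also have "\<dots> = (real n + 1) * x * (c * poly (rodrigues n n) x) - - c * (poly (rodrigues (Suc n) (Suc n)) x / 2)"
    by (simp add: algebra_simps)
  also have "\<dots> = (real n + 1) * x * poly (dleg 0 n) x - (real n + 1) * poly (dleg 0 (Suc n)) x"
    unfolding d by (simp add: c(1))
  finally show ?thesis
    by (simp add: algebra_simps)
qed

text \<open>At \<open>x = 1\<close> the left side of \<open>sqw_dleg_1\<close> vanishes, so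
  consecutive values agree.\<close>

lemma legendre_poly_1: "poly (legendre_poly n) 1 = 1"
proof (induction n)
  case (Suc n)
  then show ?case using sqw_dleg_1[of 1 n] by (simp add: dleg_0)
qed (simp add: legendre_poly_def rodrigues_def)

lemma legendre_poly_minus_1: "poly (legendre_poly n) (-1) = (-1) ^ n"
proof (induction n)
  case (Suc n)
  then show ?case using sqw_dleg_1[of "-1" n] by (simp add: dleg_0)
qed (simp add: legendre_poly_def rodrigues_def)

text \<open>By the Legendre equations the derivatives of the summands telescope, so the sum is constant.\<close>

lemma legendre_addition:
  fixes x :: real
  shows "(poly (legendre_poly n) x)\<^sup>2
     + 2 * (\<Sum>m=1..n. fact (n - m) / fact (n + m) * (1 - x\<^sup>2) ^ m * (poly (dleg m n) x)\<^sup>2) = 1"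
proof -
  define c :: "nat \<Rightarrow> real" where "c m = fact (n - m) / fact (n + m)" for m
  define A :: "real poly" where
    "A = (dleg 0 n)\<^sup>2 + smult 2 (\<Sum>m=1..n. smult (c m) (sqw ^ m * (dleg m n)\<^sup>2))"
  define B where "B m = smult (c m) (sqw ^ m * dleg m n * dleg (Suc m) n)" for m
  have t: "pderiv (smult (c (Suc m)) (sqw ^ Suc m * (dleg (Suc m) n)\<^sup>2)) = B (Suc m) - B m" if "Suc m \<le> n" for m
  proof -
    \<comment> \<open>The ratio of consecutive factorial weights is the zeroth-order coefficient in
      \<open>dleg_ode\<close>; this is what turns the derivative into a difference of consecutive
      \<open>B\<close>.\<close>
    have "c m = c (Suc m) * ((real n - real m) * (real n + real m + 1))"
    proof -
      have "n - m = Suc (n - Suc m)" using that by simp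
      then have "fact (n - m) = (real n - real m) * fact (n - Suc m)"
        using that by (simp add: of_nat_diff)
      moreover define k where "k = real n + real m + 1"
      moreover have "fact (n + Suc m) = k * fact (n + m)"
        by (simp add: k_def algebra_simps)
      moreover have "k \<noteq> 0" unfolding k_def by linarith
      ultimately show ?thesis unfolding c_def k_def[symmetric] by simp
    qed
    moreover have "(real n - real m) * (real n + real m + 1) * poly (dleg m n) y =
       2 * (real m + 1) * y * poly (dleg (m + 1) n) y - (1 - y\<^sup>2) * poly (dleg (m + 2) n) y" for y
      using dleg_ode[of y m n] by linarith
    ultimately have Bm: "poly (B m) y = c (Suc m) * (1 - y\<^sup>2) ^ m * poly (dleg (Suc m) n) y *
       (2 * (real m + 1) * y * poly (dleg (m + 1) n) y - (1 - y\<^sup>2) * poly (dleg (m + 2) n) y)" for y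
      by (simp add: B_def mult.assoc poly_power mult_ac power2_eq_square del: power_Suc)
    have "poly (pderiv (smult (c (Suc m)) (sqw ^ Suc m * (dleg (Suc m) n)\<^sup>2))) y = poly (B (Suc m) - B m) y" for y
      unfolding poly_diff Bm
      by (simp only: pderiv_smult pderiv_mult pderiv_power_Suc power2_eq_square pderiv_sqw pderiv_dleg B_def)
         (simp add: power2_eq_square algebra_simps)
    then show ?thesis by (rule real_poly_eqI)
  qed
  have "pderiv (\<Sum>m=1..n. smult (c m) (sqw ^ m * (dleg m n)\<^sup>2)) = (\<Sum>m<n. B (Suc m) - B m)"
  proof -
    have "(\<Sum>m=1..n. smult (c m) (sqw ^ m * (dleg m n)\<^sup>2)) = (\<Sum>m<n. smult (c (Suc m)) (sqw ^ Suc m * (dleg (Suc m) n)\<^sup>2))"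
      by (rule sum.reindex_bij_witness[of _ Suc "\<lambda>m. m - 1"]) auto
    then show ?thesis
      using t by (simp add: higher_pderiv_sum[of 1, simplified] del: power_Suc)
  qed
  also have "\<dots> = B n - B 0" by (rule sum_lessThan_telescope)
  also have "B n = 0" by (simp add: B_def dleg_eq_0)
  finally have "pderiv A = 0"
    by (intro real_poly_eqI) (simp add: A_def B_def c_def pderiv_add pderiv_smult power2_eq_square pderiv_mult pderiv_dleg)
  then obtain h where h: "A = [:h:]" using pderiv_iszero by blast
  \<comment> \<open>All terms with \<open>m \<ge> 1\<close> carry a factor \<open>1 - x^2\<close>,
    so the constant is read off at \<open>x = 1\<close>.\<close>
  have "poly A 1 = 1"
    by (simp add: A_def poly_sum poly_power dleg_0 legendre_poly_1 power_0_left)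
  then have "poly A x = 1" using h by simp
  then show ?thesis
    by (simp add: A_def poly_sum poly_power dleg_0 c_def algebra_simps power2_eq_square)
qed

section \<open>Orthonormal polynomials and the Markov inequality\<close>

text \<open>Products with \<open>[:0, 1:]\<close> and \<open>sqw\<close> are from here on kept as
  products, so that the rules for integrals of products still match them.\<close>

declare mult_pCons_left [simp del] mult_pCons_right [simp del]

section \<open>Integrals of polynomials and the \<open>L^2\<close> norm on [-1, 1]\<close>

definition pint :: "real \<Rightarrow> real \<Rightarrow> real poly \<Rightarrow> real" where
  "pint a b p = integral {a..b} (poly p)"

abbreviation qint :: "real poly \<Rightarrow> real" where
  "qint \<equiv> pint (-1) 1"

lemma poly_integrable: "poly (p :: real poly) integrable_on {a..b}"
  by (intro integrable_continuous_interval continuous_intros)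

lemma pint_add: "pint a b (p + q) = pint a b p + pint a b q"
  unfolding pint_def poly_add
  by (intro Henstock_Kurzweil_Integration.integral_add poly_integrable)

lemma pint_smult: "pint a b (smult c p) = c * pint a b p"
  unfolding pint_def poly_smult by simp

lemma pint_0: "pint a b 0 = 0"
  using pint_smult[of a b 0 0] by simp

lemma pint_diff: "pint a b (p - q) = pint a b p - pint a b q"
  unfolding pint_def poly_diff
  by (intro Henstock_Kurzweil_Integration.integral_diff poly_integrable)

lemma pint_minus: "pint a b (- p) = - pint a b p"
  using pint_smult[of a b "-1" p] by simp

lemma pint_sum: "pint a b (\<Sum>i\<in>I. f i) = (\<Sum>i\<in>I. pint a b (f i))"
  by (induction I rule: infinite_finite_induct) (simp_all add: pint_0 pint_add)

lemma pint_pderiv: "a \<le> b \<Longrightarrow> pint a b (pderiv p) = poly p b - poly p a"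
  unfolding pint_def
  by (intro integral_unique fundamental_theorem_of_calculus)
     (auto simp: has_real_derivative_iff_has_vector_derivative[symmetric] intro: poly_DERIV DERIV_subset)

lemma pint_mono: "(\<And>x. x \<in> {a..b} \<Longrightarrow> poly p x \<le> poly q x) \<Longrightarrow> pint a b p \<le> pint a b q"
  unfolding pint_def by (intro integral_le poly_integrable) auto

lemma pint_nonneg: "(\<And>x. x \<in> {a..b} \<Longrightarrow> 0 \<le> poly p x) \<Longrightarrow> 0 \<le> pint a b p"
  using pint_mono[of a b 0 p] by (simp add: pint_0)

lemma pint_square_nonneg: "0 \<le> pint a b (p * p)"
  by (rule pint_nonneg) simp

lemma pint_by_parts:
  "a \<le> b \<Longrightarrow> pint a b (pderiv p * q) = poly p b * poly q b - poly p a * poly q a - pint a b (p * pderiv q)"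
  using pint_pderiv[of a b "p * q"] by (simp add: pderiv_mult pint_add mult_ac)

text \<open>A nonnegative continuous function with integral 0 vanishes on the interval, and a
  polynomial with infinitely many roots is 0.\<close>

lemma poly_zero_of_pint_square:
  assumes "a < b" "pint a b (p * p) = 0"
  shows "p = 0"
proof -
  have "poly (p * p) x = 0" if "x \<in> {a..b}" for x
    by (rule has_integral_0_cbox_imp_0[of a b "poly (p * p)" x])
       (use assms that poly_integrable[of "p * p" a b] in
         \<open>auto simp: pint_def has_integral_iff intro!: continuous_intros\<close>)
  then have "{a..b} \<subseteq> {x. poly p x = 0}" by auto
  moreover have "infinite {a..b}" using assms by simp
  ultimately show "p = 0"
    using poly_roots_finite finite_subset by blast
qed

text \<open>The Gram determinant argument is applied to the polynomial \<open>\<langle>q,q\<rangle> p - \<langle>p,q\<rangle> q\<close>.\<close>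

lemma pint_Cauchy_Schwarz: "(pint a b (p * q))\<^sup>2 \<le> pint a b (p * p) * pint a b (q * q)"
proof (cases "pint a b (q * q) = 0")
  case True
  show ?thesis
  proof (cases "a < b")
    case True
    then have "q = 0" using \<open>pint a b (q * q) = 0\<close> by (rule poly_zero_of_pint_square)
    then show ?thesis by (simp add: pint_0)
  next
    case False
    then have "pint a b f = 0" for f
      unfolding pint_def by (cases "a = b") auto
    then show ?thesis by simp
  qed
next
  case False
  let ?A = "pint a b (p * p)" and ?B = "pint a b (p * q)" and ?C = "pint a b (q * q)"
  have "0 \<le> pint a b ((smult ?C p - smult ?B q) * (smult ?C p - smult ?B q))"
    by (rule pint_square_nonneg)
  also have "(smult ?C p - smult ?B q) * (smult ?C p - smult ?B q) =
      smult (?C * ?C) (p * p) - smult (2 * ?B * ?C) (p * q) + smult (?B * ?B) (q * q)"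
    by (intro real_poly_eqI) (simp add: algebra_simps)
  also have "pint a b \<dots> = ?C * (?A * ?C - ?B\<^sup>2)"
    by (simp add: pint_diff pint_add pint_smult power2_eq_square algebra_simps)
  finally have "0 \<le> ?C * (?A * ?C - ?B\<^sup>2)" .
  moreover have "0 < ?C" using pint_square_nonneg[of a b q] False by linarith
  ultimately show ?thesis by (simp add: zero_le_mult_iff)
qed

definition pnorm :: "real poly \<Rightarrow> real" where
  "pnorm p = sqrt (qint (p * p))"

lemma pnorm_nonneg: "0 \<le> pnorm p"
  by (simp add: pnorm_def pint_square_nonneg)

lemma pnorm_0: "pnorm 0 = 0"
  by (simp add: pnorm_def pint_0)

lemma pnorm_square: "(pnorm p)\<^sup>2 = qint (p * p)"
  by (simp add: pnorm_def pint_square_nonneg)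

lemma pnorm_smult: "pnorm (smult c p) = \<bar>c\<bar> * pnorm p"
  by (simp add: pnorm_def pint_smult real_sqrt_mult flip: mult.assoc)

lemma qint_le_pnorm: "qint (p * q) \<le> pnorm p * pnorm q"
proof -
  have "\<bar>qint (p * q)\<bar> = sqrt ((qint (p * q))\<^sup>2)" by simp
  also have "\<dots> \<le> sqrt (qint (p * p) * qint (q * q))"
    by (intro real_sqrt_le_mono pint_Cauchy_Schwarz)
  finally show ?thesis by (simp add: pnorm_def real_sqrt_mult)
qed

lemma pnorm_triangle: "pnorm (p + q) \<le> pnorm p + pnorm q"
proof (rule power2_le_imp_le)
  have "(p + q) * (p + q) = p * p + q * q + smult 2 (p * q)"
    by (intro real_poly_eqI) (simp add: algebra_simps)
  then have "(pnorm (p + q))\<^sup>2 = (pnorm p)\<^sup>2 + (pnorm q)\<^sup>2 + 2 * qint (p * q)"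
    by (simp add: pnorm_square pint_add pint_smult)
  also have "\<dots> \<le> (pnorm p + pnorm q)\<^sup>2"
    using qint_le_pnorm[of p q] by (simp add: power2_sum)
  finally show "(pnorm (p + q))\<^sup>2 \<le> (pnorm p + pnorm q)\<^sup>2" .
qed (simp add: pnorm_nonneg)

lemma pnorm_sum: "pnorm (\<Sum>i\<in>I. f i) \<le> (\<Sum>i\<in>I. pnorm (f i))"
proof (induction I rule: infinite_finite_induct)
  case (insert i I)
  then show ?case using pnorm_triangle[of "f i" "\<Sum>i\<in>I. f i"] by simp
qed (simp_all add: pnorm_0)

text \<open>Elimination of the leading coefficient. It is stated for arbitrary families because it
  serves \<open>legendre_poly\<close> and \<open>nleg\<close> as well as the shifted derivatives
  \<open>dleg 1 (Suc j)\<close> and \<open>dleg \<mu> (\<mu> + j)\<close>.\<close>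

lemma poly_graded_basis:
  fixes f :: "nat \<Rightarrow> 'a::field poly"
  assumes "\<And>j. degree (f j) = j" "\<And>j. f j \<noteq> 0" "degree p \<le> n"
  shows "\<exists>c. p = (\<Sum>j\<le>n. smult (c j) (f j))"
  using assms(3)
proof (induction n arbitrary: p)
  case 0
  then obtain a where "p = [:a:]" by (auto elim: degree_eq_zeroE)
  moreover obtain b where b: "f 0 = [:b:]" using assms(1)[of 0] by (auto elim: degree_eq_zeroE)
  moreover have "b \<noteq> 0" using assms(2)[of 0] b by auto
  ultimately show ?case by (intro exI[of _ "\<lambda>_. a / b"]) simp
next
  case (Suc n)
  define d where "d = coeff p (Suc n) / lead_coeff (f (Suc n))"
  have "coeff (p - smult d (f (Suc n))) i = 0" if "i > n" for i
  proof (cases "i = Suc n")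
    case True
    have "coeff (f (Suc n)) (Suc n) \<noteq> 0" using assms(1,2)[of "Suc n"] by (metis leading_coeff_0_iff)
    then show ?thesis using True assms(1)[of "Suc n"] by (simp add: d_def)
  next
    case False
    then show ?thesis using that Suc.prems assms(1)[of "Suc n"] by (simp add: coeff_eq_0)
  qed
  then have "degree (p - smult d (f (Suc n))) \<le> n" by (intro degree_le) auto
  then obtain c where c: "p - smult d (f (Suc n)) = (\<Sum>j\<le>n. smult (c j) (f j))"
    using Suc.IH by blast
  show ?case
    by (rule exI[of _ "c(Suc n := d)"]) (use c in \<open>simp add: algebra_simps\<close>)
qed

text \<open>Legendre's equation in divergence form: the derivative of
  \<open>sqw ^ Suc m * dleg (Suc m) n\<close> is a multiple of \<open>sqw ^ m * dleg m n\<close>.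
  One integration by parts has no boundary terms because of \<open>sqw\<close>. The case
  \<open>m = 0\<close> is the energy identity.\<close>

lemma dleg_orth_step:
  "qint (sqw ^ Suc m * dleg (Suc m) n * dleg (Suc m) k) =
    (real n - real m) * (real n + real m + 1) * qint (sqw ^ m * dleg m n * dleg m k)"
proof -
  have e: "pderiv (sqw ^ Suc m * dleg (Suc m) n) =
     smult (- ((real n - real m) * (real n + real m + 1))) (sqw ^ m * dleg m n)"
  proof (rule real_poly_eqI)
    fix x
    have "poly (pderiv (sqw ^ Suc m * dleg (Suc m) n)) x = (1 - x\<^sup>2) ^ m *
        ((1 - x\<^sup>2) * poly (dleg (m + 2) n) x - 2 * (real m + 1) * x * poly (dleg (m + 1) n) x)"
      by (simp only: pderiv_mult pderiv_power_Suc pderiv_sqw pderiv_dleg)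
         (simp add: power2_eq_square algebra_simps)
    also have "\<dots> = (1 - x\<^sup>2) ^ m * (- ((real n - real m) * (real n + real m + 1) * poly (dleg m n) x))"
      using dleg_ode[of x m n] by (metis add_eq_0_iff2 minus_minus)
    finally show "poly (pderiv (sqw ^ Suc m * dleg (Suc m) n)) x =
        poly (smult (- ((real n - real m) * (real n + real m + 1))) (sqw ^ m * dleg m n)) x"
      by (simp add: poly_power power2_eq_square algebra_simps)
  qed
  have "qint (pderiv (sqw ^ Suc m * dleg (Suc m) n) * dleg m k) =
     - qint (sqw ^ Suc m * dleg (Suc m) n * dleg (Suc m) k)"
    by (subst pint_by_parts) (simp_all add: pderiv_dleg)
  then show ?thesis unfolding e by (simp add: pint_smult pint_minus)
qed

text \<open>The energy form is symmetric in \<open>n\<close> and \<open>k\<close>, while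
  \<open>dleg_orth_step\<close> evaluates it with the eigenvalue of either index; distinct
  eigenvalues leave only 0.\<close>

lemma legendre_orth_neq:
  assumes "n \<noteq> k"
  shows "qint (legendre_poly n * legendre_poly k) = 0"
proof -
  have "real n * (real n + 1) * qint (dleg 0 n * dleg 0 k) = real k * (real k + 1) * qint (dleg 0 k * dleg 0 n)"
    using dleg_orth_step[of 0 n k] dleg_orth_step[of 0 k n] by (simp add: mult_ac)
  then have "(real n * (real n + 1) - real k * (real k + 1)) * qint (dleg 0 n * dleg 0 k) = 0"
    by (simp add: algebra_simps)
  moreover have "real n * (real n + 1) - real k * (real k + 1) = (real n - real k) * (real n + real k + 1)"
    by (simp add: algebra_simps)
  ultimately show ?thesis using assms by (simp add: dleg_0)
qed

lemma degree_legendre_poly: "degree (legendre_poly n) = n"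
  using degree_dleg[of 0 n] by (simp add: dleg_0)

lemma legendre_poly_nonzero: "legendre_poly n \<noteq> 0"
  using dleg_nonzero[of 0 n] by (simp add: dleg_0)

lemma legendre_orth_lower_degree:
  assumes "degree q < n"
  shows "qint (legendre_poly n * q) = 0"
proof -
  obtain c where "q = (\<Sum>j\<le>n - 1. smult (c j) (legendre_poly j))"
    using poly_graded_basis[of legendre_poly q "n - 1", OF degree_legendre_poly legendre_poly_nonzero] assms
    by fastforce
  then show ?thesis using assms
    by (simp add: sum_distrib_left pint_sum pint_smult legendre_orth_neq)
qed

text \<open>Two integrals known from boundary values, that of \<open>P_{n+1}' P_n\<close> and that
  of the derivative of \<open>x P_n^2\<close>, are both 2. With the recurrence
  \<open>dleg_Suc_Suc\<close> they determine the norm.\<close>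

lemma legendre_norm: "qint (legendre_poly n * legendre_poly n) = 2 / (2 * real n + 1)"
proof -
  let ?P = "legendre_poly n" and ?Q = "legendre_poly (Suc n)"
  have "pderiv ?Q = [:0, 1:] * pderiv ?P + smult (real n + 1) ?P"
    using dleg_Suc_Suc[of n] by (intro real_poly_eqI) (simp add: dleg_def algebra_simps)
  then have 1: "qint (pderiv ?Q * ?P) = qint ([:0, 1:] * pderiv ?P * ?P) + (real n + 1) * qint (?P * ?P)"
    by (simp only: distrib_right pint_add pint_smult mult_smult_left)
  have "qint (?Q * pderiv ?P) = 0"
    by (rule legendre_orth_lower_degree) (simp add: degree_pderiv degree_legendre_poly)
  then have 2: "qint (pderiv ?Q * ?P) = 2"
    by (subst pint_by_parts) (simp_all add: legendre_poly_1 legendre_poly_minus_1 flip: power_mult_distrib)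
  have "qint (pderiv ([:0, 1:] * (?P * ?P))) = 2"
    by (subst pint_pderiv) (simp_all add: legendre_poly_1 legendre_poly_minus_1 flip: power_mult_distrib)
  moreover have "pderiv ([:0, 1:] * (?P * ?P)) = ?P * ?P + smult 2 ([:0, 1:] * pderiv ?P * ?P)"
    by (intro real_poly_eqI) (simp add: pderiv_mult pderiv_pCons algebra_simps)
  ultimately have "qint (?P * ?P) + 2 * qint ([:0, 1:] * pderiv ?P * ?P) = 2"
    by (simp only: pint_add pint_smult)
  with 1 2 have "qint (?P * ?P) * (2 * real n + 1) = 2" by (simp add: algebra_simps)
  then show ?thesis by (simp add: field_simps)
qed

lemma dleg_orth:
  assumes "m \<le> n"
  shows "qint (sqw ^ m * dleg m n * dleg m k) =
    (if n = k then 2 / (2 * real n + 1) * (fact (n + m) / fact (n - m)) else 0)"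
  using assms
proof (induction m)
  case 0
  then show ?case by (simp add: dleg_0 legendre_norm legendre_orth_neq)
next
  case (Suc m)
  have "n - m = Suc (n - Suc m)" using Suc.prems by simp
  then have f: "fact (n - m) = (real n - real m) * fact (n - Suc m)"
    using Suc.prems by (simp add: of_nat_diff)
  have g: "fact (n + Suc m) = (real n + real m + 1) * fact (n + m)" by (simp add: algebra_simps)
  have "real n - real m \<noteq> 0" using Suc.prems by simp
  then show ?case unfolding dleg_orth_step g using Suc f by auto
qed

section \<open>Normalised Legendre polynomials, Markov and end point inequalities\<close>

definition nleg :: "nat \<Rightarrow> real poly" where
  "nleg n = smult (sqrt (real n + 1/2)) (legendre_poly n)"

lemma degree_nleg: "degree (nleg n) = n"
  by (simp add: nleg_def degree_legendre_poly)

lemma nleg_orthonormal: "qint (nleg n * nleg k) = (if n = k then 1 else 0)"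
  by (simp add: nleg_def pint_smult legendre_norm legendre_orth_neq field_simps)

lemma nleg_nonzero: "nleg n \<noteq> 0"
  by (simp add: nleg_def legendre_poly_nonzero)

lemma nleg_expansion:
  assumes "degree p \<le> K"
  shows "p = (\<Sum>n\<le>K. smult (qint (p * nleg n)) (nleg n))"
proof -
  obtain c where c: "p = (\<Sum>j\<le>K. smult (c j) (nleg j))"
    using poly_graded_basis[of nleg p K, OF degree_nleg nleg_nonzero] assms by blast
  have "qint (p * nleg n) = c n" if "n \<le> K" for n
    using that by (subst c) (simp add: sum_distrib_right pint_sum pint_smult nleg_orthonormal mult_delta_right)
  then show ?thesis by (subst c) simp
qed

lemma pnorm_nleg_sum:
  assumes "finite I"
  shows "(pnorm (\<Sum>n\<in>I. smult (a n) (nleg n)))\<^sup>2 = (\<Sum>n\<in>I. (a n)\<^sup>2)"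
  using assms unfolding pnorm_square
  by (simp add: sum_distrib_right sum_distrib_left pint_sum pint_smult nleg_orthonormal power2_eq_square mult_delta_right)

text \<open>Derivatives of Legendre polynomials are orthogonal for the weight
  \<open>1 - x^2\<close>, with the eigenvalues \<open>n (n + 1)\<close> as ratios of the squared
  norms.\<close>

lemma legendre_energy:
  assumes "finite I"
  shows "qint (sqw * pderiv (\<Sum>n\<in>I. smult (a n) (nleg n)) * pderiv (\<Sum>n\<in>I. smult (a n) (nleg n))) =
    (\<Sum>n\<in>I. real n * (real n + 1) * (a n)\<^sup>2)"
proof -
  have *: "qint (pderiv (nleg n) * (pderiv (nleg k) * sqw)) = (if n = k then real n * (real n + 1) else 0)" for n k
    using dleg_orth_step[of 0 n k] nleg_orthonormal[of n k]
    by (auto simp add: nleg_def pderiv_smult pint_smult dleg_def mult_ac split: if_splits)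
  have "pderiv (\<Sum>n\<in>I. smult (a n) (nleg n)) = (\<Sum>n\<in>I. smult (a n) (pderiv (nleg n)))"
    using higher_pderiv_sum[of 1 "\<lambda>n. smult (a n) (nleg n)" I] by (simp add: pderiv_smult)
  then show ?thesis using assms
    by (simp add: sum_distrib_left sum_distrib_right pint_sum pint_smult * power2_eq_square
          mult_ac mult_delta_right)
qed

text \<open>In the integration by parts the second derivative is orthogonal to \<open>P_n\<close>,
  having lower degree. Only the end points contribute, and there Legendre's equation gives the
  derivative.\<close>

lemma pnorm_pderiv_nleg: "(pnorm (pderiv (nleg n)))\<^sup>2 = (real n + 1/2) * (real n * (real n + 1))"
proof -
  let ?P = "legendre_poly n"
  have d1: "poly (pderiv ?P) 1 = real n * (real n + 1) / 2"
    using dleg_ode[of 1 0 n] by (simp add: dleg_def legendre_poly_1)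
  have d2: "poly (pderiv ?P) (-1) = - real n * (real n + 1) / 2 * (-1) ^ n"
    using dleg_ode[of "-1" 0 n] by (simp add: dleg_def legendre_poly_minus_1)
  have "qint (?P * pderiv (pderiv ?P)) = 0"
  proof (cases "n = 0")
    case True
    then have "pderiv ?P = 0" using degree_legendre_poly[of n] pderiv_eq_0_iff by metis
    then show ?thesis by (simp add: pint_0)
  next
    case False
    then show ?thesis
      by (intro legendre_orth_lower_degree) (simp add: degree_pderiv degree_legendre_poly)
  qed
  then have "qint (pderiv ?P * pderiv ?P) = real n * (real n + 1)"
    by (subst pint_by_parts, simp, cases "even n")
       (simp_all add: d1 d2 legendre_poly_1 legendre_poly_minus_1)
  then show ?thesis unfolding pnorm_square
    by (simp add: nleg_def pderiv_smult pint_smult flip: mult.assoc)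
qed

text \<open>The derivative is expanded in the derivatives of the basis and estimated by
  Cauchy-Schwarz. The sum of their squared norms is \<open>K (K + 1)^2 (K + 2) / 4\<close>, of order
  \<open>K^4\<close>, whence the factor \<open>K^2\<close>.\<close>

lemma Markov_inequality_L2:
  assumes "degree p \<le> K"
  shows "pnorm (pderiv p) \<le> 2 * (real K)\<^sup>2 * pnorm p"
proof (cases "K = 0")
  case True
  then show ?thesis using assms pderiv_eq_0_iff[of p] by (simp add: pnorm_0)
next
  case False
  define a where "a n = qint (p * nleg n)" for n
  have p: "p = (\<Sum>n\<le>K. smult (a n) (nleg n))"
    unfolding a_def by (rule nleg_expansion) fact
  have "pderiv p = (\<Sum>n\<le>K. smult (a n) (pderiv (nleg n)))"
    using higher_pderiv_sum[of 1 "\<lambda>n. smult (a n) (nleg n)" "{..K}"] p by (simp add: pderiv_smult)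
  then have "pnorm (pderiv p) \<le> (\<Sum>n\<le>K. \<bar>a n\<bar> * pnorm (pderiv (nleg n)))"
    using pnorm_sum[of "\<lambda>n. smult (a n) (pderiv (nleg n))" "{..K}"] by (simp add: pnorm_smult)
  then have "(pnorm (pderiv p))\<^sup>2 \<le> (\<Sum>n\<le>K. \<bar>a n\<bar> * pnorm (pderiv (nleg n)))\<^sup>2"
    by (intro power_mono pnorm_nonneg)
  also have "\<dots> \<le> (\<Sum>n\<le>K. \<bar>a n\<bar>\<^sup>2) * (\<Sum>n\<le>K. (pnorm (pderiv (nleg n)))\<^sup>2)"
    by (rule Cauchy_Schwarz_ineq_sum)
  also have "(\<Sum>n\<le>K. \<bar>a n\<bar>\<^sup>2) = (pnorm p)\<^sup>2"
    using pnorm_nleg_sum[of "{..K}" a] p by simp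
  also have "(\<Sum>n\<le>K. (pnorm (pderiv (nleg n)))\<^sup>2) = real K * (real K + 1)\<^sup>2 * (real K + 2) / 4"
    unfolding pnorm_pderiv_nleg
    by (induction K) (simp_all add: field_simps power2_eq_square)
  also have "(pnorm p)\<^sup>2 * \<dots> \<le> (pnorm p)\<^sup>2 * (4 * real K ^ 4)"
  proof (rule mult_left_mono)
    have K: "1 \<le> real K" using False by simp
    have "(real K + 1)\<^sup>2 \<le> (2 * real K)\<^sup>2" using K by (intro power_mono) auto
    then have "real K * (real K + 1)\<^sup>2 * (real K + 2) \<le> real K * (2 * real K)\<^sup>2 * (3 * real K)"
      using K by (intro mult_mono) auto
    also have "\<dots> = 12 * real K ^ 4"
      by (simp add: power2_eq_square power4_eq_xxxx mult_ac)
    finally show "real K * (real K + 1)\<^sup>2 * (real K + 2) / 4 \<le> 4 * real K ^ 4"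
      using zero_le_power[of "real K" 4] by linarith
  qed simp
  also have "\<dots> = (2 * (real K)\<^sup>2 * pnorm p)\<^sup>2"
    by (simp add: power_mult_distrib power4_eq_xxxx power2_eq_square)
  finally show ?thesis
    by (rule power2_le_imp_le) (simp add: pnorm_nonneg)
qed

text \<open>Cauchy-Schwarz with the value of the reproducing kernel at an end point,
  \<open>(K + 1)^2 / 2\<close>.\<close>

lemma endpoint_bound:
  assumes "degree p \<le> K" "1 \<le> K" "x \<in> {-1, 1}"
  shows "\<bar>poly p x\<bar> \<le> 2 * real K * pnorm p"
proof (rule power2_le_imp_le)
  define a where "a n = qint (p * nleg n)" for n
  have p: "p = (\<Sum>n\<le>K. smult (a n) (nleg n))"
    unfolding a_def by (rule nleg_expansion) fact
  have n: "(poly (nleg n) x)\<^sup>2 = real n + 1/2" for n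
    using assms(3) by (auto simp: nleg_def power_mult_distrib legendre_poly_1 legendre_poly_minus_1
      simp flip: power_mult)
  have "\<bar>poly p x\<bar>\<^sup>2 = (\<Sum>n\<le>K. a n * poly (nleg n) x)\<^sup>2"
    by (subst p) (simp add: poly_sum)
  also have "\<dots> \<le> (\<Sum>n\<le>K. (a n)\<^sup>2) * (\<Sum>n\<le>K. (poly (nleg n) x)\<^sup>2)"
    by (rule Cauchy_Schwarz_ineq_sum)
  also have "(\<Sum>n\<le>K. (a n)\<^sup>2) = (pnorm p)\<^sup>2"
    using pnorm_nleg_sum[of "{..K}" a] p by simp
  also have "(\<Sum>n\<le>K. (poly (nleg n) x)\<^sup>2) = (real K + 1)\<^sup>2 / 2"
    unfolding n by (induction K) (simp_all add: field_simps power2_eq_square)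
  also have "(pnorm p)\<^sup>2 * \<dots> \<le> (pnorm p)\<^sup>2 * (2 * real K)\<^sup>2"
  proof (rule mult_left_mono)
    have "(real K + 1)\<^sup>2 \<le> (2 * real K)\<^sup>2" using assms(2) by (intro power_mono) auto
    then show "(real K + 1)\<^sup>2 / 2 \<le> (2 * real K)\<^sup>2"
      by (smt (verit) field_sum_of_halves zero_le_power2)
  qed simp
  finally show "\<bar>poly p x\<bar>\<^sup>2 \<le> (2 * real K * pnorm p)\<^sup>2"
    by (simp add: power_mult_distrib mult_ac)
qed (simp add: pnorm_nonneg)

section \<open>Oscillatory integrals of polynomials\<close>

definition oint :: "real \<Rightarrow> real poly \<Rightarrow> complex" where
  "oint \<kappa> p = integral {-1..1} (\<lambda>x. of_real (poly p x) * exp (\<i> * of_real (\<kappa> * x)))"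

lemma oint_integrable:
  "(\<lambda>x. of_real (poly p x) * exp (\<i> * of_real (\<kappa> * x))) integrable_on {a..b::real}"
  by (intro integrable_continuous_interval continuous_intros)

lemma oint_add: "oint \<kappa> (p + q) = oint \<kappa> p + oint \<kappa> q"
  unfolding oint_def poly_add of_real_add distrib_right
  by (intro Henstock_Kurzweil_Integration.integral_add oint_integrable)

lemma oint_diff: "oint \<kappa> (p - q) = oint \<kappa> p - oint \<kappa> q"
  unfolding oint_def poly_diff of_real_diff left_diff_distrib
  by (intro Henstock_Kurzweil_Integration.integral_diff oint_integrable)

lemma oint_smult: "oint \<kappa> (smult c p) = of_real c * oint \<kappa> p"
  unfolding oint_def poly_smult of_real_mult mult.assoc
  by (simp add: integral_mult_right)

lemma oint_0: "oint \<kappa> 0 = 0"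
  using oint_smult[of \<kappa> 0 0] by simp

lemma oint_sum: "oint \<kappa> (\<Sum>i\<in>I. f i) = (\<Sum>i\<in>I. oint \<kappa> (f i))"
  by (induction I rule: infinite_finite_induct) (simp_all add: oint_0 oint_add)

lemma abs_poly_integrable: "(\<lambda>x. \<bar>poly p x\<bar> :: real) integrable_on {a..b}"
  by (intro integrable_continuous_interval continuous_intros)

lemma norm_oint_le: "cmod (oint \<kappa> p) \<le> integral {-1..1} (\<lambda>x. \<bar>poly p x\<bar>)"
  unfolding oint_def
  by (intro Henstock_Kurzweil_Integration.integral_norm_bound_integral oint_integrable abs_poly_integrable)
     (simp add: norm_mult)

lemma oint_pderiv:
  "oint \<kappa> (pderiv p) = of_real (poly p 1) * exp (\<i> * of_real \<kappa>)
     - of_real (poly p (-1)) * exp (- \<i> * of_real \<kappa>) - \<i> * of_real \<kappa> * oint \<kappa> p"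
proof -
  let ?e = "\<lambda>x. exp (\<i> * of_real (\<kappa> * x))"
  let ?f = "\<lambda>x. of_real (poly (pderiv p) x) * ?e x + \<i> * of_real \<kappa> * (of_real (poly p x) * ?e x)"
  have d: "((\<lambda>x. of_real (poly p x) * ?e x) has_vector_derivative ?f x) (at x within S)" for x S
  proof -
    have 1: "((\<lambda>x. complex_of_real (poly p x)) has_vector_derivative of_real (poly (pderiv p) x)) (at x within S)"
      by (intro has_vector_derivative_of_real)
         (simp add: has_real_derivative_iff_has_vector_derivative[symmetric] DERIV_subset[OF poly_DERIV])
    have "((\<lambda>z. exp (\<i> * of_real \<kappa> * z)) has_field_derivative (\<i> * of_real \<kappa> * exp (\<i> * of_real \<kappa> * of_real x))) (at (of_real x))"
      by (auto intro!: derivative_eq_intros)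
    then have "((\<lambda>x. exp (\<i> * of_real \<kappa> * of_real x)) has_vector_derivative (\<i> * of_real \<kappa> * exp (\<i> * of_real \<kappa> * of_real x))) (at x within S)"
      by (rule has_vector_derivative_real_field)
    then have 2: "(?e has_vector_derivative (\<i> * of_real \<kappa> * ?e x)) (at x within S)"
      by (simp add: mult.assoc)
    show ?thesis
      using has_vector_derivative_mult[OF 1 2] by (simp add: mult_ac add.commute)
  qed
  have "(?f has_integral (of_real (poly p 1) * ?e 1 - of_real (poly p (-1)) * ?e (-1))) {-1..1}"
    by (rule fundamental_theorem_of_calculus) (simp, rule d)
  then have "integral {-1..1} ?f = of_real (poly p 1) * ?e 1 - of_real (poly p (-1)) * ?e (-1)"
    by (rule integral_unique)
  moreover have "integral {-1..1} ?f = oint \<kappa> (pderiv p) + \<i> * of_real \<kappa> * oint \<kappa> p"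
    unfolding oint_def
    by (intro integral_unique has_integral_add has_integral_mult_right integrable_integral oint_integrable)
  ultimately show ?thesis by (simp add: algebra_simps)
qed

text \<open>Optimising the parameter \<open>c\<close> recovers a Cauchy-Schwarz bound from a family
  of pointwise arithmetic-geometric inequalities. This covers weights that are not polynomials,
  which \<open>pint_Cauchy_Schwarz\<close> does not.\<close>

lemma le_sqrt_mult_of_weighted_means:
  fixes I U V :: real
  assumes "\<And>c. c > 0 \<Longrightarrow> I \<le> (c * U + V / c) / 2" "0 \<le> U" "0 < V"
  shows "I \<le> sqrt (U * V)"
proof (cases "U = 0")
  case True
  show ?thesis
  proof (rule ccontr)
    assume "\<not> ?thesis"
    then have "I > 0" using True by simp
    \<comment> \<open>The choice \<open>c = V / I\<close> turns the assumption into
      \<open>I \<le> I / 2\<close>.\<close>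
    then show False using assms(1)[of "V / I"] assms(3) True by simp
  qed
next
  case False
  then have "U > 0" using assms(2) by simp
  then have *: "sqrt (V / U) * U = sqrt (U * V)" "V / sqrt (V / U) = sqrt (U * V)"
    using assms(3) by (simp_all add: real_sqrt_divide real_sqrt_mult real_div_sqrt field_simps)
  then show ?thesis using assms(1)[of "sqrt (V / U)"] assms(3) \<open>U > 0\<close> by simp
qed

lemma abs_le_weighted_mean:
  fixes y :: real
  assumes "c > 0" "w > 0"
  shows "\<bar>y\<bar> \<le> (c * (w * y\<^sup>2) + (1 / w) / c) / 2"
proof -
  have "0 \<le> (c * w * \<bar>y\<bar> - 1)\<^sup>2 / (c * w)" using assms by simp
  also have "\<dots> = c * (w * y\<^sup>2) + (1 / w) / c - 2 * \<bar>y\<bar>"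
    using assms by (simp add: power2_eq_square field_simps)
  finally show ?thesis by simp
qed

lemma integral_abs_poly_le:
  fixes w :: "real \<Rightarrow> real"
  assumes "continuous_on {-1..1} w" "\<And>x. x \<in> {-1..1} \<Longrightarrow> w x > 0"
    and U: "integral {-1..1} (\<lambda>x. w x * (poly p x)\<^sup>2) \<le> U"
    and V: "integral {-1..1} (\<lambda>x. 1 / w x) \<le> V" "0 < V"
  shows "integral {-1..1} (\<lambda>x. \<bar>poly p x\<bar>) \<le> sqrt (U * V)"
proof (rule le_sqrt_mult_of_weighted_means)
  have i1: "(\<lambda>x. w x * (poly p x)\<^sup>2) integrable_on {-1..1}"
    using assms(1) by (intro integrable_continuous_interval continuous_intros)
  have i2: "(\<lambda>x. 1 / w x) integrable_on {-1..1}"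
    using assms(1,2) by (intro integrable_continuous_interval continuous_intros) force+
  have "0 \<le> integral {-1..1} (\<lambda>x. w x * (poly p x)\<^sup>2)"
    using assms(2) i1 by (intro Henstock_Kurzweil_Integration.integral_nonneg) (simp_all add: less_imp_le)
  then show "0 \<le> U" using U by linarith
  fix c :: real assume c: "c > 0"
  have "integral {-1..1} (\<lambda>x. \<bar>poly p x\<bar>) \<le> integral {-1..1} (\<lambda>x. c / 2 * (w x * (poly p x)\<^sup>2) + 1 / (2 * c) * (1 / w x))"
  proof (rule integral_le)
    show "(\<lambda>x. c / 2 * (w x * (poly p x)\<^sup>2) + 1 / (2 * c) * (1 / w x)) integrable_on {-1..1}"
      using i1 i2 by (intro integrable_add integrable_on_mult_right)
    show "\<bar>poly p x\<bar> \<le> c / 2 * (w x * (poly p x)\<^sup>2) + 1 / (2 * c) * (1 / w x)" if "x \<in> {-1..1}" for x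
      using abs_le_weighted_mean[OF c assms(2)[OF that], of "poly p x"]
      by (simp add: add_divide_distrib mult_ac)
  qed (rule abs_poly_integrable)
  also have "\<dots> = c / 2 * integral {-1..1} (\<lambda>x. w x * (poly p x)\<^sup>2) + 1 / (2 * c) * integral {-1..1} (\<lambda>x. 1 / w x)"
    by (intro integral_unique has_integral_add has_integral_mult_right integrable_integral i1 i2)
  also have "\<dots> \<le> c / 2 * U + 1 / (2 * c) * V"
    using U V c by (intro add_mono mult_left_mono) auto
  finally show "integral {-1..1} (\<lambda>x. \<bar>poly p x\<bar>) \<le> (c * U + V / c) / 2"
    by (simp add: add_divide_distrib mult_ac)
qed fact

lemma integral_abs_poly_le_pnorm: "integral {-1..1} (\<lambda>x. \<bar>poly p x\<bar>) \<le> sqrt 2 * pnorm p"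
proof -
  have "integral {-1..1} (\<lambda>x. \<bar>poly p x\<bar>) \<le> sqrt (qint (p * p) * 2)"
  proof (rule integral_abs_poly_le[where w = "\<lambda>_. 1"])
    have "integral {-1..1} (\<lambda>x. 1 * (poly p x)\<^sup>2) = qint (p * p)"
      unfolding pint_def by (intro integral_cong) (simp add: power2_eq_square)
    then show "integral {-1..1} (\<lambda>x. 1 * (poly p x)\<^sup>2) \<le> qint (p * p)" by simp
  qed simp_all
  then show ?thesis by (simp add: real_sqrt_mult pnorm_def mult.commute)
qed

lemma integral_inverse_linear:
  assumes "\<epsilon> > (0::real)"
  shows "((\<lambda>x. 1 / (1 + \<epsilon> - x)) has_integral ln (1 + 2 / \<epsilon>)) {-1..1}"
    and "((\<lambda>x. 1 / (1 + \<epsilon> + x)) has_integral ln (1 + 2 / \<epsilon>)) {-1..1}"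
proof -
  have l: "ln (2 + \<epsilon>) - ln \<epsilon> = ln (1 + 2 / \<epsilon>)"
  proof -
    have "1 + 2 / \<epsilon> = (2 + \<epsilon>) / \<epsilon>" using assms by (simp add: field_simps)
    then show ?thesis using assms by (simp add: ln_div)
  qed
  have "((\<lambda>x. 1 / (1 + \<epsilon> - x)) has_integral (- ln (1 + \<epsilon> - 1) - (- ln (1 + \<epsilon> - (-1))))) {-1..1}"
    by (rule fundamental_theorem_of_calculus)
       (use assms in \<open>auto simp: has_real_derivative_iff_has_vector_derivative[symmetric] intro!: derivative_eq_intros\<close>)
  then show "((\<lambda>x. 1 / (1 + \<epsilon> - x)) has_integral ln (1 + 2 / \<epsilon>)) {-1..1}" using l by (simp add: add.commute)
  have "((\<lambda>x. 1 / (1 + \<epsilon> + x)) has_integral (ln (1 + \<epsilon> + 1) - ln (1 + \<epsilon> + (-1)))) {-1..1}"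
    by (rule fundamental_theorem_of_calculus)
       (use assms in \<open>auto simp: has_real_derivative_iff_has_vector_derivative[symmetric] intro!: derivative_eq_intros\<close>)
  then show "((\<lambda>x. 1 / (1 + \<epsilon> + x)) has_integral ln (1 + 2 / \<epsilon>)) {-1..1}" using l by (simp add: add.commute)
qed

text \<open>On either half of the interval the weight is at least
  \<open>1 + \<epsilon> - \<bar>x\<bar>\<close>, whose inverse has a logarithmic integral. Replacing
  the logarithm by a linear bound is what leads to the exponent 3/2 below.\<close>

lemma integral_inverse_weight:
  assumes "1 \<le> K" "\<epsilon> = 1 / (real K)\<^sup>2"
  shows "integral {-1..1} (\<lambda>x. 1 / (1 - x\<^sup>2 + \<epsilon>)) \<le> 8 * real K"
proof -
  have K: "1 \<le> real K" using assms by simp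
  have e: "\<epsilon> > 0" using assms by simp
  have pos: "1 - x\<^sup>2 + \<epsilon> > 0" if "x \<in> {-1..1}" for x :: real
  proof -
    have "x\<^sup>2 \<le> 1" using that by (simp add: abs_square_le_1 abs_le_iff)
    then show ?thesis using e by linarith
  qed
  have "integral {-1..1} (\<lambda>x. 1 / (1 - x\<^sup>2 + \<epsilon>)) \<le> integral {-1..1} (\<lambda>x. 1 / (1 + \<epsilon> - x) + 1 / (1 + \<epsilon> + x))"
  proof (rule integral_le)
    show "(\<lambda>x. 1 / (1 - x\<^sup>2 + \<epsilon>)) integrable_on {-1..1}"
      by (intro integrable_continuous_interval continuous_intros) (use pos in force)
    show "(\<lambda>x. 1 / (1 + \<epsilon> - x) + 1 / (1 + \<epsilon> + x)) integrable_on {-1..1}"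
      using integral_inverse_linear[OF e] by (intro integrable_add) auto
    fix x :: real assume x: "x \<in> {-1..1}"
    show "1 / (1 - x\<^sup>2 + \<epsilon>) \<le> 1 / (1 + \<epsilon> - x) + 1 / (1 + \<epsilon> + x)"
    proof (cases "x \<ge> 0")
      case True
      have "1 + \<epsilon> - x \<le> 1 - x\<^sup>2 + \<epsilon>" using True x mult_left_le[of x x] by (simp add: power2_eq_square)
      then have "1 / (1 - x\<^sup>2 + \<epsilon>) \<le> 1 / (1 + \<epsilon> - x)" using x e by (intro divide_left_mono) (auto intro!: mult_pos_pos pos)
      moreover have "0 \<le> 1 / (1 + \<epsilon> + x)" using x e by simp
      ultimately show ?thesis by linarith
    next
      case False
      have "1 + \<epsilon> + x \<le> 1 - x\<^sup>2 + \<epsilon>" using False x mult_left_le[of "- x" "- x"] by (simp add: power2_eq_square)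
      then have "1 / (1 - x\<^sup>2 + \<epsilon>) \<le> 1 / (1 + \<epsilon> + x)" using x e by (intro divide_left_mono) (auto intro!: mult_pos_pos pos)
      moreover have "0 \<le> 1 / (1 + \<epsilon> - x)" using x e by simp
      ultimately show ?thesis by linarith
    qed
  qed
  also have "\<dots> = 2 * ln (1 + 2 / \<epsilon>)"
    using has_integral_add[OF integral_inverse_linear[OF e]] by (simp add: integral_unique)
  also have "1 + 2 / \<epsilon> = 1 + 2 * (real K)\<^sup>2" using assms by simp
  also have "2 * ln (1 + 2 * (real K)\<^sup>2) \<le> 2 * ln ((1 + 2 * real K)\<^sup>2)"
    using K by (intro mult_left_mono iffD2[OF ln_le_cancel_iff]) (auto simp: power2_eq_square algebra_simps intro: add_pos_nonneg)
  also have "\<dots> = 4 * ln (1 + 2 * real K)" using K by (simp add: ln_realpow)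
  also have "\<dots> \<le> 4 * (2 * real K)" using K by (intro mult_left_mono ln_add_one_self_le_self) auto
  finally show ?thesis by simp
qed

lemma pnorm_eq_expansion: 
  assumes "degree p \<le> K"
  shows "(\<Sum>n\<le>K. (qint (p * nleg n))\<^sup>2) = (pnorm p)\<^sup>2"
  using pnorm_nleg_sum[of "{..K}" "\<lambda>n. qint (p * nleg n)"] nleg_expansion[OF assms] by simp

lemma weighted_Bernstein:
  assumes "degree p \<le> K"
  shows "qint (sqw * pderiv p * pderiv p) \<le> real K * (real K + 1) * (pnorm p)\<^sup>2"
proof -
  define a where "a n = qint (p * nleg n)" for n
  have p: "p = (\<Sum>n\<le>K. smult (a n) (nleg n))"
    unfolding a_def by (rule nleg_expansion) fact
  have "qint (sqw * pderiv p * pderiv p) = (\<Sum>n\<le>K. real n * (real n + 1) * (a n)\<^sup>2)"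
    using legendre_energy[of "{..K}" a] p by simp
  also have "\<dots> \<le> (\<Sum>n\<le>K. real K * (real K + 1) * (a n)\<^sup>2)"
    by (intro sum_mono mult_right_mono mult_mono) auto
  also have "\<dots> = real K * (real K + 1) * (pnorm p)\<^sup>2"
    using pnorm_eq_expansion[OF assms] by (simp add: sum_distrib_left[symmetric] a_def)
  finally show ?thesis .
qed

text \<open>The weight \<open>1 - x^2 + 1 / K^2\<close> balances two estimates: the energy is at
  most \<open>K (K + 1)\<close> times the squared norm, and Markov's \<open>K^4\<close> is reduced
  to \<open>K^2\<close> by the small summand. With the inverse weight this gives
  \<open>sqrt (48 K^3)\<close>, and \<open>48 \<le> 7^2\<close>.\<close>

lemma total_variation_bound:
  assumes "degree p \<le> K" "1 \<le> K"
  shows "integral {-1..1} (\<lambda>x. \<bar>poly (pderiv p) x\<bar>) \<le> 7 * real K powr (3/2) * pnorm p"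
proof -
  define \<epsilon> where "\<epsilon> = 1 / (real K)\<^sup>2"
  have K: "1 \<le> real K" using assms by simp
  have e: "\<epsilon> > 0" using K by (simp add: \<epsilon>_def)
  have pos: "1 - x\<^sup>2 + \<epsilon> > 0" if "x \<in> {-1..1}" for x :: real
  proof -
    have "x\<^sup>2 \<le> 1" using that by (simp add: abs_square_le_1 abs_le_iff)
    then show ?thesis using e by linarith
  qed
  have "integral {-1..1} (\<lambda>x. (1 - x\<^sup>2 + \<epsilon>) * (poly (pderiv p) x)\<^sup>2) =
      qint (sqw * pderiv p * pderiv p + smult \<epsilon> (pderiv p * pderiv p))"
    unfolding pint_def by (intro integral_cong) (simp add: power2_eq_square algebra_simps)
  also have "\<dots> = qint (sqw * pderiv p * pderiv p) + \<epsilon> * (pnorm (pderiv p))\<^sup>2"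
    by (simp add: pint_add pint_smult pnorm_square)
  also have "\<dots> \<le> real K * (real K + 1) * (pnorm p)\<^sup>2 + \<epsilon> * (2 * (real K)\<^sup>2 * pnorm p)\<^sup>2"
    using e by (intro add_mono weighted_Bernstein mult_left_mono power_mono Markov_inequality_L2 pnorm_nonneg assms) auto
  also have "\<epsilon> * (2 * (real K)\<^sup>2 * pnorm p)\<^sup>2 = 4 * (real K)\<^sup>2 * (pnorm p)\<^sup>2"
    using K by (simp add: \<epsilon>_def power2_eq_square field_simps)
  also have "real K * (real K + 1) * (pnorm p)\<^sup>2 \<le> real K * (2 * real K) * (pnorm p)\<^sup>2"
    using K by (intro mult_right_mono mult_left_mono) auto
  finally have U: "integral {-1..1} (\<lambda>x. (1 - x\<^sup>2 + \<epsilon>) * (poly (pderiv p) x)\<^sup>2) \<le> 6 * (real K)\<^sup>2 * (pnorm p)\<^sup>2"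
    by (simp add: power2_eq_square mult_ac)
  have "integral {-1..1} (\<lambda>x. \<bar>poly (pderiv p) x\<bar>) \<le> sqrt (6 * (real K)\<^sup>2 * (pnorm p)\<^sup>2 * (8 * real K))"
    by (rule integral_abs_poly_le[OF _ _ U integral_inverse_weight[OF assms(2) \<epsilon>_def]])
       (use pos K in \<open>auto intro!: continuous_intros\<close>)
  also have "\<dots> \<le> sqrt ((7 * real K powr (3/2) * pnorm p)\<^sup>2)"
  proof (rule real_sqrt_le_mono)
    have "(real K powr (3/2))\<^sup>2 = real K ^ 3"
      using K by (simp add: powr_power)
    then have "(7 * real K powr (3/2) * pnorm p)\<^sup>2 = 49 * (real K ^ 3 * (pnorm p)\<^sup>2)"
      by (simp add: power_mult_distrib)
    moreover have "6 * (real K)\<^sup>2 * (pnorm p)\<^sup>2 * (8 * real K) = 48 * (real K ^ 3 * (pnorm p)\<^sup>2)"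
      by (simp add: power2_eq_square power3_eq_cube)
    moreover have "0 \<le> real K ^ 3 * (pnorm p)\<^sup>2" by simp
    ultimately show "6 * (real K)\<^sup>2 * (pnorm p)\<^sup>2 * (8 * real K) \<le> (7 * real K powr (3/2) * pnorm p)\<^sup>2"
      by linarith
  qed
  also have "\<dots> = 7 * real K powr (3/2) * pnorm p" by (simp add: pnorm_nonneg)
  finally show ?thesis .
qed

text \<open>What is left of the integral after \<open>l\<close> integrations by parts when the
  boundary values of \<open>p\<close> itself vanish: the \<open>L^1\<close> norm of
  \<open>p'\<close> for \<open>l = 1\<close>; for \<open>l = 2\<close> the boundary values of
  \<open>p'\<close> and the \<open>L^1\<close> norm of \<open>p''\<close>, the latter majorised by
  \<open>sqrt 2 * pnorm\<close>, like that of \<open>p\<close> for \<open>l = 0\<close>.\<close>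

definition osc_seminorm :: "nat \<Rightarrow> real poly \<Rightarrow> real" where
  "osc_seminorm l p = (if l = 0 then sqrt 2 * pnorm p
     else if l = 1 then integral {-1..1} (\<lambda>x. \<bar>poly (pderiv p) x\<bar>)
     else \<bar>poly (pderiv p) 1\<bar> + \<bar>poly (pderiv p) (-1)\<bar> + sqrt 2 * pnorm (pderiv (pderiv p)))"

lemma osc_seminorm_triangle: "osc_seminorm l (p + q) \<le> osc_seminorm l p + osc_seminorm l q"
proof -
  have "integral {-1..1} (\<lambda>x. \<bar>poly (pderiv p) x + poly (pderiv q) x\<bar>)
      \<le> integral {-1..1} (\<lambda>x. \<bar>poly (pderiv p) x\<bar> + \<bar>poly (pderiv q) x\<bar>)"
    by (intro integral_le integrable_add abs_poly_integrable)
       (auto intro!: integrable_continuous_interval continuous_intros)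
  also have "\<dots> = integral {-1..1} (\<lambda>x. \<bar>poly (pderiv p) x\<bar>) + integral {-1..1} (\<lambda>x. \<bar>poly (pderiv q) x\<bar>)"
    by (intro Henstock_Kurzweil_Integration.integral_add abs_poly_integrable)
  finally have 1: "integral {-1..1} (\<lambda>x. \<bar>poly (pderiv p) x + poly (pderiv q) x\<bar>) \<le> \<dots>" .
  have 0: "sqrt 2 * pnorm (p + q) \<le> sqrt 2 * pnorm p + sqrt 2 * pnorm q" for p q
    using mult_left_mono[OF pnorm_triangle[of p q], of "sqrt 2"] by (simp add: distrib_left)
  show ?thesis
    using 0[of p q] 0[of "pderiv (pderiv p)" "pderiv (pderiv q)"] 1
    by (auto simp: osc_seminorm_def pderiv_add)
qed

lemma osc_seminorm_minus: "osc_seminorm l (- p) = osc_seminorm l p"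
  using pnorm_smult[of "-1"] by (simp add: osc_seminorm_def pderiv_minus)

lemma osc_seminorm_0: "osc_seminorm l 0 = 0"
  by (simp add: osc_seminorm_def pnorm_0)

lemma osc_seminorm_le:
  assumes "degree p \<le> K" "1 \<le> K" "l \<le> 2"
  shows "osc_seminorm l p \<le> 20 * real K powr loss_exponent l * pnorm p"
proof -
  have K: "1 \<le> real K" using assms by simp
  have s2: "sqrt 2 \<le> 2" by (rule real_le_lsqrt) auto
  consider "l = 0" | "l = 1" | "l = 2" using assms(3) by linarith
  then show ?thesis
  proof cases
    case 1
    have "sqrt 2 * pnorm p \<le> 20 * pnorm p"
      using s2 by (intro mult_right_mono pnorm_nonneg) linarith
    then show ?thesis using 1 K by (simp add: osc_seminorm_def loss_exponent_def)
  next
    case 2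
    have "7 * real K powr (3/2) * pnorm p \<le> 20 * real K powr (3/2) * pnorm p"
      by (intro mult_right_mono pnorm_nonneg) auto
    then show ?thesis using order_trans[OF total_variation_bound[OF assms(1,2)]] 2
      by (simp add: osc_seminorm_def loss_exponent_def)
  next
    case 3
    have d: "degree (pderiv p) \<le> K" using assms(1) by (simp add: degree_pderiv)
    have m: "pnorm (pderiv p) \<le> 2 * (real K)\<^sup>2 * pnorm p" by (rule Markov_inequality_L2) fact
    have e: "\<bar>poly (pderiv p) x\<bar> \<le> 4 * real K ^ 4 * pnorm p" if "x \<in> {-1, 1}" for x
    proof -
      have "\<bar>poly (pderiv p) x\<bar> \<le> 2 * real K * pnorm (pderiv p)"
        using endpoint_bound[OF d assms(2) that] .
      also have "\<dots> \<le> 2 * real K * (2 * (real K)\<^sup>2 * pnorm p)" using m by (intro mult_left_mono) auto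
      also have "\<dots> = 4 * real K ^ 3 * pnorm p" by (simp add: power2_eq_square power3_eq_cube)
      also have "\<dots> \<le> 4 * real K ^ 4 * pnorm p"
        using K by (intro mult_right_mono mult_left_mono power_increasing pnorm_nonneg) auto
      finally show ?thesis .
    qed
    have "pnorm (pderiv (pderiv p)) \<le> 2 * (real K)\<^sup>2 * pnorm (pderiv p)"
      by (rule Markov_inequality_L2) fact
    also have "\<dots> \<le> 2 * (real K)\<^sup>2 * (2 * (real K)\<^sup>2 * pnorm p)" using m by (intro mult_left_mono) auto
    also have "\<dots> = 4 * real K ^ 4 * pnorm p" by (simp add: power2_eq_square power4_eq_xxxx)
    finally have "sqrt 2 * pnorm (pderiv (pderiv p)) \<le> 2 * (4 * real K ^ 4 * pnorm p)"
      using s2 by (intro mult_mono pnorm_nonneg) auto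
    moreover have "0 \<le> real K ^ 4 * pnorm p" by (simp add: pnorm_nonneg)
    moreover have "real K powr 4 = real K ^ 4" using K by simp
    ultimately show ?thesis using e[of 1] e[of "-1"] 3
      by (simp add: osc_seminorm_def loss_exponent_def mult.assoc)
  qed
qed

text \<open>Each use of \<open>oint_pderiv\<close> gains a factor \<open>1 / \<kappa>\<close>. The
  first one has no boundary term by the assumptions; the boundary term of the second is part of the
  seminorm.\<close>

lemma norm_oint_le_osc_seminorm:
  assumes "\<kappa> > 0" "l \<le> 2" "l \<noteq> 0 \<Longrightarrow> poly p 1 = 0" "l \<noteq> 0 \<Longrightarrow> poly p (-1) = 0"
  shows "cmod (oint \<kappa> p) \<le> \<kappa> powr (- real l) * osc_seminorm l p"
proof -
  consider "l = 0" | "l = 1" | "l = 2" using assms(2) by linarith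
  then show ?thesis
  proof cases
    case 1
    then show ?thesis using order_trans[OF norm_oint_le integral_abs_poly_le_pnorm] assms(1)
      by (simp add: osc_seminorm_def)
  next
    case 2
    have "oint \<kappa> (pderiv p) = - \<i> * of_real \<kappa> * oint \<kappa> p"
      using oint_pderiv[of \<kappa> p] assms(3,4) 2 by simp
    then have "\<kappa> * cmod (oint \<kappa> p) = cmod (oint \<kappa> (pderiv p))" using assms(1) by (simp add: norm_mult)
    also have "\<dots> \<le> osc_seminorm l p" using norm_oint_le[of \<kappa> "pderiv p"] 2 by (simp add: osc_seminorm_def)
    finally have "cmod (oint \<kappa> p) \<le> osc_seminorm l p / \<kappa>" using assms(1) by (simp add: field_simps)
    then show ?thesis using assms(1) 2 by (simp add: powr_minus_divide)
  next
    case 3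
    have 1: "oint \<kappa> (pderiv p) = - \<i> * of_real \<kappa> * oint \<kappa> p"
      using oint_pderiv[of \<kappa> p] assms(3,4) 3 by simp
    have "\<i> * of_real \<kappa> * oint \<kappa> (pderiv p) = of_real (poly (pderiv p) 1) * exp (\<i> * of_real \<kappa>)
       - of_real (poly (pderiv p) (-1)) * exp (- \<i> * of_real \<kappa>) - oint \<kappa> (pderiv (pderiv p))"
      using oint_pderiv[of \<kappa> "pderiv p"] by (simp add: algebra_simps)
    then have "\<kappa> * cmod (oint \<kappa> (pderiv p)) = cmod (of_real (poly (pderiv p) 1) * exp (\<i> * of_real \<kappa>)
       - of_real (poly (pderiv p) (-1)) * exp (- \<i> * of_real \<kappa>) - oint \<kappa> (pderiv (pderiv p)))"
      using assms(1) by (metis abs_of_pos mult_1 norm_ii norm_mult norm_of_real)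
    also have "\<dots> \<le> cmod (of_real (poly (pderiv p) 1) * exp (\<i> * of_real \<kappa>))
       + cmod (of_real (poly (pderiv p) (-1)) * exp (- \<i> * of_real \<kappa>)) + cmod (oint \<kappa> (pderiv (pderiv p)))"
      by (meson add_right_mono norm_triangle_ineq4 order_trans)
    also have "\<dots> \<le> osc_seminorm l p"
      using order_trans[OF norm_oint_le integral_abs_poly_le_pnorm, of \<kappa> "pderiv (pderiv p)"] 3
      by (simp add: osc_seminorm_def norm_mult)
    finally have "\<kappa> * (\<kappa> * cmod (oint \<kappa> p)) \<le> osc_seminorm l p"
      unfolding 1 using assms(1) by (simp add: norm_mult)
    then have "cmod (oint \<kappa> p) \<le> osc_seminorm l p / \<kappa>\<^sup>2" using assms(1) by (simp add: field_simps power2_eq_square)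
    then show ?thesis using assms(1) 3 by (simp add: powr_minus_divide)
  qed
qed

text \<open>Dyadic blocks: splitting off the degrees in \<open>(N, 2 N]\<close> costs \<open>2 powr (\<eta> - r) < 1\<close> per step.\<close>

lemma osc_seminorm_tail:
  fixes r :: real
  assumes "l \<le> 2" "r > loss_exponent l"
  defines "C \<equiv> 20 * 2 powr loss_exponent l / (1 - 2 powr (loss_exponent l - r))"
  shows "\<lbrakk>1 \<le> N; (\<Sum>n\<in>{N<..M}. (real n + 1/2) powr (2 * r) * (a n)\<^sup>2) \<le> A\<^sup>2; 0 \<le> A\<rbrakk> \<Longrightarrow>
    osc_seminorm l (\<Sum>n\<in>{N<..M}. smult (a n) (nleg n)) \<le> C * real N powr (loss_exponent l - r) * A"
proof (induction "M - N" arbitrary: N rule: less_induct)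
  case less
  let ?\<eta> = "loss_exponent l"
  let ?B = "\<lambda>I. \<Sum>n\<in>I. smult (a n) (nleg n)"
  have \<eta>: "0 \<le> ?\<eta>" by (simp add: loss_exponent_def)
  then have r: "r > 0" using assms by simp
  have q: "2 powr (?\<eta> - r) < 1" using assms by (simp add: powr_less_one)
  have "x + x / (1 - y) * y = x / (1 - y)" if "y < 1" for x y :: real
    using that by (simp add: field_simps)
  \<comment> \<open>\<open>C\<close> is the fixed point of the recursion over blocks: the cost of
    one block plus \<open>2 powr (\<eta> - r)\<close> times the bound for the rest is again
    \<open>C\<close>.\<close>
  with q have C: "20 * 2 powr ?\<eta> + C * 2 powr (?\<eta> - r) = C" "0 \<le> C"
    by (simp_all add: C_def)
  show ?case
  proof (cases "M \<le> N")
    case True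
    then show ?thesis using C less.prems by (simp add: osc_seminorm_0)
  next
    case False
    define I where "I = {N<..min (2 * N) M}"
    have split: "{N<..M} = I \<union> {2 * N<..M}" "I \<inter> {2 * N<..M} = {}" by (auto simp: I_def)
    have N: "1 \<le> real N" using less.prems by simp
    have "(pnorm (?B I))\<^sup>2 * real N powr (2 * r) = (\<Sum>n\<in>I. real N powr (2 * r) * (a n)\<^sup>2)"
      by (subst pnorm_nleg_sum) (simp_all add: I_def sum_distrib_left mult.commute)
    also have "\<dots> \<le> (\<Sum>n\<in>I. (real n + 1/2) powr (2 * r) * (a n)\<^sup>2)"
      using r by (intro sum_mono mult_right_mono powr_mono2) (auto simp: I_def)
    also have "\<dots> \<le> (\<Sum>n\<in>{N<..M}. (real n + 1/2) powr (2 * r) * (a n)\<^sup>2)"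
      by (intro sum_mono2) (auto simp: I_def)
    also note less.prems(2)
    finally have "(pnorm (?B I) * real N powr r)\<^sup>2 \<le> A\<^sup>2"
      using N by (simp add: power_mult_distrib powr_power mult.commute)
    then have "pnorm (?B I) * real N powr r \<le> A"
      using less.prems(3) by (rule power2_le_imp_le)
    then have p: "pnorm (?B I) \<le> real N powr (- r) * A"
      using N by (simp add: powr_minus_divide field_simps)
    have "osc_seminorm l (?B I) \<le> 20 * real (2 * N) powr ?\<eta> * pnorm (?B I)"
    proof (rule osc_seminorm_le)
      show "degree (?B I) \<le> 2 * N"
        by (intro degree_sum_le) (auto simp: I_def degree_nleg intro: order_trans[OF degree_smult_le])
    qed (use less.prems assms in auto)
    also have "\<dots> \<le> 20 * real (2 * N) powr ?\<eta> * (real N powr (- r) * A)"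
      using p by (intro mult_left_mono) auto
    also have "\<dots> = 20 * 2 powr ?\<eta> * (real N powr (?\<eta> - r) * A)"
      using N by (simp add: powr_mult mult_ac flip: powr_add)
    finally have 1: "osc_seminorm l (?B I) \<le> 20 * 2 powr ?\<eta> * (real N powr (?\<eta> - r) * A)" .
    have "osc_seminorm l (?B {2 * N<..M}) \<le> C * real (2 * N) powr (?\<eta> - r) * A"
    proof (rule less.hyps)
      have "(\<Sum>n\<in>{2*N<..M}. (real n + 1/2) powr (2 * r) * (a n)\<^sup>2) \<le> (\<Sum>n\<in>{N<..M}. (real n + 1/2) powr (2 * r) * (a n)\<^sup>2)"
        by (intro sum_mono2) auto
      then show "(\<Sum>n\<in>{2*N<..M}. (real n + 1/2) powr (2 * r) * (a n)\<^sup>2) \<le> A\<^sup>2"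
        using less.prems(2) by linarith
    qed (use False less.prems in auto)
    also have "\<dots> = C * 2 powr (?\<eta> - r) * (real N powr (?\<eta> - r) * A)"
      using N by (simp add: powr_mult)
    finally have 2: "osc_seminorm l (?B {2 * N<..M}) \<le> C * 2 powr (?\<eta> - r) * (real N powr (?\<eta> - r) * A)" .
    have "osc_seminorm l (?B {N<..M}) \<le> osc_seminorm l (?B I) + osc_seminorm l (?B {2 * N<..M})"
      unfolding split(1) using split(2) by (subst sum.union_disjoint) (auto simp: I_def osc_seminorm_triangle)
    also have "\<dots> \<le> (20 * 2 powr ?\<eta> + C * 2 powr (?\<eta> - r)) * (real N powr (?\<eta> - r) * A)"
      using 1 2 by (simp add: distrib_right)
    finally show ?thesis unfolding C by (simp add: mult.assoc)
  qed
qed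

section \<open>Gauss-Lobatto interpolation and quadrature\<close>

text \<open>Rolle's theorem between neighbours, adding the largest point last. The location clauses
  keep the new critical point apart from the old ones and later confine all of them to the open
  interval.\<close>

lemma poly_Rolle_card:
  fixes p :: "real poly"
  assumes "finite S" "S \<noteq> {}" "\<And>x. x \<in> S \<Longrightarrow> poly p x = 0"
  shows "\<exists>T. finite T \<and> Suc (card T) = card S \<and>
    (\<forall>t\<in>T. poly (pderiv p) t = 0 \<and> (\<exists>s\<in>S. s < t) \<and> (\<exists>s\<in>S. t < s))"
  using assms
proof (induction S rule: finite_linorder_max_induct)
  case (insert b A)
  show ?case
  proof (cases "A = {}")
    case True
    then show ?thesis by (intro exI[of _ "{}"]) simp
  next
    case False
    then obtain T where T: "finite T" "Suc (card T) = card A"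
      "\<forall>t\<in>T. poly (pderiv p) t = 0 \<and> (\<exists>s\<in>A. s < t) \<and> (\<exists>s\<in>A. t < s)"
      using insert by auto
    have M: "Max A \<in> A" using False insert by simp
    then have "Max A < b" using insert by auto
    then obtain x where x: "Max A < x" "x < b" "poly p b - poly p (Max A) = (b - Max A) * poly (pderiv p) x"
      using poly_MVT by blast
    then have "poly (pderiv p) x = 0" using insert.prems M by auto
    moreover have "x \<notin> T"
    proof
      assume "x \<in> T"
      then obtain s where "s \<in> A" "x < s" using T by blast
      then show False using x(1) Max_ge[OF insert.hyps(1)] by fastforce
    qed
    ultimately show ?thesis using T x M insert.hyps
      by (intro exI[of _ "insert x T"]) (auto simp: card_insert_if)
  qed
qed simp

text \<open>Each derivative costs at most one factor \<open>sqw\<close>, so the end points stay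
  roots as long as \<open>k < n\<close>; this feeds Rolle's theorem in
  \<open>rodrigues_roots\<close>.\<close>

lemma sqw_power_dvd_rodrigues: "k \<le> n \<Longrightarrow> \<exists>q. rodrigues k n = sqw ^ (n - k) * q"
proof (induction k)
  case 0
  then show ?case by (simp add: rodrigues_def)
next
  case (Suc k)
  then obtain q where q: "rodrigues k n = sqw ^ (n - k) * q" by auto
  have e: "n - k = Suc (n - Suc k)" using Suc.prems by simp
  have "rodrigues (Suc k) n = sqw ^ (n - Suc k) * (sqw * pderiv q + smult (real (n - k)) (q * [:0, -2:]))"
    unfolding pderiv_rodrigues[symmetric] q e
    by (intro real_poly_eqI) (simp only: pderiv_mult pderiv_power_Suc pderiv_sqw, simp add: algebra_simps)
  then show ?case by blast
qed

text \<open>Adding the roots at -1 and 1 to the \<open>k\<close> interior roots gives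
  \<open>k + 2\<close> points, hence \<open>k + 1\<close> interior roots of the next
  derivative.\<close>

lemma rodrigues_roots:
  "k \<le> n \<Longrightarrow> \<exists>T. finite T \<and> card T = k \<and> T \<subseteq> {-1<..<1} \<and> (\<forall>t\<in>T. poly (rodrigues k n) t = 0)"
proof (induction k)
  case (Suc k)
  then obtain T where T: "finite T" "card T = k" "T \<subseteq> {-1<..<1}" "\<forall>t\<in>T. poly (rodrigues k n) t = 0" by auto
  let ?S = "insert (-1) (insert 1 T)"
  obtain q where q: "rodrigues k n = sqw ^ (n - k) * q"
    using sqw_power_dvd_rodrigues[of k n] Suc.prems by auto
  have "poly (rodrigues k n) x = 0" if "x \<in> ?S" for x
  proof (cases "x \<in> T")
    case False
    then have "x\<^sup>2 = 1" using that by auto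
    then show ?thesis using Suc.prems by (simp add: q poly_power power2_eq_square)
  qed (use T in auto)
  then obtain T' where T': "finite T'" "Suc (card T') = card ?S"
    "\<forall>t\<in>T'. poly (pderiv (rodrigues k n)) t = 0 \<and> (\<exists>s\<in>?S. s < t) \<and> (\<exists>s\<in>?S. t < s)"
    using poly_Rolle_card[of ?S "rodrigues k n"] T by auto
  have "card ?S = Suc (Suc k)" using T by (auto simp: card_insert_if)
  moreover have "T' \<subseteq> {-1<..<1}" using T' T(3) by force
  ultimately show ?case using T' by (intro exI[of _ T']) (auto simp: pderiv_rodrigues)
qed auto

section \<open>Node polynomial, nodes and Lagrange interpolation\<close>

definition lob :: "nat \<Rightarrow> real poly" where
  "lob N = sqw * pderiv (legendre_poly N)"

definition lobatto_nodes :: "nat \<Rightarrow> real set" where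
  "lobatto_nodes N = {x. poly (lob N) x = 0}"

lemma lobatto_nodes_eq: "lobatto_nodes N = {-1, 1} \<union> {x. poly (pderiv (legendre_poly N)) x = 0}"
proof -
  have "1 - x * x = 0 \<longleftrightarrow> x = 1 \<or> x = -1" for x :: real
    using square_eq_1_iff[of x] by (auto simp: mult.commute)
  then show ?thesis by (auto simp: lobatto_nodes_def lob_def)
qed

lemma degree_lob: "N \<ge> 1 \<Longrightarrow> degree (lob N) = Suc N"
proof -
  assume "N \<ge> 1"
  then have "dleg 1 N \<noteq> 0" by (intro dleg_nonzero)
  then have "pderiv (legendre_poly N) \<noteq> 0" by (simp add: dleg_def)
  then show ?thesis using \<open>N \<ge> 1\<close>
    by (simp add: lob_def degree_mult_eq degree_pderiv degree_legendre_poly)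
qed

lemma pderiv_lob: "pderiv (lob N) = smult (- (real N * (real N + 1))) (legendre_poly N)"
proof (rule real_poly_eqI)
  fix x
  have "poly (pderiv (lob N)) x = (1 - x\<^sup>2) * poly (dleg 2 N) x - 2 * x * poly (dleg 1 N) x"
    by (simp add: lob_def pderiv_mult pderiv_sqw dleg_def numeral_2_eq_2 power2_eq_square)
  then show "poly (pderiv (lob N)) x = poly (smult (- (real N * (real N + 1))) (legendre_poly N)) x"
    using dleg_ode[of x 0 N] by (simp add: dleg_0 numeral_2_eq_2)
qed

text \<open>\<open>P_N\<close> has \<open>N\<close> interior roots; Rolle yields
  \<open>N - 1\<close> roots of \<open>P_N'\<close> strictly between them, and the degree leaves no
  room for others.\<close>

lemma lobatto_nodes:
  assumes "N \<ge> 1"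
  shows finite_lobatto_nodes: "finite (lobatto_nodes N)"
    and card_lobatto_nodes: "card (lobatto_nodes N) = Suc N"
    and lobatto_nodes_subset: "lobatto_nodes N \<subseteq> {-1..1}"
    and interior_lobatto_nodes: "x \<in> lobatto_nodes N \<Longrightarrow> x \<noteq> 1 \<Longrightarrow> x \<noteq> -1 \<Longrightarrow> -1 < x \<and> x < 1"
proof -
  let ?R = "{x. poly (pderiv (legendre_poly N)) x = 0}"
  have nz: "pderiv (legendre_poly N) \<noteq> 0"
    using dleg_nonzero[of 1 N] assms by (simp add: dleg_def)
  obtain T where T: "finite T" "card T = N" "T \<subseteq> {-1<..<1}" "\<forall>t\<in>T. poly (rodrigues N N) t = 0"
    using rodrigues_roots[of N N] by auto
  then have "\<exists>T'. finite T' \<and> Suc (card T') = card T \<and>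
    (\<forall>t\<in>T'. poly (pderiv (legendre_poly N)) t = 0 \<and> (\<exists>s\<in>T. s < t) \<and> (\<exists>s\<in>T. t < s))"
    using assms by (intro poly_Rolle_card) (auto simp: legendre_poly_def)
  then obtain T' where T': "finite T'" "Suc (card T') = N" "T' \<subseteq> ?R" "T' \<subseteq> {-1<..<1}"
    using T(2,3) by fastforce
  have "card ?R \<le> degree (pderiv (legendre_poly N))" by (rule card_poly_roots_bound) fact
  then have "card ?R \<le> card T'" using T' by (simp add: degree_pderiv degree_legendre_poly)
  then have R: "T' = ?R" using T' nz by (intro card_seteq poly_roots_finite) auto
  then have e: "lobatto_nodes N = insert (-1) (insert 1 T')" by (simp add: lobatto_nodes_eq)
  show "finite (lobatto_nodes N)" "lobatto_nodes N \<subseteq> {-1..1}"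
    "x \<in> lobatto_nodes N \<Longrightarrow> x \<noteq> 1 \<Longrightarrow> x \<noteq> -1 \<Longrightarrow> -1 < x \<and> x < 1"
    using T' by (auto simp: e)
  show "card (lobatto_nodes N) = Suc N"
    using T' by (auto simp: e card_insert_if)
qed

text \<open>The node set is a parameter because components of odd order are interpolated at the
  interior nodes only.\<close>

definition lagrange :: "real set \<Rightarrow> real \<Rightarrow> real poly" where
  "lagrange S x = (\<Prod>y\<in>S - {x}. smult (1 / (x - y)) [:- y, 1:])"

lemma poly_lagrange:
  assumes "finite S" "y \<in> S"
  shows "poly (lagrange S x) y = (if y = x then 1 else 0)"
proof (cases "y = x")
  case True
  have "(1 / (x - z)) * (x - z) = 1" if "z \<in> S - {x}" for z using that by auto
  then show ?thesis using True by (simp add: lagrange_def poly_prod algebra_simps diff_divide_distrib[symmetric])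
next
  case False
  then have "(\<Prod>z\<in>S - {x}. poly (smult (1 / (x - z)) [:- z, 1:]) y) = 0"
    using assms by (intro prod_zero) auto
  then show ?thesis using False by (simp add: lagrange_def poly_prod del: poly_smult)
qed

lemma degree_lagrange:
  assumes "finite S" "x \<in> S"
  shows "degree (lagrange S x) \<le> card S - 1"
proof -
  have "degree (lagrange S x) \<le> (\<Sum>y\<in>S - {x}. degree (smult (1 / (x - y)) [:- y, 1:]))"
    unfolding lagrange_def using assms by (intro order_trans[OF degree_prod_sum_le]) (auto simp: comp_def)
  also have "\<dots> \<le> (\<Sum>y\<in>S - {x}. 1)" by (intro sum_mono) auto
  finally show ?thesis using assms by (simp add: card_Diff_singleton)
qed

lemma poly_eq_on_nodes:
  fixes p q :: "'a::idom poly"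
  assumes "degree p \<le> n" "degree q \<le> n" "finite S" "n < card S" "\<And>x. x \<in> S \<Longrightarrow> poly p x = poly q x"
  shows "p = q"
proof (rule ccontr)
  assume "p \<noteq> q"
  then have nz: "p - q \<noteq> 0" by simp
  have "S \<subseteq> {x. poly (p - q) x = 0}" using assms(5) by auto
  then have "card S \<le> card {x. poly (p - q) x = 0}" by (intro card_mono poly_roots_finite nz)
  also have "\<dots> \<le> degree (p - q)" by (rule card_poly_roots_bound[OF nz])
  also have "\<dots> \<le> n" by (rule degree_diff_le) fact+
  finally show False using assms(4) by simp
qed

definition linterp :: "nat \<Rightarrow> (real \<Rightarrow> real) \<Rightarrow> real poly" where
  "linterp N f = (\<Sum>x\<in>lobatto_nodes N. smult (f x) (lagrange (lobatto_nodes N) x))"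

lemma poly_linterp:
  assumes "N \<ge> 1" "y \<in> lobatto_nodes N"
  shows "poly (linterp N f) y = f y"
  using finite_lobatto_nodes[OF assms(1)] assms(2)
  by (simp add: linterp_def poly_sum poly_lagrange if_distrib[of "\<lambda>z. _ * z"] cong: if_cong)

lemma degree_linterp: "N \<ge> 1 \<Longrightarrow> degree (linterp N f) \<le> N"
  unfolding linterp_def
  by (intro degree_sum_le finite_lobatto_nodes order_trans[OF degree_smult_le]
        order_trans[OF degree_lagrange]) (simp_all add: card_lobatto_nodes finite_lobatto_nodes)

lemma linterp_unique:
  assumes "N \<ge> 1" "degree p \<le> N" "\<And>x. x \<in> lobatto_nodes N \<Longrightarrow> poly p x = f x"
  shows "p = linterp N f"
  by (rule poly_eq_on_nodes[OF assms(2) degree_linterp[OF assms(1)] finite_lobatto_nodes[OF assms(1)]])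
     (use assms in \<open>auto simp: card_lobatto_nodes poly_linterp\<close>)

section \<open>Quadrature weights and exactness\<close>

definition lobatto_weight :: "nat \<Rightarrow> real \<Rightarrow> real" where
  "lobatto_weight N x = qint (lagrange (lobatto_nodes N) x)"

text \<open>The derivatives of the Legendre polynomials of degrees 1 to \<open>N - 1\<close> span
  all degrees below \<open>N - 1\<close> and are orthogonal to \<open>P_N'\<close> for the weight
  \<open>1 - x^2\<close>.\<close>

lemma lob_orth_lower_degree:
  assumes "N \<ge> 1" "degree s < N - 1 \<or> s = 0"
  shows "qint (lob N * s) = 0"
proof (cases "s = 0")
  case False
  then have s: "degree s < N - 1" using assms by auto
  have "\<exists>c. s = (\<Sum>j\<le>N - 2. smult (c j) (dleg 1 (Suc j)))"
    by (rule poly_graded_basis) (use s in \<open>auto simp: degree_dleg dleg_nonzero\<close>)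
  then obtain c where "s = (\<Sum>j\<le>N - 2. smult (c j) (dleg 1 (Suc j)))" by blast
  moreover have "qint (lob N * dleg 1 (Suc j)) = 0" if "j \<le> N - 2" for j
    using dleg_orth[of 1 N "Suc j"] assms s that by (simp add: lob_def dleg_def)
  ultimately show ?thesis
    by (simp add: sum_distrib_left pint_sum pint_smult)
qed (simp add: pint_0)

text \<open>Division by \<open>lob N\<close>: the quotient has degree below \<open>N - 1\<close>, so
  its product with \<open>lob N\<close> has integral 0. The remainder has degree at most
  \<open>N\<close>, agrees with \<open>p\<close> at the nodes, and therefore is its
  interpolant.\<close>

lemma lobatto_quadrature_exact:
  assumes "N \<ge> 1" "degree p < 2 * N"
  shows "qint p = (\<Sum>x\<in>lobatto_nodes N. lobatto_weight N x * poly p x)"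
proof -
  have nz: "lob N \<noteq> 0" using degree_lob[OF assms(1)] by auto
  let ?s = "p div lob N" and ?t = "p mod lob N"
  have p: "p = lob N * ?s + ?t" by simp
  have t: "?t = 0 \<or> degree ?t < Suc N" using degree_mod_less[OF nz, of p] degree_lob[OF assms(1)] by auto
  have s: "degree ?s < N - 1 \<or> ?s = 0"
  proof (rule ccontr)
    assume "\<not> ?thesis"
    then have s: "?s \<noteq> 0" "N - 1 \<le> degree ?s" by auto
    have "degree (lob N * ?s) = Suc N + degree ?s"
      using s nz degree_lob[OF assms(1)] by (simp add: degree_mult_eq)
    moreover have "degree ?t < Suc N" using t by auto
    ultimately have "degree (lob N * ?s + ?t) = Suc N + degree ?s"
      by (subst degree_add_eq_left) auto
    then have "degree p = Suc N + degree ?s" by simp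
    then show False using s assms by linarith
  qed
  have val: "poly p x = poly ?t x" if "x \<in> lobatto_nodes N" for x
  proof -
    have "poly p x = poly (lob N) x * poly ?s x + poly ?t x" by (metis p poly_add poly_mult)
    then show ?thesis using that by (simp add: lobatto_nodes_def)
  qed
  have "?t = linterp N (poly p)"
    by (rule linterp_unique[OF assms(1)]) (use t val in auto)
  then have "qint ?t = (\<Sum>x\<in>lobatto_nodes N. lobatto_weight N x * poly p x)"
    by (simp add: linterp_def pint_sum pint_smult lobatto_weight_def mult.commute)
  moreover have "qint p = qint ?t"
    by (subst p) (simp only: pint_add lob_orth_lower_degree[OF assms(1) s])
  ultimately show ?thesis by simp
qed

lemma coeff_mult_degree_le:
  fixes p q :: "'a::comm_semiring_0 poly"
  assumes "degree p \<le> a" "degree q \<le> b"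
  shows "coeff (p * q) (a + b) = coeff p a * coeff q b"
proof (cases "degree p = a \<and> degree q = b")
  case True
  then show ?thesis using coeff_mult_degree_sum[of p q] by simp
next
  case False
  then have "degree p < a \<or> degree q < b" using assms by auto
  moreover have "degree (p * q) \<le> degree p + degree q" by (rule degree_mult_le)
  ultimately show ?thesis using assms by (auto simp: coeff_eq_0)
qed

lemma degree_sqw: "degree sqw = 2"
  by simp

text \<open>\<open>(1 - x^2) p'^2\<close> has degree up to \<open>2 N\<close>, just beyond
  exactness, and a leading coefficient of known sign. It serves to correct other polynomials of
  degree \<open>2 N\<close>.\<close>

lemma coeff_sqw_pderiv_square:
  assumes "N \<ge> 1" "degree p \<le> N"
  shows "degree (sqw * pderiv p * pderiv p) \<le> 2 * N"
    and "coeff (sqw * pderiv p * pderiv p) (2 * N) = - (real N * coeff p N)\<^sup>2"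
proof -
  have d: "degree (pderiv p) \<le> N - 1" using assms by (simp add: degree_pderiv)
  have d2: "degree (sqw * pderiv p) \<le> 2 + (N - 1)"
    using d by (intro order_trans[OF degree_mult_le] add_mono) (auto simp only: degree_sqw)
  have "degree (sqw * pderiv p * pderiv p) \<le> (2 + (N - 1)) + (N - 1)"
    by (rule order_trans[OF degree_mult_le add_mono[OF d2 d]])
  then show "degree (sqw * pderiv p * pderiv p) \<le> 2 * N" using assms by simp
  have ix: "(2 + (N - 1)) + (N - 1) = 2 * N" using assms by simp
  have "coeff (sqw * pderiv p * pderiv p) ((2 + (N - 1)) + (N - 1)) =
     coeff (sqw * pderiv p) (2 + (N - 1)) * coeff (pderiv p) (N - 1)"
    by (rule coeff_mult_degree_le) fact+
  also have "coeff (sqw * pderiv p) (2 + (N - 1)) = coeff sqw 2 * coeff (pderiv p) (N - 1)"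
    by (rule coeff_mult_degree_le[OF eq_refl[OF degree_sqw] d])
  also have "coeff sqw 2 = -1" by (simp add: numeral_2_eq_2)
  also have "coeff (pderiv p) (N - 1) = real N * coeff p N" using assms by (simp add: coeff_pderiv)
  finally show "coeff (sqw * pderiv p * pderiv p) (2 * N) = - (real N * coeff p N)\<^sup>2"
    unfolding ix by (simp add: power2_eq_square)
qed

lemma degree_less_double:
  assumes "N \<ge> 1" "degree p \<le> 2 * N" "coeff p (2 * N) = 0"
  shows "degree p < 2 * N"
proof -
  have "degree p \<noteq> 2 * N"
  proof
    assume "degree p = 2 * N"
    then have "p = 0" using assms(3) by (metis leading_coeff_0_iff)
    then show False using \<open>degree p = 2 * N\<close> assms(1) by simp
  qed
  then show ?thesis using assms(2) by simp
qed

lemma sqw_pderiv_square_at_node: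
  assumes "x \<in> lobatto_nodes N"
  shows "(1 - x\<^sup>2) * (poly (pderiv (legendre_poly N)) x * poly (pderiv (legendre_poly N)) x) = 0"
  using assms by (simp add: lobatto_nodes_def lob_def power2_eq_square)

text \<open>The rule is not exact for \<open>q\<^sup>2\<close>; adding a multiple of \<open>(1 - x\<^sup>2) P\<^sub>N'\<^sup>2\<close>, which vanishes at the
  nodes and has positive integral, cancels the leading coefficient.\<close>

lemma pnorm_le_discrete:
  assumes "N \<ge> 1" "degree q \<le> N"
  shows "(pnorm q)\<^sup>2 \<le> (\<Sum>x\<in>lobatto_nodes N. lobatto_weight N x * (poly q x)\<^sup>2)"
proof -
  let ?P = "legendre_poly N"
  have lc: "coeff ?P N \<noteq> 0"
    using leading_coeff_0_iff[of ?P] legendre_poly_nonzero[of N] by (simp add: degree_legendre_poly)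
  define b where "b = coeff q N / (real N * coeff ?P N)"
  define p where "p = q * q + smult (b\<^sup>2) (sqw * pderiv ?P * pderiv ?P)"
  have dP: "degree ?P \<le> N" by (simp add: degree_legendre_poly)
  have "coeff (q * q) (2 * N) = (coeff q N)\<^sup>2"
    using coeff_mult_degree_le[OF assms(2) assms(2)] by (simp add: power2_eq_square mult_2)
  then have "coeff p (2 * N) = 0"
    using assms lc by (simp add: p_def coeff_sqw_pderiv_square[OF assms(1) dP] b_def power_divide power_mult_distrib)
  moreover have "degree p \<le> 2 * N" unfolding p_def
    using assms order_trans[OF degree_mult_le, of q q "2 * N"]
    by (intro degree_add_le order_trans[OF degree_smult_le] coeff_sqw_pderiv_square dP) auto
  ultimately have "qint p = (\<Sum>x\<in>lobatto_nodes N. lobatto_weight N x * poly p x)"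
    using assms by (intro lobatto_quadrature_exact degree_less_double)
  also have "\<dots> = (\<Sum>x\<in>lobatto_nodes N. lobatto_weight N x * (poly q x)\<^sup>2)"
  proof (intro sum.cong refl arg_cong2[of _ _ _ _ "(*)"])
    fix x assume "x \<in> lobatto_nodes N"
    from sqw_pderiv_square_at_node[OF this] show "poly p x = (poly q x)\<^sup>2"
      by (simp add: p_def power2_eq_square)
  qed
  finally have "(\<Sum>x\<in>lobatto_nodes N. lobatto_weight N x * (poly q x)\<^sup>2) =
     (pnorm q)\<^sup>2 + b\<^sup>2 * qint (sqw * pderiv ?P * pderiv ?P)"
    by (simp add: p_def pint_add pint_smult pnorm_square)
  moreover have "0 \<le> qint (sqw * pderiv ?P * pderiv ?P)"
  proof (rule pint_nonneg)
    fix x :: real assume "x \<in> {-1..1}"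
    then have "0 \<le> (1 - x\<^sup>2) * (poly (pderiv ?P) x)\<^sup>2"
      by (intro mult_nonneg_nonneg) (auto simp: abs_square_le_1 abs_le_iff)
    then show "0 \<le> poly (sqw * pderiv ?P * pderiv ?P) x" by (simp add: power2_eq_square)
  qed
  ultimately show ?thesis by simp
qed

text \<open>Let \<open>K\<close> be the node polynomial divided by its linear factor at
  \<open>x\<close>. The product \<open>K P_N\<close>, corrected in its leading coefficient, is
  integrated exactly, and at the nodes it vanishes except at \<open>x\<close>. There
  \<open>K\<close> is the derivative of \<open>lob N\<close>, that is
  \<open>- N (N + 1) P_N\<close>.\<close>

lemma lobatto_weight_eq:
  assumes "N \<ge> 1" "x \<in> lobatto_nodes N"
  shows "real N * (real N + 1) * (poly (legendre_poly N) x)\<^sup>2 * lobatto_weight N x = 2"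
proof -
  let ?P = "legendre_poly N"
  have N: "real N > 0" using assms by simp
  have dP: "degree ?P \<le> N" by (simp add: degree_legendre_poly)
  obtain K where K: "lob N = [:- x, 1:] * K"
    using assms(2) by (auto simp: lobatto_nodes_def poly_eq_0_iff_dvd elim: dvdE)
  have Kx: "poly K x = - (real N * (real N + 1) * poly ?P x)"
  proof -
    have "poly (pderiv (lob N)) x = poly K x"
      unfolding K by (simp add: pderiv_mult pderiv_pCons)
    then show ?thesis by (simp add: pderiv_lob)
  qed
  have Ky: "poly K y = 0" if "y \<in> lobatto_nodes N" "y \<noteq> x" for y
  proof -
    have "(y - x) * poly K y = poly (lob N) y" unfolding K by (simp add: algebra_simps)
    then show ?thesis using that by (simp add: lobatto_nodes_def)
  qed
  have nz: "lob N \<noteq> 0" using degree_lob[OF assms(1)] by auto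
  have degK: "degree K = N"
    using degree_lob[OF assms(1)] nz unfolding K by (subst (asm) degree_mult_eq) auto
  have cK: "coeff K N = - real N * coeff ?P N"
  proof -
    have "coeff K N = coeff (lob N) (1 + N)"
      unfolding K by (subst coeff_mult_degree_le) (use degK in auto)
    also have "1 + N = 2 + (N - 1)" using assms by simp
    also have "coeff (lob N) (2 + (N - 1)) = coeff sqw 2 * coeff (pderiv ?P) (N - 1)"
      unfolding lob_def by (rule coeff_mult_degree_le) (simp_all only: degree_sqw degree_pderiv degree_legendre_poly order_refl)
    finally show ?thesis using assms by (simp add: coeff_pderiv numeral_2_eq_2)
  qed
  \<comment> \<open>\<open>K + N P_N\<close> has degree below \<open>N\<close> and is thus
    orthogonal to \<open>P_N\<close>, so only the norm of \<open>P_N\<close> enters.\<close>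
  have "qint (K * ?P) = - 2 * real N / (2 * real N + 1)"
  proof -
    have "degree (K + smult (real N) ?P) < N"
    proof -
      have "degree (K + smult (real N) ?P) \<le> N" using degK dP by (intro degree_add_le order_trans[OF degree_smult_le]) auto
      moreover have "coeff (K + smult (real N) ?P) N = 0" using cK by simp
      ultimately show ?thesis using assms(1)
        by (metis One_nat_def Suc_le_lessD degree_0 le_neq_implies_less leading_coeff_0_iff)
    qed
    then have "qint (?P * (K + smult (real N) ?P)) = 0" by (rule legendre_orth_lower_degree)
    then show ?thesis by (simp add: distrib_left pint_add pint_smult legendre_norm mult.commute)
  qed
  moreover have "qint (sqw * pderiv ?P * pderiv ?P) = real N * (real N + 1) * (2 / (2 * real N + 1))"
    using dleg_orth_step[of 0 N N] by (simp add: dleg_def legendre_norm)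
  moreover define p where "p = K * ?P - smult (1 / real N) (sqw * pderiv ?P * pderiv ?P)"
  ultimately have "qint p = - 2 * real N / (2 * real N + 1) - 1 / real N * (real N * (real N + 1) * (2 / (2 * real N + 1)))"
    by (simp add: pint_diff pint_smult)
  also have "\<dots> = - 2" using N by (simp add: divide_simps)
  finally have q: "qint p = - 2" .
  have "coeff (K * ?P) (2 * N) = coeff K N * coeff ?P N"
    using coeff_mult_degree_le[of K N ?P N] degK dP by (simp add: mult_2)
  then have "coeff p (2 * N) = 0"
    using N by (simp add: p_def coeff_sqw_pderiv_square[OF assms(1) dP] cK power2_eq_square)
  moreover have "degree p \<le> 2 * N" unfolding p_def
    using degK dP order_trans[OF degree_mult_le, of K ?P "2 * N"]
    by (intro degree_diff_le order_trans[OF degree_smult_le] coeff_sqw_pderiv_square dP assms) auto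
  ultimately have "qint p = (\<Sum>y\<in>lobatto_nodes N. lobatto_weight N y * poly p y)"
    using assms by (intro lobatto_quadrature_exact degree_less_double)
  also have "\<dots> = (\<Sum>y\<in>lobatto_nodes N. if y = x then lobatto_weight N x * (poly K x * poly ?P x) else 0)"
  proof (intro sum.cong refl)
    fix y assume y: "y \<in> lobatto_nodes N"
    then show "lobatto_weight N y * poly p y = (if y = x then lobatto_weight N x * (poly K x * poly ?P x) else 0)"
      using sqw_pderiv_square_at_node[OF y] Ky[OF y] by (cases "y = x") (auto simp: p_def power2_eq_square)
  qed
  also have "\<dots> = lobatto_weight N x * (poly K x * poly ?P x)"
    using assms finite_lobatto_nodes[OF assms(1)] by simp
  finally show ?thesis using q Kx by (simp add: power2_eq_square algebra_simps)
qed

lemma lobatto_weight_pos: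
  assumes "N \<ge> 1" "x \<in> lobatto_nodes N"
  shows "lobatto_weight N x > 0"
proof (rule ccontr)
  assume "\<not> ?thesis"
  then have "real N * (real N + 1) * (poly (legendre_poly N) x)\<^sup>2 * lobatto_weight N x \<le> 0"
    by (intro mult_nonneg_nonpos) auto
  then show False using lobatto_weight_eq[OF assms] by simp
qed

lemma lobatto_weight_endpoint:
  assumes "N \<ge> 1" "x \<in> {-1, 1}"
  shows "lobatto_weight N x = 2 / (real N * (real N + 1))"
proof -
  have "x \<in> lobatto_nodes N" using assms by (auto simp: lobatto_nodes_eq)
  moreover have "(poly (legendre_poly N) x)\<^sup>2 = 1"
    using assms by (auto simp: legendre_poly_1 legendre_poly_minus_1 simp flip: power_mult)
  ultimately have "real N * (real N + 1) * lobatto_weight N x = 2"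
    using lobatto_weight_eq[OF assms(1)] by force
  moreover have "real N * (real N + 1) > 0" using assms by simp
  ultimately show ?thesis by (simp add: field_simps)
qed

section \<open>Spacing of the nodes and size of the weights\<close>

lemma pint_subset_le:
  assumes "a \<le> c" "d \<le> b" "\<And>x. x \<in> {a..b} \<Longrightarrow> 0 \<le> poly p x"
  shows "pint c d p \<le> pint a b p"
  unfolding pint_def using assms
  by (intro integral_subset_le poly_integrable) auto

lemma pint_const: "a \<le> b \<Longrightarrow> pint a b [:c:] = (b - a) * c"
  using pint_pderiv[of a b "[:0, c:]"] by (simp add: pderiv_pCons algebra_simps)

lemma pint_linear: "a \<le> b \<Longrightarrow> pint a b [:c, d:] = (b - a) * c + d * (b\<^sup>2 - a\<^sup>2) / 2"
  using pint_pderiv[of a b "[:0, c, d / 2:]"] by (simp add: pderiv_pCons algebra_simps power2_eq_square diff_divide_distrib)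

text \<open>Fundamental theorem of calculus and Cauchy-Schwarz, starting from a zero at one end of
  the interval.\<close>

lemma poly_square_le_energy:
  assumes "a \<le> x" "x \<le> b"
  shows "poly p a = 0 \<Longrightarrow> (poly p x)\<^sup>2 \<le> (x - a) * pint a b (pderiv p * pderiv p)"
    and "poly p b = 0 \<Longrightarrow> (poly p x)\<^sup>2 \<le> (b - x) * pint a b (pderiv p * pderiv p)"
proof -
  have *: "(poly p d - poly p c)\<^sup>2 \<le> (d - c) * pint a b (pderiv p * pderiv p)"
    if "a \<le> c" "c \<le> d" "d \<le> b" for c d
  proof -
    have 1: "pint c d 1 = d - c" using that pint_const[of c d 1] by (simp add: one_pCons)
    have "(pint c d (pderiv p * 1))\<^sup>2 \<le> pint c d (pderiv p * pderiv p) * pint c d (1 * 1)"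
      by (rule pint_Cauchy_Schwarz)
    also have "\<dots> \<le> pint a b (pderiv p * pderiv p) * pint c d (1 * 1)"
      by (intro mult_right_mono pint_subset_le) (use that 1 in auto)
    finally show ?thesis
      using that pint_pderiv[of c d p] by (simp add: 1 mult.commute)
  qed
  show "poly p a = 0 \<Longrightarrow> (poly p x)\<^sup>2 \<le> (x - a) * pint a b (pderiv p * pderiv p)"
    using *[of a x] assms by simp
  show "poly p b = 0 \<Longrightarrow> (poly p x)\<^sup>2 \<le> (b - x) * pint a b (pderiv p * pderiv p)"
    using *[of x b] assms by simp
qed

text \<open>The node polynomial \<open>D\<close> satisfies \<open>D'' = - N (N + 1) P_N'\<close>.
  Integration by parts between two of its zeros turns its energy into an integral without
  derivatives of \<open>D\<close>; comparing both sides bounds the distance of the zeros from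
  below.\<close>

lemma lob_energy:
  assumes "a \<in> lobatto_nodes N" "b \<in> lobatto_nodes N" "a < b" "N \<ge> 1"
  shows "pint a b (pderiv (lob N) * pderiv (lob N)) =
      real N * (real N + 1) * pint a b (lob N * pderiv (legendre_poly N))"
    and "0 < pint a b (pderiv (lob N) * pderiv (lob N))"
proof -
  have "pint a b (pderiv (lob N) * pderiv (lob N)) = - pint a b (lob N * pderiv (pderiv (lob N)))"
    using assms by (subst pint_by_parts) (auto simp: lobatto_nodes_def)
  then show "pint a b (pderiv (lob N) * pderiv (lob N)) =
      real N * (real N + 1) * pint a b (lob N * pderiv (legendre_poly N))"
    by (simp add: pderiv_lob pderiv_smult pderiv_minus pint_smult pint_minus)
  have "pderiv (lob N) \<noteq> 0" using assms by (simp add: pderiv_lob legendre_poly_nonzero)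
  then show "0 < pint a b (pderiv (lob N) * pderiv (lob N))"
    using poly_zero_of_pint_square[OF assms(3)] pint_square_nonneg[of a b "pderiv (lob N)"]
    by (metis less_eq_real_def)
qed

text \<open>Let \<open>E\<close> be the energy of \<open>D = lob N\<close> between \<open>x\<close>
  and the nearer end point, say 1. Then \<open>D^2 \<le> (1 - t) E\<close>, so
  \<open>D P_N' = D^2 / (1 - t^2) \<le> E\<close>, and \<open>lob_energy\<close> gives
  \<open>E \<le> N (N + 1) (1 - x) E\<close>; cancel \<open>E\<close>. The product
  \<open>D P_N'\<close> is used because it needs no division.\<close>

lemma interior_node_endpoint_distance:
  assumes "N \<ge> 1" "x \<in> lobatto_nodes N" "x \<noteq> 1" "x \<noteq> -1"
  shows "1 \<le> real N * (real N + 1) * (1 - x\<^sup>2)"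
proof -
  let ?D = "lob N" and ?y = "pderiv (legendre_poly N)"
  have x: "-1 < x" "x < 1" using interior_lobatto_nodes[OF assms] by auto
  have ends: "1 \<in> lobatto_nodes N" "-1 \<in> lobatto_nodes N" by (auto simp: lobatto_nodes_eq)
  have Dy: "poly ?D t * poly ?y t = (1 - t\<^sup>2) * (poly ?y t)\<^sup>2" "(poly ?D t)\<^sup>2 = (1 - t\<^sup>2)\<^sup>2 * (poly ?y t)\<^sup>2" for t
    by (simp_all add: lob_def power2_eq_square)
  have "1 \<le> real N * (real N + 1) * (1 - \<bar>x\<bar>)"
  proof (cases "x \<ge> 0")
    case True
    define E where "E = pint x 1 (pderiv ?D * pderiv ?D)"
    have E: "E = real N * (real N + 1) * pint x 1 (?D * ?y)" "0 < E"
      unfolding E_def using lob_energy[OF assms(2) ends(1) x(2) assms(1)] by auto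
    have "pint x 1 (?D * ?y) \<le> pint x 1 [:E:]"
    proof (rule pint_mono)
      fix t assume t: "t \<in> {x..1}"
      show "poly (?D * ?y) t \<le> poly [:E:] t"
      proof (cases "t = 1")
        case False
        have "(poly ?D t)\<^sup>2 \<le> (1 - t) * E"
          unfolding E_def by (rule poly_square_le_energy(2)) (use t ends in \<open>auto simp: lobatto_nodes_def\<close>)
        then have "(1 - t) * ((1 + t) * ((1 - t\<^sup>2) * (poly ?y t)\<^sup>2)) \<le> (1 - t) * E"
          unfolding Dy by (simp add: power2_eq_square algebra_simps)
        then have "(1 + t) * ((1 - t\<^sup>2) * (poly ?y t)\<^sup>2) \<le> E" using t False by simp
        moreover have "0 \<le> (1 - t\<^sup>2) * (poly ?y t)\<^sup>2"
          using t True by (intro mult_nonneg_nonneg) (auto simp: abs_square_le_1 abs_le_iff)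
        then have "(1 - t\<^sup>2) * (poly ?y t)\<^sup>2 \<le> (1 + t) * ((1 - t\<^sup>2) * (poly ?y t)\<^sup>2)"
          using t True mult_right_mono[of 1 "1 + t" "(1 - t\<^sup>2) * (poly ?y t)\<^sup>2"] by simp
        ultimately show ?thesis using Dy(1)[of t] by simp
      qed (use ends E in \<open>auto simp: lobatto_nodes_def\<close>)
    qed
    then have "pint x 1 (?D * ?y) \<le> (1 - x) * E" using pint_const[of x 1 E] x by simp
    then have "E \<le> real N * (real N + 1) * ((1 - x) * E)" by (subst E(1)) (intro mult_left_mono, auto)
    then show ?thesis using E(2) True by (simp add: mult.assoc[symmetric])
  next
    case False
    define E where "E = pint (-1) x (pderiv ?D * pderiv ?D)"
    have E: "E = real N * (real N + 1) * pint (-1) x (?D * ?y)" "0 < E"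
      unfolding E_def using lob_energy[OF ends(2) assms(2) x(1) assms(1)] by auto
    have "pint (-1) x (?D * ?y) \<le> pint (-1) x [:E:]"
    proof (rule pint_mono)
      fix t assume t: "t \<in> {-1..x}"
      show "poly (?D * ?y) t \<le> poly [:E:] t"
      proof (cases "t = -1")
        case False
        have "(poly ?D t)\<^sup>2 \<le> (t - (-1)) * E"
          unfolding E_def by (rule poly_square_le_energy(1)) (use t ends in \<open>auto simp: lobatto_nodes_def\<close>)
        then have "(1 + t) * ((1 - t) * ((1 - t\<^sup>2) * (poly ?y t)\<^sup>2)) \<le> (1 + t) * E"
          unfolding Dy by (simp add: power2_eq_square algebra_simps)
        then have "(1 - t) * ((1 - t\<^sup>2) * (poly ?y t)\<^sup>2) \<le> E" using t False by simp
        moreover have "0 \<le> (1 - t\<^sup>2) * (poly ?y t)\<^sup>2"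
          using t \<open>\<not> x \<ge> 0\<close> by (intro mult_nonneg_nonneg) (auto simp: abs_square_le_1 abs_le_iff)
        then have "(1 - t\<^sup>2) * (poly ?y t)\<^sup>2 \<le> (1 - t) * ((1 - t\<^sup>2) * (poly ?y t)\<^sup>2)"
          using t \<open>\<not> x \<ge> 0\<close> mult_right_mono[of 1 "1 - t" "(1 - t\<^sup>2) * (poly ?y t)\<^sup>2"] by simp
        ultimately show ?thesis using Dy(1)[of t] by simp
      qed (use ends E in \<open>auto simp: lobatto_nodes_def\<close>)
    qed
    then have "pint (-1) x (?D * ?y) \<le> (x + 1) * E" using pint_const[of "-1" x E] x by simp
    then have "E \<le> real N * (real N + 1) * ((x + 1) * E)" by (subst E(1)) (intro mult_left_mono, auto)
    then show ?thesis using E(2) False by (simp add: mult.assoc[symmetric] add.commute)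
  qed
  also have "\<dots> \<le> real N * (real N + 1) * (1 - x\<^sup>2)"
  proof (rule mult_left_mono)
    have "\<bar>x\<bar> * \<bar>x\<bar> \<le> \<bar>x\<bar>" using x by (intro mult_left_le) auto
    then show "1 - \<bar>x\<bar> \<le> 1 - x\<^sup>2" by (simp add: power2_eq_square)
  qed simp
  finally show ?thesis .
qed

text \<open>The same energy argument between two interior nodes. Now \<open>1 - t^2\<close> is at
  least its minimum over the two ends, and integrating the linear bound \<open>t - a\<close>
  supplies the factor 2.\<close>

lemma interior_node_gap:
  assumes "N \<ge> 1" "a \<in> lobatto_nodes N" "b \<in> lobatto_nodes N" "-1 < a" "a < b" "b < 1"
  shows "2 * min (1 - a\<^sup>2) (1 - b\<^sup>2) \<le> real N * (real N + 1) * (b - a)\<^sup>2"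
proof -
  let ?D = "lob N" and ?y = "pderiv (legendre_poly N)"
  define \<mu> where "\<mu> = min (1 - a\<^sup>2) (1 - b\<^sup>2)"
  have \<mu>: "0 < \<mu>" using assms by (auto simp: \<mu>_def abs_square_less_1 abs_less_iff)
  define E where "E = pint a b (pderiv ?D * pderiv ?D)"
  have E: "E = real N * (real N + 1) * pint a b (?D * ?y)" "0 < E"
    unfolding E_def using lob_energy[OF assms(2,3,5,1)] by auto
  have "pint a b (?D * ?y) \<le> pint a b [:- a * E / \<mu>, E / \<mu>:]"
  proof (rule pint_mono)
    fix t assume t: "t \<in> {a..b}"
    have "(poly ?D t)\<^sup>2 \<le> (t - a) * E"
      unfolding E_def by (rule poly_square_le_energy(1)) (use t assms in \<open>auto simp: lobatto_nodes_def\<close>)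
    moreover have "\<mu> \<le> 1 - t\<^sup>2"
    proof (cases "t \<ge> 0")
      case True
      then have "t\<^sup>2 \<le> b\<^sup>2" using t by (intro power_mono) auto
      then show ?thesis by (simp add: \<mu>_def)
    next
      case False
      then have "(- t)\<^sup>2 \<le> (- a)\<^sup>2" using t by (intro power_mono) auto
      then show ?thesis by (simp add: \<mu>_def)
    qed
    then have "\<mu> * ((1 - t\<^sup>2) * (poly ?y t)\<^sup>2) \<le> (1 - t\<^sup>2) * ((1 - t\<^sup>2) * (poly ?y t)\<^sup>2)"
      using \<mu> by (intro mult_right_mono) auto
    ultimately have "\<mu> * ((1 - t\<^sup>2) * (poly ?y t)\<^sup>2) \<le> (t - a) * E"
      by (simp add: lob_def power2_eq_square mult_ac)
    then have "(1 - t\<^sup>2) * (poly ?y t)\<^sup>2 \<le> (t - a) * E / \<mu>" using \<mu> by (simp add: field_simps)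
    then show "poly (?D * ?y) t \<le> poly [:- a * E / \<mu>, E / \<mu>:] t"
      by (simp add: lob_def power2_eq_square left_diff_distrib diff_divide_distrib)
  qed
  also have "\<dots> = (b - a)\<^sup>2 * E / (2 * \<mu>)"
    using assms \<mu> by (subst pint_linear) (auto simp: power2_eq_square field_simps)
  finally have "E \<le> real N * (real N + 1) * ((b - a)\<^sup>2 * E / (2 * \<mu>))"
    by (subst E(1)) (intro mult_left_mono, auto)
  then have "2 * \<mu> * E \<le> real N * (real N + 1) * (b - a)\<^sup>2 * E"
    using \<mu> by (simp add: field_simps)
  then show ?thesis using E(2) by (simp add: \<mu>_def)
qed

text \<open>Odd degrees vanish at 0, so two consecutive degrees are added. Combining the two
  recurrences at 0 relates \<open>P_{n+2}\<close> to \<open>P_n\<close>, and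
  \<open>n (n + 2) \<le> (n + 1)^2\<close> makes \<open>n P_n(0)^2\<close> nondecreasing in steps of
  two. For \<open>N = 1\<close> the bound is an equality.\<close>

lemma legendre_at_0:
  assumes "N \<ge> 1"
  shows "1/2 \<le> real N * (poly (legendre_poly N) 0)\<^sup>2 + (real N + 1) * (poly (legendre_poly (Suc N)) 0)\<^sup>2"
  using assms
proof (induction N rule: nat_induct_at_least)
  have r: "(real n + 2)\<^sup>2 * (poly (legendre_poly (Suc (Suc n))) 0)\<^sup>2 = (real n + 1)\<^sup>2 * (poly (legendre_poly n) 0)\<^sup>2" for n
    using sqw_dleg_1[of 0 "Suc n"] dleg_Suc_Suc[of n 0]
    by (simp add: dleg_0 add_ac flip: power_mult_distrib) (metis (no_types) add.commute power2_minus)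
  {
    case base
    have "4 * (poly (legendre_poly (Suc (Suc 0))) 0)\<^sup>2 = 1"
      using r[of 0] by (simp add: legendre_poly_def rodrigues_def)
    then show ?case by (simp add: numeral_2_eq_2)
  next
    case (Suc n)
    let ?b = "\<lambda>n. (poly (legendre_poly n) 0)\<^sup>2"
    have "real n * ?b n \<le> (real n + 2) * ?b (Suc (Suc n))"
    proof -
      have "(real n + 2) * (real n * ?b n) \<le> (real n + 1)\<^sup>2 * ?b n"
        unfolding mult.assoc[symmetric] by (intro mult_right_mono) (auto simp: power2_eq_square algebra_simps)
      also have "\<dots> = (real n + 2) * ((real n + 2) * ?b (Suc (Suc n)))"
        using r[of n] by (simp add: power2_eq_square mult_ac)
      finally have *: "(real n + 2) * (real n * ?b n) \<le> (real n + 2) * ((real n + 2) * ?b (Suc (Suc n)))" .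
      show ?thesis by (rule mult_left_le_imp_le[OF *]) simp
    qed
    then show ?case using Suc.IH by (simp add: algebra_simps)
  }
qed

text \<open>A Sonin function of \<open>u(\<theta>) = sqrt (sin \<theta>) P\<^sub>N (cos \<theta>)\<close>: it is \<open>u'\<^sup>2 + Q u\<^sup>2\<close> for
  \<open>u'' + Q u = 0\<close>, \<open>Q = (N + 1/2)\<^sup>2 + 1 / (4 sin\<^sup>2 \<theta>)\<close>, expressed in \<open>t = cos \<theta>\<close> and multiplied by \<open>sin \<theta>\<close>.\<close>

definition sonin :: "nat \<Rightarrow> real \<Rightarrow> real" where
  "sonin N t = ((real N + 1/2)\<^sup>2 * (1 - t\<^sup>2) + (1 + t\<^sup>2) / 4) * (poly (legendre_poly N) t)\<^sup>2
     + (1 - t\<^sup>2)\<^sup>2 * (poly (pderiv (legendre_poly N)) t)\<^sup>2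
     - t * (1 - t\<^sup>2) * poly (legendre_poly N) t * poly (pderiv (legendre_poly N)) t"

text \<open>By Legendre's equation everything cancels except a term with the sign of
  \<open>t\<close>; hence the quotient is smallest at \<open>t = 0\<close>.\<close>

lemma sonin_deriv:
  assumes "-1 < t" "t < 1"
  shows "((\<lambda>t. sonin N t / sqrt (1 - t\<^sup>2)) has_real_derivative
      t * (poly (legendre_poly N) t)\<^sup>2 / 2 / (sqrt (1 - t\<^sup>2)) ^ 3) (at t)"
proof -
  let ?P = "legendre_poly N"
  define y where "y = poly ?P t"
  define y1 where "y1 = poly (pderiv ?P) t"
  define y2 where "y2 = poly (pderiv (pderiv ?P)) t"
  define w where "w = 1 - t\<^sup>2"
  define n where "n = real N"
  have w: "w > 0" using assms by (simp add: w_def abs_square_less_1 abs_less_iff)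
  have ode: "w * y2 = 2 * t * y1 - n * (n + 1) * y"
    using dleg_ode[of t 0 N] by (simp add: dleg_def w_def y_def y1_def y2_def n_def numeral_2_eq_2)
  define T where "T = ((n + 1/2)\<^sup>2 * (- (2 * t)) + (2 * t) / 4) * y\<^sup>2 + ((n + 1/2)\<^sup>2 * w + (1 + t\<^sup>2) / 4) * (2 * y * y1)
     + (2 * w * (- (2 * t)) * y1\<^sup>2 + w\<^sup>2 * (2 * y1 * y2))
     - ((w + t * (- (2 * t))) * y * y1 + t * w * (y1 * y1 + y * y2))"
  have d1: "(sonin N has_real_derivative T) (at t)"
    unfolding sonin_def T_def y_def y1_def y2_def w_def n_def
    by (auto intro!: derivative_eq_intros poly_DERIV simp: power2_eq_square field_simps)
  have d2: "((\<lambda>t. sqrt (1 - t\<^sup>2)) has_real_derivative - t / sqrt w) (at t)"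
    unfolding w_def using assms w by (auto intro!: derivative_eq_intros simp: w_def field_simps)
  have "((\<lambda>t. sonin N t / sqrt (1 - t\<^sup>2)) has_real_derivative
     (T * sqrt w - sonin N t * (- t / sqrt w)) / (sqrt w * sqrt w)) (at t)"
    using DERIV_divide[OF d1 d2] w by (simp add: w_def)
  moreover have "(T * sqrt w - sonin N t * (- t / sqrt w)) / (sqrt w * sqrt w) = (T * w + t * sonin N t) / (sqrt w) ^ 3"
  proof -
    define s where "s = sqrt w"
    have s: "s > 0" "w = s * s" using w by (auto simp: s_def)
    show ?thesis unfolding s_def[symmetric] s(2) using s(1) by (simp add: field_simps power3_eq_cube)
  qed
  moreover have "T * w + t * sonin N t = t * y\<^sup>2 / 2"
  proof -
    have t2: "t\<^sup>2 = 1 - w" by (simp add: w_def)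
    have S: "sonin N t = ((n + 1/2)\<^sup>2 * w + (1 + t\<^sup>2) / 4) * y\<^sup>2 + w\<^sup>2 * y1\<^sup>2 - t * w * y * y1"
      by (simp add: sonin_def y_def y1_def w_def n_def)
    have T: "T = ((n + 1/2)\<^sup>2 * (- (2 * t)) + (2 * t) / 4) * y\<^sup>2 + ((n + 1/2)\<^sup>2 * w + (1 + t\<^sup>2) / 4) * (2 * y * y1)
     + (2 * w * (- (2 * t)) * y1\<^sup>2 + w * (2 * y1 * (2 * t * y1 - n * (n + 1) * y)))
     - ((w + t * (- (2 * t))) * y * y1 + t * (w * y1 * y1 + y * (2 * t * y1 - n * (n + 1) * y)))"
      unfolding T_def ode[symmetric] by (simp add: power2_eq_square algebra_simps)
    have nn: "(n + 1/2)\<^sup>2 = n * (n + 1) + 1/4" by (simp add: power2_eq_square algebra_simps)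
    define m where "m = n * (n + 1)"
    show ?thesis unfolding S T w_def nn m_def[symmetric]
      by (simp add: power2_eq_square algebra_simps add_divide_distrib diff_divide_distrib)
  qed
  ultimately have "((\<lambda>t. sonin N t / sqrt (1 - t\<^sup>2)) has_real_derivative t * y\<^sup>2 / 2 / (sqrt w) ^ 3) (at t)"
    by (simp only:)
  then show ?thesis by (simp only: w_def y_def)
qed

text \<open>The minimum at 0 involves \<open>P_N(0)\<close> and, through \<open>sqw_dleg_1\<close>,
  \<open>P_{N+1}(0)\<close>; \<open>legendre_at_0\<close> bounds this combination from
  below.\<close>

lemma sonin_lower_bound:
  assumes "-1 < x" "x < 1" "N \<ge> 1"
  shows "real N / 2 * sqrt (1 - x\<^sup>2) \<le> sonin N x"
proof -
  let ?f = "\<lambda>t. sonin N t / sqrt (1 - t\<^sup>2)"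
  have pos: "0 < sqrt (1 - t\<^sup>2)" if "-1 < t" "t < 1" for t :: real
    using that by (simp add: abs_square_less_1 abs_less_iff)
  have "?f 0 \<le> ?f x"
  proof (cases "x \<ge> 0")
    case True
    show ?thesis
    proof (rule DERIV_nonneg_imp_nondecreasing[OF True])
      fix t assume "0 \<le> t" "t \<le> x"
      then show "\<exists>y. (?f has_real_derivative y) (at t) \<and> 0 \<le> y"
        using sonin_deriv[of t N] pos[of t] assms
        by (intro exI[of _ "t * (poly (legendre_poly N) t)\<^sup>2 / 2 / (sqrt (1 - t\<^sup>2)) ^ 3"] conjI) auto
    qed
  next
    case False
    then have "x \<le> 0" by simp
    then show ?thesis
    proof (rule DERIV_nonpos_imp_nonincreasing)
      fix t assume "x \<le> t" "t \<le> 0"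
      then show "\<exists>y. (?f has_real_derivative y) (at t) \<and> y \<le> 0"
        using sonin_deriv[of t N] pos[of t] assms
        by (intro exI[of _ "t * (poly (legendre_poly N) t)\<^sup>2 / 2 / (sqrt (1 - t\<^sup>2)) ^ 3"] conjI)
           (auto intro!: divide_nonpos_pos mult_nonpos_nonneg)
    qed
  qed
  moreover have "real N / 2 \<le> sonin N 0"
  proof -
    let ?b = "\<lambda>n. (poly (legendre_poly n) 0)\<^sup>2"
    have "(poly (pderiv (legendre_poly N)) 0)\<^sup>2 = ((real N + 1) * poly (legendre_poly (Suc N)) 0)\<^sup>2"
      using sqw_dleg_1[of 0 N] by (simp add: dleg_def)
    then have "sonin N 0 = ((real N + 1/2)\<^sup>2 + 1/4) * ?b N + (real N + 1)\<^sup>2 * ?b (Suc N)"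
      by (simp add: sonin_def power_mult_distrib)
    also have "\<dots> \<ge> real N * (real N * ?b N + (real N + 1) * ?b (Suc N))"
      unfolding distrib_left mult.assoc[symmetric]
      by (intro add_mono mult_right_mono) (auto simp: power2_eq_square algebra_simps)
    finally show ?thesis
      using mult_left_mono[OF legendre_at_0[OF assms(3)], of "real N"] by simp
  qed
  moreover have "?f 0 = sonin N 0" by simp
  ultimately have "real N / 2 \<le> sonin N x / sqrt (1 - x\<^sup>2)" by linarith
  then show ?thesis using pos[OF assms(1,2)] by (simp add: field_simps)
qed

text \<open>At an interior node \<open>P_N' = 0\<close>, so the Sonin function is a multiple of
  \<open>P_N^2\<close>, and its lower bound limits the weight through
  \<open>lobatto_weight_eq\<close>. The distance to the end points absorbs the summand
  \<open>1/2\<close>.\<close>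

lemma lobatto_weight_interior:
  assumes "N \<ge> 1" "x \<in> lobatto_nodes N" "x \<noteq> 1" "x \<noteq> -1"
  shows "lobatto_weight N x \<le> 6 * sqrt (1 - x\<^sup>2) / real N"
proof -
  let ?y = "poly (legendre_poly N) x" and ?n = "real N * (real N + 1)"
  have x: "-1 < x" "x < 1" using interior_lobatto_nodes[OF assms] by auto
  have N: "real N > 0" using assms by simp
  define s where "s = sqrt (1 - x\<^sup>2)"
  have s: "s > 0" "1 - x\<^sup>2 = s\<^sup>2" using x by (auto simp: s_def abs_square_less_1 abs_less_iff abs_square_le_1 abs_le_iff)
  have z: "poly (pderiv (legendre_poly N)) x = 0" using assms by (auto simp: lobatto_nodes_eq)
  have x2: "x\<^sup>2 = 1 - s\<^sup>2" using s(2) by simp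
  have "sonin N x = ((real N + 1/2)\<^sup>2 * s\<^sup>2 + (2 - s\<^sup>2) / 4) * ?y\<^sup>2"
    unfolding sonin_def z x2 by simp
  also have "\<dots> = (?n * s\<^sup>2 + 1/2) * ?y\<^sup>2"
    by (simp add: power2_eq_square field_simps)
  also have "\<dots> \<le> (3/2 * ?n * s\<^sup>2) * ?y\<^sup>2"
    using interior_node_endpoint_distance[OF assms] s(2) by (intro mult_right_mono) auto
  finally have "real N / 2 * s \<le> (3/2 * ?n * s\<^sup>2) * ?y\<^sup>2"
    using sonin_lower_bound[OF x assms(1)] by (simp add: s_def)
  then have "s * (real N / 2) \<le> s * (3/2 * s * (?n * ?y\<^sup>2))" by (simp add: power2_eq_square algebra_simps)
  then have a: "real N / 2 \<le> 3/2 * s * (?n * ?y\<^sup>2)" using s(1) by simp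
  have w: "0 < lobatto_weight N x" using lobatto_weight_pos assms by blast
  have "real N / 2 * lobatto_weight N x \<le> 3/2 * s * (?n * ?y\<^sup>2) * lobatto_weight N x"
    using a w by (intro mult_right_mono) auto
  also have "\<dots> = 3 * s" using lobatto_weight_eq[OF assms(1,2)] by (simp add: mult.assoc)
  finally show ?thesis using N by (simp add: s_def field_simps)
qed

section \<open>Discrete norms at the nodes\<close>

text \<open>\<open>h(x)^2\<close> exceeds \<open>h(y)^2\<close> by at most the integral of the
  derivative of \<open>h^2\<close>, which is dominated by \<open>h^2 / \<rho> + \<rho> h'^2\<close>.
  Averaging over all \<open>y\<close> in the interval of length \<open>2 \<rho>\<close> gives the
  bound.\<close>

lemma poly_square_le_local_energy:
  assumes "\<rho> > 0"
  shows "(poly h x)\<^sup>2 \<le> 3 / (2 * \<rho>) * pint (x - \<rho>) (x + \<rho>) (h * h) + \<rho> * pint (x - \<rho>) (x + \<rho>) (pderiv h * pderiv h)"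
proof -
  let ?a = "x - \<rho>" and ?b = "x + \<rho>"
  define W where "W = smult (1 / \<rho>) (h * h) + smult \<rho> (pderiv h * pderiv h)"
  have W: "\<bar>poly (pderiv (h * h)) t\<bar> \<le> poly W t" for t
  proof -
    have "0 \<le> (poly h t - \<rho> * poly (pderiv h) t)\<^sup>2 / \<rho>" "0 \<le> (poly h t + \<rho> * poly (pderiv h) t)\<^sup>2 / \<rho>"
      using assms by auto
    moreover have "(poly h t - \<rho> * poly (pderiv h) t)\<^sup>2 / \<rho> = poly W t - poly (pderiv (h * h)) t"
      "(poly h t + \<rho> * poly (pderiv h) t)\<^sup>2 / \<rho> = poly W t + poly (pderiv (h * h)) t"
      using assms by (simp_all add: W_def pderiv_mult power2_eq_square field_simps)
    ultimately show ?thesis by linarith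
  qed
  then have W0: "0 \<le> poly W t" for t by (rule order_trans[OF abs_ge_zero])
  have le: "(poly h x)\<^sup>2 \<le> (poly h y)\<^sup>2 + pint ?a ?b W" if y: "y \<in> {?a..?b}" for y
  proof -
    have "\<bar>poly (h * h) d - poly (h * h) c\<bar> \<le> pint ?a ?b W" if "c \<le> d" "?a \<le> c" "d \<le> ?b" for c d
    proof -
      have "pint c d (pderiv (h * h)) \<le> pint c d W" "pint c d (- pderiv (h * h)) \<le> pint c d W"
        using W by (auto intro!: pint_mono simp: abs_le_iff)
      moreover have "pint c d W \<le> pint ?a ?b W"
        using that by (intro pint_subset_le W0) auto
      ultimately show ?thesis using pint_pderiv[of c d "h * h"] that by (simp add: pint_minus abs_le_iff)
    qed
    from this[of x y] this[of y x] y assms show ?thesis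
      by (cases "x \<le> y") (auto simp: power2_eq_square abs_le_iff)
  qed
  have "pint ?a ?b [:(poly h x)\<^sup>2:] \<le> pint ?a ?b (h * h + [:pint ?a ?b W:])"
    using le by (intro pint_mono) (simp add: power2_eq_square)
  then have "2 * \<rho> * (poly h x)\<^sup>2 \<le> pint ?a ?b (h * h) + 2 * \<rho> * pint ?a ?b W"
    using assms by (simp add: pint_add pint_const)
  also have "\<dots> = 3 * pint ?a ?b (h * h) + 2 * \<rho>\<^sup>2 * pint ?a ?b (pderiv h * pderiv h)"
    using assms by (simp add: W_def pint_add pint_smult power2_eq_square field_simps)
  finally show ?thesis using assms by (simp add: field_simps power2_eq_square)
qed

text \<open>The gap estimate only controls the smaller of the two roots \<open>m \<le> M\<close>. If
  \<open>M > 2 m\<close>, then \<open>M^2 - m^2\<close>, the difference of the squared nodes, forces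
  \<open>b - a\<close> to be of order \<open>M^2\<close>, and \<open>N M \<ge> 2/3\<close> converts
  this to order \<open>M / N\<close>.\<close>

lemma interior_node_separation:
  assumes "N \<ge> 1" "a \<in> lobatto_nodes N" "b \<in> lobatto_nodes N" "-1 < a" "a < b" "b < 1"
  shows "max (sqrt (1 - a\<^sup>2)) (sqrt (1 - b\<^sup>2)) \<le> 4 * real N * (b - a)"
proof -
  define sa where "sa = sqrt (1 - a\<^sup>2)"
  define sb where "sb = sqrt (1 - b\<^sup>2)"
  define M where "M = max sa sb"
  define m where "m = min sa sb"
  have N: "1 \<le> real N" using assms by simp
  have ab: "a\<^sup>2 < 1" "b\<^sup>2 < 1" using assms by (auto simp: abs_square_less_1 abs_less_iff)
  then have s: "sa > 0" "sb > 0" "sa\<^sup>2 = 1 - a\<^sup>2" "sb\<^sup>2 = 1 - b\<^sup>2" by (auto simp: sa_def sb_def)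
  have m: "0 < m" "0 < M" using s by (auto simp: m_def M_def)
  have m2: "m\<^sup>2 = min (1 - a\<^sup>2) (1 - b\<^sup>2)"
  proof (cases "sa \<le> sb")
    case True
    then have "sa\<^sup>2 \<le> sb\<^sup>2" using s by (intro power_mono) auto
    then show ?thesis using True s by (simp add: m_def min_def)
  next
    case False
    then have "sb\<^sup>2 \<le> sa\<^sup>2" using s by (intro power_mono) auto
    then show ?thesis using False s by (auto simp: m_def min_def)
  qed
  have N2: "real N * (real N + 1) \<le> 2 * (real N)\<^sup>2" using N by (simp add: power2_eq_square algebra_simps)
  have "2 * m\<^sup>2 \<le> real N * (real N + 1) * (b - a)\<^sup>2"
    unfolding m2 by (rule interior_node_gap) fact+
  also have "\<dots> \<le> 2 * (real N)\<^sup>2 * (b - a)\<^sup>2" by (rule mult_right_mono[OF N2 zero_le_power2])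
  also have "\<dots> = 2 * (real N * (b - a))\<^sup>2" unfolding power_mult_distrib by (rule mult.assoc)
  finally have "m\<^sup>2 \<le> (real N * (b - a))\<^sup>2" by (rule mult_left_le_imp_le) simp
  then have mb: "m \<le> real N * (b - a)" by (rule power2_le_imp_le) (use N assms(5) in auto)
  have "M \<le> 4 * (real N * (b - a))"
  proof (cases "M \<le> 2 * m")
    case True
    then show ?thesis using mb m by linarith
  next
    case False
    then have "(2 * m)\<^sup>2 \<le> M\<^sup>2" using m by (intro power_mono) auto
    then have "3 / 4 * M\<^sup>2 \<le> M\<^sup>2 - m\<^sup>2" by (simp add: power_mult_distrib)
    also have "\<dots> \<le> \<bar>b\<^sup>2 - a\<^sup>2\<bar>"
    proof (cases "sa \<le> sb")
      case True
      then have "M = sb" "m = sa" by (simp_all add: M_def m_def)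
      then show ?thesis using s(3,4) by simp
    next
      case False
      then have "M = sa" "m = sb" by (simp_all add: M_def m_def)
      then show ?thesis using s(3,4) by simp
    qed
    also have "\<dots> = (b - a) * \<bar>a + b\<bar>" using assms by (simp add: power2_eq_square square_diff_square_factored abs_mult)
    also have "\<dots> \<le> (b - a) * 2" using assms by (intro mult_left_mono) auto
    finally have 1: "3 / 4 * M\<^sup>2 \<le> (b - a) * 2" .
    have "1 \<le> real N * (real N + 1) * M\<^sup>2"
      using interior_node_endpoint_distance[of N a] interior_node_endpoint_distance[of N b] assms s
      by (auto simp: M_def max_def)
    also have "\<dots> \<le> 2 * (real N)\<^sup>2 * M\<^sup>2" using N2 by (intro mult_right_mono) auto
    also have "\<dots> = 2 * (real N * M)\<^sup>2" unfolding power_mult_distrib by (rule mult.assoc)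
    \<comment> \<open>\<open>2/3\<close> is a rational number below
      \<open>sqrt (1/2)\<close>.\<close>
    finally have "(2 / 3)\<^sup>2 \<le> (real N * M)\<^sup>2" by (simp add: power_divide)
    then have "2 / 3 \<le> real N * M" using m N by (intro power2_le_imp_le[of "2/3"]) auto
    then have "2 / 3 * (3 / 4 * M) \<le> real N * M * (3 / 4 * M)" using m by (intro mult_right_mono) auto
    also have "\<dots> = real N * (3 / 4 * M\<^sup>2)" by (simp add: power2_eq_square)
    also have "\<dots> \<le> real N * ((b - a) * 2)" using 1 by (intro mult_left_mono) auto
    finally show ?thesis by (simp add: algebra_simps)
  qed
  then show ?thesis by (simp add: M_def sa_def sb_def mult.assoc)
qed

text \<open>Around each interior node lies an interval of radius \<open>\<rho>\<close>; these
  intervals overlap at most in end points, stay inside [-1, 1], and on each the weight is comparable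
  to \<open>\<rho>\<close> from above. Summing the local inequality gives global integrals.\<close>

lemma discrete_norm_interior:
  assumes "N \<ge> 1"
  shows "(\<Sum>x\<in>lobatto_nodes N - {-1, 1}. lobatto_weight N x * (poly h x)\<^sup>2) \<le>
    72 * qint (h * h) + 2 / (real N)\<^sup>2 * qint (sqw * pderiv h * pderiv h)"
proof -
  have N: "1 \<le> real N" using assms by simp
  define I where "I = lobatto_nodes N - {-1, 1}"
  define s where "s x = sqrt (1 - x\<^sup>2)" for x
  \<comment> \<open>With the factor 8, \<open>interior_node_separation\<close> makes the intervals
    essentially disjoint, and \<open>1 - t^2\<close> stays at least half its value at the node. The
    weight bound becomes \<open>48 * \<rho>\<close>, whence \<open>72 = 48 * 3/2\<close>.\<close>
  define \<rho> where "\<rho> x = s x / (8 * real N)" for x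
  define \<Phi> where "\<Phi> = smult 72 (h * h) + smult (2 / (real N)\<^sup>2) (sqw * pderiv h * pderiv h)"
  have I: "x \<in> lobatto_nodes N" "-1 < x" "x < 1" if "x \<in> I" for x
    using that interior_lobatto_nodes[OF assms, of x] by (auto simp: I_def)
  have s: "0 < s x" "(s x)\<^sup>2 = 1 - x\<^sup>2" "2 / 3 \<le> real N * s x" "\<bar>x\<bar> \<le> 1 - (s x)\<^sup>2 / 2" if "x \<in> I" for x
  proof -
    have "x\<^sup>2 < 1" using I[OF that] by (auto simp: abs_square_less_1 abs_less_iff)
    then show 1: "0 < s x" "(s x)\<^sup>2 = 1 - x\<^sup>2" by (auto simp: s_def)
    have "1 \<le> real N * (real N + 1) * (s x)\<^sup>2"
      using interior_node_endpoint_distance[OF assms I(1)[OF that]] I[OF that] 1 by simp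
    also have "\<dots> \<le> 2 * (real N)\<^sup>2 * (s x)\<^sup>2"
      using N by (intro mult_right_mono) (auto simp: power2_eq_square algebra_simps)
    also have "\<dots> = 2 * (real N * s x)\<^sup>2" unfolding power_mult_distrib by (rule mult.assoc)
    finally have "(2 / 3)\<^sup>2 \<le> (real N * s x)\<^sup>2" by (simp add: power_divide)
    then show "2 / 3 \<le> real N * s x" using 1 by (intro power2_le_imp_le[of "2/3"]) auto
    have "0 \<le> (1 - \<bar>x\<bar>)\<^sup>2" by simp
    then show "\<bar>x\<bar> \<le> 1 - (s x)\<^sup>2 / 2" unfolding 1(2) by (simp add: power2_eq_square field_simps)
  qed
  have \<rho>: "0 < \<rho> x" "\<rho> x \<le> 3 / 16 * (s x)\<^sup>2" if "x \<in> I" for x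
  proof -
    show "0 < \<rho> x" using s[OF that] N by (simp add: \<rho>_def)
    have "s x * (2 / 3) \<le> s x * (real N * s x)" using s[OF that] by (intro mult_left_mono) auto
    then show "\<rho> x \<le> 3 / 16 * (s x)\<^sup>2" using N by (simp add: \<rho>_def field_simps power2_eq_square)
  qed
  have J: "{x - \<rho> x..x + \<rho> x} \<subseteq> {-1..1}" if "x \<in> I" for x
    using s(4)[OF that] \<rho>[OF that] s(1)[OF that] zero_le_power2[of "s x"] by (auto simp: abs_le_iff)
  have Jw: "(s x)\<^sup>2 \<le> 2 * (1 - t\<^sup>2)" if "x \<in> I" "t \<in> {x - \<rho> x..x + \<rho> x}" for x t
  proof -
    have t: "\<bar>t - x\<bar> \<le> \<rho> x" using that by (auto simp: abs_le_iff)
    have "\<bar>t + x\<bar> \<le> 2" using J[OF that(1)] that(2) I[OF that(1)] by auto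
    then have "\<bar>t - x\<bar> * \<bar>t + x\<bar> \<le> \<rho> x * 2" using t by (intro mult_mono) auto
    moreover have "t\<^sup>2 - x\<^sup>2 \<le> \<bar>t - x\<bar> * \<bar>t + x\<bar>"
      by (metis abs_ge_self abs_mult mult.commute power2_eq_square square_diff_square_factored)
    ultimately have "t\<^sup>2 - x\<^sup>2 \<le> 3 / 8 * (s x)\<^sup>2" using \<rho>(2)[OF that(1)] by linarith
    moreover have "A \<le> 2 * (1 - T)" if "T - X \<le> 3 / 8 * A" "A = 1 - X" "0 \<le> A" for A T X :: real
      using that by (simp add: field_simps)
    ultimately show ?thesis using s(2)[OF that(1)] zero_le_power2 by blast
  qed
  have main: "lobatto_weight N x * (poly h x)\<^sup>2 \<le> pint (x - \<rho> x) (x + \<rho> x) \<Phi>" if x: "x \<in> I" for x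
  proof -
    let ?p = "pint (x - \<rho> x) (x + \<rho> x)"
    have "lobatto_weight N x \<le> 48 * \<rho> x"
      using lobatto_weight_interior[OF assms I(1)[OF x]] I[OF x] by (simp add: \<rho>_def s_def)
    then have "lobatto_weight N x * (poly h x)\<^sup>2 \<le> 48 * \<rho> x * (poly h x)\<^sup>2"
      by (intro mult_right_mono) auto
    also have "\<dots> \<le> 48 * \<rho> x * (3 / (2 * \<rho> x) * ?p (h * h) + \<rho> x * ?p (pderiv h * pderiv h))"
      using \<rho>(1)[OF x] by (intro mult_left_mono poly_square_le_local_energy) auto
    also have "\<dots> = 72 * ?p (h * h) + 2 / (real N)\<^sup>2 * (24 * (real N * \<rho> x)\<^sup>2 * ?p (pderiv h * pderiv h))"
      using \<rho>(1)[OF x] N by (simp add: field_simps power2_eq_square)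
    also have "24 * (real N * \<rho> x)\<^sup>2 * ?p (pderiv h * pderiv h) = ?p (smult (24 / 64 * (s x)\<^sup>2) (pderiv h * pderiv h))"
      using N by (simp add: \<rho>_def pint_smult power_divide)
    also have "\<dots> \<le> ?p (sqw * pderiv h * pderiv h)"
    proof (rule pint_mono)
      fix t assume t: "t \<in> {x - \<rho> x..x + \<rho> x}"
      have "24 / 64 * A \<le> B" if "A \<le> 2 * B" "0 \<le> A" for A B :: real
        using that by (simp add: field_simps)
      from this[OF Jw[OF x t] zero_le_power2]
      have "24 / 64 * (s x)\<^sup>2 * (poly (pderiv h) t)\<^sup>2 \<le> (1 - t\<^sup>2) * (poly (pderiv h) t)\<^sup>2"
        by (rule mult_right_mono) simp
      then show "poly (smult (24 / 64 * (s x)\<^sup>2) (pderiv h * pderiv h)) t \<le> poly (sqw * pderiv h * pderiv h) t"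
        by (simp add: power2_eq_square algebra_simps)
    qed
    finally show ?thesis by (simp add: \<Phi>_def pint_add pint_smult mult_left_mono divide_right_mono)
  qed
  have sep: "x + \<rho> x \<le> y - \<rho> y" if "x \<in> I" "y \<in> I" "x < y" for x y
  proof -
    have "max (s x) (s y) \<le> 4 * real N * (y - x)"
      unfolding s_def by (rule interior_node_separation) (use I that assms in auto)
    then have "s x + s y \<le> 8 * real N * (y - x)" by linarith
    then have "(s x + s y) / (8 * real N) \<le> y - x"
      using N by (simp add: pos_divide_le_eq mult.commute)
    then show ?thesis by (simp add: \<rho>_def add_divide_distrib)
  qed
  have fin: "finite I" using finite_lobatto_nodes[OF assms] by (simp add: I_def)
  have A: "(poly \<Phi> has_integral (\<Sum>x\<in>I. pint (x - \<rho> x) (x + \<rho> x) \<Phi>)) (\<Union>x\<in>I. {x - \<rho> x..x + \<rho> x})"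
  proof (rule has_integral_UN[OF fin])
    show "(poly \<Phi> has_integral pint (x - \<rho> x) (x + \<rho> x) \<Phi>) {x - \<rho> x..x + \<rho> x}" for x
      unfolding pint_def by (intro integrable_integral poly_integrable)
    show "pairwise (\<lambda>x y. negligible ({x - \<rho> x..x + \<rho> x} \<inter> {y - \<rho> y..y + \<rho> y})) I"
    proof (rule pairwiseI)
      fix x y assume xy: "x \<in> I" "y \<in> I" "x \<noteq> y"
      have "{x - \<rho> x..x + \<rho> x} \<inter> {y - \<rho> y..y + \<rho> y} \<subseteq> {x + \<rho> x, y + \<rho> y}"
        using sep[OF xy(1,2)] sep[OF xy(2,1)] xy(3) by (cases "x < y") auto
      then show "negligible ({x - \<rho> x..x + \<rho> x} \<inter> {y - \<rho> y..y + \<rho> y})"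
        by (rule negligible_subset[rotated]) (simp add: negligible_finite)
    qed
  qed
  have nn: "0 \<le> poly \<Phi> t" if "t \<in> {-1..1}" for t
  proof -
    have "0 \<le> 1 - t\<^sup>2" using that by (auto simp: abs_square_le_1 abs_le_iff)
    then have "0 \<le> 2 / (real N)\<^sup>2 * ((1 - t\<^sup>2) * (poly (pderiv h) t)\<^sup>2)" by simp
    then show ?thesis by (simp add: \<Phi>_def power2_eq_square mult.assoc)
  qed
  have B: "(poly \<Phi> has_integral qint \<Phi>) {-1..1}"
    unfolding pint_def by (intro integrable_integral poly_integrable)
  have sub: "(\<Union>x\<in>I. {x - \<rho> x..x + \<rho> x}) \<subseteq> {-1..1}" by (rule UN_least[OF J])
  have "(\<Sum>x\<in>I. pint (x - \<rho> x) (x + \<rho> x) \<Phi>) \<le> qint \<Phi>"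
    by (rule has_integral_subset_le[OF sub A B]) (use nn in blast)
  moreover have "(\<Sum>x\<in>I. lobatto_weight N x * (poly h x)\<^sup>2) \<le> (\<Sum>x\<in>I. pint (x - \<rho> x) (x + \<rho> x) \<Phi>)"
    by (intro sum_mono main)
  ultimately show ?thesis by (simp add: I_def \<Phi>_def pint_add pint_smult)
qed

text \<open>The normalised associated Legendre function of order \<open>2 k\<close>: for even order
  the factor \<open>(1 - x^2)^(2k/2)\<close> is the polynomial \<open>sqw ^ k\<close>. The index is
  half the order.\<close>

definition aleg :: "nat \<Rightarrow> nat \<Rightarrow> real poly" where
  "aleg k n = smult (sqrt ((real n + 1/2) * (fact (n - 2 * k) / fact (n + 2 * k)))) (sqw ^ k * dleg (2 * k) n)"

lemma aleg_0: "aleg 0 n = nleg n"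
  by (simp add: aleg_def nleg_def dleg_0)

lemma aleg_orthonormal:
  assumes "2 * k \<le> n"
  shows "qint (aleg k n * aleg k j) = (if n = j then 1 else 0)"
proof -
  let ?c = "\<lambda>n. sqrt ((real n + 1/2) * (fact (n - 2 * k) / fact (n + 2 * k)))"
  have "aleg k n * aleg k j = smult (?c n * ?c j) (sqw ^ (2 * k) * dleg (2 * k) n * dleg (2 * k) j)"
    unfolding aleg_def mult_2 power_add by (simp add: mult_ac)
  then have "qint (aleg k n * aleg k j) = ?c n * ?c j *
      (if n = j then 2 / (2 * real n + 1) * (fact (n + 2 * k) / fact (n - 2 * k)) else 0)"
    using dleg_orth[OF assms, of j] by (simp add: pint_smult)
  also have "\<dots> = (if n = j then 1 else 0)"
  proof -
    have 1: "?c n * ?c n = (real n + 1/2) * (fact (n - 2 * k) / fact (n + 2 * k))" by simp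
    have "(real n + 1/2) * (2 / (2 * real n + 1)) = 1" by (simp add: field_simps)
    moreover have "(fact (n - 2 * k) / fact (n + 2 * k)) * (fact (n + 2 * k) / fact (n - 2 * k)) = (1 :: real)" by simp
    moreover have "?c n * ?c n * (2 / (2 * real n + 1) * (fact (n + 2 * k) / fact (n - 2 * k))) =
      ((real n + 1/2) * (2 / (2 * real n + 1))) * ((fact (n - 2 * k) / fact (n + 2 * k)) * (fact (n + 2 * k) / fact (n - 2 * k)))"
      unfolding 1 by (simp only: mult_ac)
    ultimately have "?c n * ?c n * (2 / (2 * real n + 1) * (fact (n + 2 * k) / fact (n - 2 * k))) = 1"
      by (simp only: mult_1_right)
    then show ?thesis by auto
  qed
  finally show ?thesis .
qed

lemma aleg_sum_square:
  fixes a :: "nat \<Rightarrow> real"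
  assumes "finite I" "\<And>n. n \<in> I \<Longrightarrow> 2 * k \<le> n"
  defines "h \<equiv> \<Sum>n\<in>I. smult (a n) (aleg k n)"
  shows "qint (h * h) = (\<Sum>n\<in>I. (a n)\<^sup>2)"
  unfolding h_def using assms(1,2)
  by (simp add: sum_distrib_left sum_distrib_right pint_sum pint_smult aleg_orthonormal
      mult_delta_right power2_eq_square cong: sum.cong)

text \<open>The associated Legendre equation of order \<open>m = 2 k\<close>, whose last term is
  \<open>m^2 / (1 - x^2)\<close> times the function. For \<open>k \<ge> 1\<close> this quotient is a
  polynomial, written with \<open>sqw ^ (k - 1)\<close>.\<close>

lemma aleg_ode:
  assumes "k \<ge> 1"
  shows "poly (pderiv (sqw * pderiv (aleg k n))) x = - (real n * (real n + 1)) * poly (aleg k n) x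
    + 4 * (real k)\<^sup>2 * poly (smult (sqrt ((real n + 1/2) * (fact (n - 2 * k) / fact (n + 2 * k))))
        (sqw ^ (k - 1) * dleg (2 * k) n)) x"
proof -
  obtain j where k: "k = Suc j" using assms by (cases k) auto
  define c where "c = sqrt ((real n + 1/2) * (fact (n - 2 * k) / fact (n + 2 * k)))"
  define v where "v = dleg (2 * k) n"
  define m where "m = real k"
  define w where "w = 1 - x\<^sup>2"
  have x2: "x\<^sup>2 = 1 - w" by (simp add: w_def)
  have ode: "w * poly (pderiv (pderiv v)) x = 2 * (2 * m + 1) * x * poly (pderiv v) x
      - (real n - 2 * m) * (real n + 2 * m + 1) * poly v x"
    using dleg_ode[of x "2 * k" n] by (simp add: v_def pderiv_dleg m_def w_def)
  have "sqw * pderiv (sqw ^ k * v) = sqw ^ k * (sqw * pderiv v + smult m ([:0, -2:] * v))"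
    by (intro real_poly_eqI) (simp only: k pderiv_mult pderiv_power_Suc pderiv_sqw m_def, simp add: algebra_simps)
  then have "poly (pderiv (sqw * pderiv (sqw ^ k * v))) x =
     w ^ k * (w * poly (pderiv (pderiv v)) x - 2 * x * poly (pderiv v) x - 2 * m * x * poly (pderiv v) x - 2 * m * poly v x)
     + m * w ^ j * (- (2 * x)) * (w * poly (pderiv v) x - 2 * m * x * poly v x)"
    by (simp only: k pderiv_mult pderiv_power_Suc pderiv_add pderiv_smult pderiv_sqw m_def)
       (simp add: pderiv_pCons w_def power2_eq_square algebra_simps)
  also have "\<dots> = w ^ j * (w * (w * poly (pderiv (pderiv v)) x) - (4 * m + 2) * x * w * poly (pderiv v) x
      - 2 * m * w * poly v x + 4 * m\<^sup>2 * x\<^sup>2 * poly v x)"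
    by (simp add: k power2_eq_square algebra_simps)
  also have "\<dots> = w ^ j * (w * (2 * (2 * m + 1) * x * poly (pderiv v) x
      - (real n - 2 * m) * (real n + 2 * m + 1) * poly v x) - (4 * m + 2) * x * w * poly (pderiv v) x
      - 2 * m * w * poly v x + 4 * m\<^sup>2 * (1 - w) * poly v x)"
    unfolding ode x2 ..
  also have "\<dots> = - (real n * (real n + 1)) * (w ^ k * poly v x) + 4 * m\<^sup>2 * (w ^ j * poly v x)"
    by (simp add: k power2_eq_square algebra_simps)
  finally have 1: "poly (pderiv (sqw * pderiv (sqw ^ k * v))) x = - (real n * (real n + 1)) * (w ^ k * poly v x) + 4 * m\<^sup>2 * (w ^ j * poly v x)" .
  have 2: "pderiv (sqw * pderiv (aleg k n)) = smult c (pderiv (sqw * pderiv (sqw ^ k * v)))"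
    by (simp add: aleg_def c_def v_def pderiv_smult)
  have 3: "poly (aleg k n) x = c * (w ^ k * poly v x)"
    by (simp add: aleg_def c_def v_def w_def poly_power power2_eq_square)
  have 4: "poly (smult c (sqw ^ (k - 1) * dleg (2 * k) n)) x = c * (w ^ j * poly v x)"
    by (simp add: v_def k poly_power w_def power2_eq_square)
  have "poly (pderiv (sqw * pderiv (aleg k n))) x = - (real n * (real n + 1)) * (c * (w ^ k * poly v x)) + 4 * m\<^sup>2 * (c * (w ^ j * poly v x))"
    unfolding 2 poly_smult 1 by (simp add: algebra_simps)
  then show ?thesis unfolding m_def 3[symmetric] 4[symmetric] unfolding c_def .
qed

lemma pderiv_sum: "pderiv (\<Sum>n\<in>I. f n) = (\<Sum>n\<in>I. pderiv (f n))"
  using higher_pderiv_sum[of 1 f I] by simp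

text \<open>Testing the equation with \<open>h\<close> itself leaves the eigenvalue sum minus
  \<open>4 k^2\<close> times the integral of \<open>h^2 / (1 - x^2)\<close>. This potential term is
  nonnegative, so the bound is the same as for order 0.\<close>

lemma aleg_sum_energy:
  fixes a :: "nat \<Rightarrow> real"
  assumes "k \<ge> 1" "finite I" "\<And>n. n \<in> I \<Longrightarrow> 2 * k \<le> n"
  defines "h \<equiv> \<Sum>n\<in>I. smult (a n) (aleg k n)"
  shows "qint (sqw * pderiv h * pderiv h) \<le> (\<Sum>n\<in>I. real n * (real n + 1) * (a n)\<^sup>2)"
proof -
  let ?c = "\<lambda>n. sqrt ((real n + 1/2) * (fact (n - 2 * k) / fact (n + 2 * k)))"
  define V where "V = (\<Sum>n\<in>I. smult (a n) (smult (?c n) (dleg (2 * k) n)))"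
  obtain j where k: "k = Suc j" using assms by (cases k) auto
  have hV: "h = sqw ^ k * V"
    by (simp add: h_def V_def aleg_def sum_distrib_left)
  have "pderiv (sqw * pderiv h) = (\<Sum>n\<in>I. smult (a n) (pderiv (sqw * pderiv (aleg k n))))"
    by (simp add: h_def pderiv_sum pderiv_smult sum_distrib_left)
  also have "\<dots> = (\<Sum>n\<in>I. smult (a n) (smult (- (real n * (real n + 1))) (aleg k n)
       + smult (4 * (real k)\<^sup>2) (smult (?c n) (sqw ^ j * dleg (2 * k) n))))"
    using aleg_ode[OF assms(1)] by (intro sum.cong refl real_poly_eqI) (simp add: k)
  also have "\<dots> = (\<Sum>n\<in>I. smult (- (real n * (real n + 1)) * a n) (aleg k n)) + smult (4 * (real k)\<^sup>2) (sqw ^ j * V)"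
    by (intro real_poly_eqI)
       (simp add: V_def poly_sum sum.distrib[symmetric] sum_distrib_left algebra_simps)
  finally have e: "pderiv (sqw * pderiv h) = (\<Sum>n\<in>I. smult (- (real n * (real n + 1)) * a n) (aleg k n)) + smult (4 * (real k)\<^sup>2) (sqw ^ j * V)" .
  have "qint (pderiv (sqw * pderiv h) * h) = - qint (sqw * pderiv h * pderiv h)"
    by (subst pint_by_parts) auto
  then have "qint (sqw * pderiv h * pderiv h) = - qint ((\<Sum>n\<in>I. smult (- (real n * (real n + 1)) * a n) (aleg k n)) * h)
      - 4 * (real k)\<^sup>2 * qint (sqw ^ j * V * h)"
    unfolding e by (simp add: distrib_right pint_add pint_smult)
  also have "qint ((\<Sum>n\<in>I. smult (- (real n * (real n + 1)) * a n) (aleg k n)) * h) = - (\<Sum>n\<in>I. real n * (real n + 1) * (a n)\<^sup>2)"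
    unfolding h_def sum_negf[symmetric] using assms(2,3)
    by (simp add: sum_distrib_left sum_distrib_right pint_sum pint_smult pint_minus aleg_orthonormal
      mult_delta_right power2_eq_square mult_ac cong: sum.cong)
  finally have "qint (sqw * pderiv h * pderiv h) = (\<Sum>n\<in>I. real n * (real n + 1) * (a n)\<^sup>2) - 4 * (real k)\<^sup>2 * qint (sqw ^ j * V * h)"
    by simp
  moreover have "0 \<le> qint (sqw ^ j * V * h)"
  proof (rule pint_nonneg)
    fix x :: real assume "x \<in> {-1..1}"
    then have "0 \<le> 1 - x\<^sup>2" by (auto simp: abs_square_le_1 abs_le_iff)
    then have "0 \<le> (1 - x\<^sup>2) * ((1 - x\<^sup>2) ^ j * poly V x)\<^sup>2" by simp
    then show "0 \<le> poly (sqw ^ j * V * h) x"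
      by (simp add: hV k poly_power power2_eq_square mult_ac)
  qed
  ultimately show ?thesis by simp
qed

section \<open>The discrete norm and the interpolation operator\<close>

definition dnorm :: "nat \<Rightarrow> real poly \<Rightarrow> real" where
  "dnorm N h = L2_set (\<lambda>x. sqrt (lobatto_weight N x) * poly h x) (lobatto_nodes N)"

lemma dnorm_triangle: "dnorm N (p + q) \<le> dnorm N p + dnorm N q"
  using L2_set_triangle_ineq by (simp add: dnorm_def distrib_left)

lemma dnorm_sum: "dnorm N (\<Sum>i\<in>I. f i) \<le> (\<Sum>i\<in>I. dnorm N (f i))"
proof (induction I rule: infinite_finite_induct)
  case (insert i I)
  then show ?case using dnorm_triangle[of N "f i" "\<Sum>i\<in>I. f i"] by simp
qed (simp_all add: dnorm_def L2_set_def)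

lemma dnorm_square:
  assumes "N \<ge> 1"
  shows "(dnorm N h)\<^sup>2 = (\<Sum>x\<in>lobatto_nodes N. lobatto_weight N x * (poly h x)\<^sup>2)"
proof -
  have "(dnorm N h)\<^sup>2 = (\<Sum>x\<in>lobatto_nodes N. (sqrt (lobatto_weight N x) * poly h x)\<^sup>2)"
    by (simp add: dnorm_def L2_set_def sum_nonneg)
  also have "\<dots> = (\<Sum>x\<in>lobatto_nodes N. lobatto_weight N x * (poly h x)\<^sup>2)"
    by (intro sum.cong refl) (simp add: power_mult_distrib less_imp_le lobatto_weight_pos[OF assms])
  finally show ?thesis .
qed

lemma dnorm_square_le:
  assumes "N \<ge> 1"
  shows "(dnorm N h)\<^sup>2 \<le> 72 * qint (h * h) + 2 / (real N)\<^sup>2 * qint (sqw * pderiv h * pderiv h)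
    + 2 / (real N)\<^sup>2 * ((poly h 1)\<^sup>2 + (poly h (-1))\<^sup>2)"
proof -
  have N: "1 \<le> real N" using assms by simp
  have "lobatto_nodes N = insert 1 (insert (-1) (lobatto_nodes N - {-1, 1}))"
    by (auto simp: lobatto_nodes_eq)
  then have "(dnorm N h)\<^sup>2 = lobatto_weight N 1 * (poly h 1)\<^sup>2 + lobatto_weight N (-1) * (poly h (-1))\<^sup>2
     + (\<Sum>x\<in>lobatto_nodes N - {-1, 1}. lobatto_weight N x * (poly h x)\<^sup>2)"
    using finite_lobatto_nodes[OF assms] unfolding dnorm_square[OF assms]
    by (metis (no_types, lifting) Diff_iff add.assoc finite_Diff finite_insert insertCI insertE one_neq_neg_one sum.insert)
  moreover have "2 / (real N * (real N + 1)) * ((poly h 1)\<^sup>2 + (poly h (-1))\<^sup>2) \<le> 2 / (real N)\<^sup>2 * ((poly h 1)\<^sup>2 + (poly h (-1))\<^sup>2)"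
    using N by (intro mult_right_mono divide_left_mono) (auto simp: power2_eq_square)
  ultimately show ?thesis
    using discrete_norm_interior[OF assms, of h] assms
    by (simp add: lobatto_weight_endpoint distrib_left)
qed

lemma pnorm_linterp_le: "N \<ge> 1 \<Longrightarrow> pnorm (linterp N (poly h)) \<le> dnorm N h"
proof (rule power2_le_imp_le)
  assume N: "N \<ge> 1"
  show "(pnorm (linterp N (poly h)))\<^sup>2 \<le> (dnorm N h)\<^sup>2"
    using pnorm_le_discrete[OF N degree_linterp[OF N], of "poly h"] poly_linterp[OF N, of _ "poly h"]
    by (simp add: dnorm_square[OF N])
qed (simp add: dnorm_def L2_set_nonneg)

section \<open>Truncation and aliasing errors\<close>

text \<open>Each term is split as a power \<open>3 - 2 r\<close>, decreasing because
  \<open>r > 3/2\<close>, times a power \<open>- 2\<close>, which is dominated by a telescoping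
  difference.\<close>

lemma sum_powr_tail:
  fixes r :: real
  assumes "r > 3/2" "N \<ge> 1"
  shows "(\<Sum>n\<in>{N<..M}. (real n + 1/2) powr (1 - 2 * r)) \<le> real N powr (2 - 2 * r)"
proof -
  have N: "1 \<le> real N" using assms by simp
  have step: "(real n + 1/2) powr (1 - 2 * r) \<le> real N powr (3 - 2 * r) * (1 / (real n - 1) - 1 / real n)"
    if "n \<in> {N<..M}" for n
  proof -
    have n: "real N \<le> real n - 1" "1 < real n" using that N by auto
    have "(real n + 1/2) powr (1 - 2 * r) = (real n + 1/2) powr (3 - 2 * r) * (real n + 1/2) powr (-2)"
      by (simp flip: powr_add)
    also have "\<dots> \<le> real N powr (3 - 2 * r) * (1 / (real n - 1) - 1 / real n)"
    proof (rule mult_mono)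
      show "(real n + 1/2) powr (3 - 2 * r) \<le> real N powr (3 - 2 * r)"
        using n N assms by (intro powr_mono2') auto
      have "(real n + 1/2) powr (-2) = 1 / (real n + 1/2)\<^sup>2"
        using n by (simp add: powr_minus_divide)
      also have "\<dots> \<le> 1 / ((real n - 1) * real n)"
        using n by (intro frac_le mult_pos_pos) (auto simp: power2_eq_square algebra_simps)
      also have "\<dots> = 1 / (real n - 1) - 1 / real n"
        using n by (simp add: divide_simps)
      finally show "(real n + 1/2) powr (-2) \<le> 1 / (real n - 1) - 1 / real n" .
    qed auto
    finally show ?thesis .
  qed
  have tel: "(\<Sum>n\<in>{N<..M}. 1 / (real n - 1) - 1 / real n) \<le> 1 / real N"
  proof (cases "N \<le> M")
    case True
    then have "(\<Sum>n\<in>{N<..M}. 1 / (real n - 1) - 1 / real n) = 1 / real N - 1 / real M"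
    proof (induction M rule: dec_induct)
      case (step m)
      have "{N<..Suc m} = insert (Suc m) {N<..m}" using step.hyps by auto
      then show ?case using step.IH by simp
    qed simp
    then show ?thesis by simp
  qed simp
  have "(\<Sum>n\<in>{N<..M}. (real n + 1/2) powr (1 - 2 * r)) \<le>
    (\<Sum>n\<in>{N<..M}. real N powr (3 - 2 * r) * (1 / (real n - 1) - 1 / real n))"
    by (intro sum_mono step)
  also have "\<dots> \<le> real N powr (3 - 2 * r) * (1 / real N)"
    unfolding sum_distrib_left[symmetric] by (intro mult_left_mono tel) auto
  also have "1 / real N = real N powr (-1)" using N by (simp add: powr_minus_divide)
  also have "real N powr (3 - 2 * r) * real N powr (-1) = real N powr (2 - 2 * r)"
    by (subst powr_add[symmetric]) simp
  finally show ?thesis .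
qed

lemma powr_square: "(x powr a)\<^sup>2 = x powr (2 * a)" for x a :: real
  by (simp only: power2_eq_square mult_2 powr_add)

lemma square_le_weighted:
  fixes r :: real
  assumes "r > 3/2" "1 \<le> L" "L \<le> real n"
  shows "(real n)\<^sup>2 * c\<^sup>2 \<le> L powr (2 - 2 * r) * ((real n + 1/2) powr (2 * r) * c\<^sup>2)"
proof -
  have "(real n)\<^sup>2 = real n powr 2" using assms by simp
  also have "\<dots> = real n powr (2 - 2 * r) * real n powr (2 * r)" by (simp flip: powr_add)
  also have "\<dots> \<le> L powr (2 - 2 * r) * (real n + 1/2) powr (2 * r)"
    using assms by (intro mult_mono powr_mono2' powr_mono2) auto
  finally have "(real n)\<^sup>2 \<le> L powr (2 - 2 * r) * (real n + 1/2) powr (2 * r)" .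
  from mult_right_mono[OF this zero_le_power2[of c]] show ?thesis by (simp only: mult.assoc)
qed

section \<open>Tail and aliased polynomials of a coefficient array\<close>

definition zonal_tail :: "nat \<Rightarrow> nat \<Rightarrow> (nat \<Rightarrow> int \<Rightarrow> real) \<Rightarrow> real poly" where
  "zonal_tail N M a = (\<Sum>n\<in>{N<..M}. smult (a n 0) (nleg n))"

text \<open>On the grid of angles \<open>k \<pi> / N\<close> the exponentials of orders
  \<open>2 N j\<close> and \<open>- 2 N j\<close> are 1, and both orders have the same polynomial
  \<open>aleg (N * j) n\<close>; hence their coefficients add up.\<close>

definition alias_poly :: "nat \<Rightarrow> nat \<Rightarrow> (nat \<Rightarrow> int \<Rightarrow> real) \<Rightarrow> nat \<Rightarrow> real poly" where
  "alias_poly N M a j = (\<Sum>n\<in>{2 * N * j..M}.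
     smult (a n (int (2 * N * j)) + a n (- int (2 * N * j))) (aleg (N * j) n))"

definition sobolev_sum :: "real \<Rightarrow> nat \<Rightarrow> (nat \<Rightarrow> int \<Rightarrow> real) \<Rightarrow> real" where
  "sobolev_sum r M a = (\<Sum>n\<le>M. \<Sum>m=- int n..int n. (real n + 1/2) powr (2 * r) * (a n m)\<^sup>2)"

lemma zonal_le_sobolev_sum:
  "(\<Sum>n\<in>{N<..M}. (real n + 1/2) powr (2 * r) * (a n 0)\<^sup>2) \<le> sobolev_sum r M a"
proof -
  have "(\<Sum>n\<in>{N<..M}. (real n + 1/2) powr (2 * r) * (a n 0)\<^sup>2) \<le> (\<Sum>n\<le>M. (real n + 1/2) powr (2 * r) * (a n 0)\<^sup>2)"
    by (intro sum_mono2) auto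
  also have "\<dots> \<le> sobolev_sum r M a"
    unfolding sobolev_sum_def
    by (intro sum_mono member_le_sum[of 0, where f = "\<lambda>m. (real _ + 1/2) powr (2 * r) * (a _ m)\<^sup>2"]) auto
  finally show ?thesis .
qed

text \<open>The pairs of a degree and an order \<open>2 N j\<close> or \<open>- 2 N j\<close> with
  \<open>j \<ge> 1\<close> are distinct, so the left side is a partial sum of the right one.\<close>

lemma alias_le_sobolev_sum:
  assumes "N \<ge> 1"
  shows "(\<Sum>j\<in>{1..M}. \<Sum>n\<in>{2 * N * j..M}. (real n + 1/2) powr (2 * r) *
      ((a n (int (2 * N * j)))\<^sup>2 + (a n (- int (2 * N * j)))\<^sup>2)) \<le> sobolev_sum r M a"
proof -
  define g where "g n m = (real n + 1/2) powr (2 * r) * (a n m)\<^sup>2" for n and m :: int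
  have g: "0 \<le> g n m" for n m by (simp add: g_def)
  have "(\<Sum>j\<in>{1..M}. \<Sum>n\<in>{2 * N * j..M}. g n (int (2 * N * j)) + g n (- int (2 * N * j))) =
     (\<Sum>j\<in>{1..M}. \<Sum>n\<in>{n \<in> {..M}. 2 * N * j \<le> n}. g n (int (2 * N * j)) + g n (- int (2 * N * j)))"
    by (intro sum.cong) auto
  also have "\<dots> = (\<Sum>n\<le>M. \<Sum>j\<in>{j \<in> {1..M}. 2 * N * j \<le> n}. g n (int (2 * N * j)) + g n (- int (2 * N * j)))"
    by (rule sum.swap_restrict) auto
  also have "\<dots> \<le> (\<Sum>n\<le>M. \<Sum>m=- int n..int n. g n m)"
  proof (rule sum_mono)
    fix n
    let ?J = "{j \<in> {1..M}. 2 * N * j \<le> n}"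
    let ?p = "\<lambda>j. int (2 * N * j)" and ?q = "\<lambda>j. - int (2 * N * j)"
    have inj: "inj_on ?p ?J" "inj_on ?q ?J" using assms by (auto simp: inj_on_def)
    have pq: "x > 0" "y < 0" if "x \<in> ?p ` ?J" "y \<in> ?q ` ?J" for x y
      using that assms by auto
    have "(\<Sum>j\<in>?J. g n (?p j) + g n (?q j)) = (\<Sum>m\<in>?p ` ?J. g n m) + (\<Sum>m\<in>?q ` ?J. g n m)"
      by (simp only: sum.distrib sum.reindex[OF inj(1)] sum.reindex[OF inj(2)] comp_def)
    also have "\<dots> = (\<Sum>m\<in>?p ` ?J \<union> ?q ` ?J. g n m)"
    proof (rule sum.union_disjoint[symmetric])
      have False if "x \<in> ?p ` ?J" "x \<in> ?q ` ?J" for x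
        using pq[OF that] by simp
      then show "?p ` ?J \<inter> ?q ` ?J = {}" by blast
    qed auto
    also have "\<dots> \<le> (\<Sum>m=- int n..int n. g n m)"
    proof (rule sum_mono2)
      show "?p ` ?J \<union> ?q ` ?J \<subseteq> {- int n..int n}"
      proof
        fix x assume "x \<in> ?p ` ?J \<union> ?q ` ?J"
        then obtain j where j: "2 * N * j \<le> n" "x = ?p j \<or> x = ?q j" by blast
        then have "?p j \<le> int n" by (simp only: of_nat_le_iff)
        moreover have "0 \<le> ?p j" by simp
        ultimately show "x \<in> {- int n..int n}" using j(2) by (auto simp del: of_nat_mult)
      qed
    qed (use g in auto)
    finally show "(\<Sum>j\<in>?J. g n (?p j) + g n (?q j)) \<le> (\<Sum>m=- int n..int n. g n m)" .
  qed
  finally show ?thesis by (simp add: g_def sobolev_sum_def distrib_left)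
qed

text \<open>Norm and energy contribute \<open>76\<close>, the two end points \<open>4\<close>, and
  \<open>80 \<le> 9^2\<close>. The end point values are controlled by the weighted coefficients
  because \<open>nleg n\<close> there has modulus \<open>sqrt (n + 1/2)\<close>.\<close>

lemma dnorm_zonal_tail:
  assumes "r > 3/2" "N \<ge> 1" "sobolev_sum r M a \<le> A\<^sup>2" "0 \<le> A"
  shows "dnorm N (zonal_tail N M a) \<le> 9 * real N powr (- r) * A"
proof (rule power2_le_imp_le)
  let ?I = "{N<..M}"
  define b where "b n = a n 0" for n
  define p where "p = zonal_tail N M a"
  have N: "1 \<le> real N" using assms by simp
  have p: "p = (\<Sum>n\<in>?I. smult (b n) (nleg n))" by (simp add: p_def zonal_tail_def b_def)
  have A: "(\<Sum>n\<in>?I. (real n + 1/2) powr (2 * r) * (b n)\<^sup>2) \<le> A\<^sup>2"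
    using zonal_le_sobolev_sum[of r a N M] assms(3) by (simp add: b_def)
  have "72 * qint (p * p) + 2 / (real N)\<^sup>2 * qint (sqw * pderiv p * pderiv p) =
     (\<Sum>n\<in>?I. (72 + 2 / (real N)\<^sup>2 * (real n * (real n + 1))) * (b n)\<^sup>2)"
    using pnorm_nleg_sum[of ?I b] legendre_energy[of ?I b]
    by (simp add: p pnorm_square sum_distrib_left sum.distrib distrib_right mult.assoc)
  also have "\<dots> \<le> (\<Sum>n\<in>?I. 76 / (real N)\<^sup>2 * (real N powr (2 - 2 * r) * ((real n + 1/2) powr (2 * r) * (b n)\<^sup>2)))"
  proof (rule sum_mono)
    fix n assume n: "n \<in> ?I"
    have "(real N)\<^sup>2 \<le> (real n)\<^sup>2" using n by (intro power_mono) auto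
    then have "72 \<le> 72 / (real N)\<^sup>2 * (real n)\<^sup>2" using N by (simp add: field_simps)
    moreover have "2 / (real N)\<^sup>2 * (real n * (real n + 1)) \<le> 2 / (real N)\<^sup>2 * (2 * (real n)\<^sup>2)"
      using n N by (intro mult_left_mono) (auto simp: power2_eq_square)
    moreover have "76 / (real N)\<^sup>2 * (real n)\<^sup>2 = 72 / (real N)\<^sup>2 * (real n)\<^sup>2 + 2 / (real N)\<^sup>2 * (2 * (real n)\<^sup>2)"
      by (simp add: field_simps)
    ultimately have "72 + 2 / (real N)\<^sup>2 * (real n * (real n + 1)) \<le> 76 / (real N)\<^sup>2 * (real n)\<^sup>2"
      by linarith
    then have "(72 + 2 / (real N)\<^sup>2 * (real n * (real n + 1))) * (b n)\<^sup>2 \<le> 76 / (real N)\<^sup>2 * (real n)\<^sup>2 * (b n)\<^sup>2"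
      by (intro mult_right_mono) auto
    also have "\<dots> = 76 / (real N)\<^sup>2 * ((real n)\<^sup>2 * (b n)\<^sup>2)" by simp
    also have "\<dots> \<le> 76 / (real N)\<^sup>2 * (real N powr (2 - 2 * r) * ((real n + 1/2) powr (2 * r) * (b n)\<^sup>2))"
      using n N assms(1) by (intro mult_left_mono square_le_weighted) auto
    finally show "(72 + 2 / (real N)\<^sup>2 * (real n * (real n + 1))) * (b n)\<^sup>2 \<le> \<dots>" .
  qed
  also have "\<dots> \<le> 76 / (real N)\<^sup>2 * (real N powr (2 - 2 * r) * A\<^sup>2)"
    unfolding sum_distrib_left[symmetric] using A by (intro mult_left_mono) auto
  finally have 1: "72 * qint (p * p) + 2 / (real N)\<^sup>2 * qint (sqw * pderiv p * pderiv p) \<le> \<dots>" .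
  have e: "(poly p x)\<^sup>2 \<le> real N powr (2 - 2 * r) * A\<^sup>2" if "x \<in> {-1, 1}" for x
  proof -
    have n: "(poly (nleg n) x)\<^sup>2 = real n + 1/2" for n
      using that by (auto simp: nleg_def power_mult_distrib legendre_poly_1 legendre_poly_minus_1
        simp flip: power_mult)
    \<comment> \<open>Opposite powers are inserted so that Cauchy-Schwarz separates the Sobolev sum
      from the sum bounded in \<open>sum_powr_tail\<close>.\<close>
    have "poly p x = (\<Sum>n\<in>?I. ((real n + 1/2) powr r * b n) * ((real n + 1/2) powr (- r) * poly (nleg n) x))"
    proof -
      have eq: "((real n + 1/2) powr r * b n) * ((real n + 1/2) powr (- r) * poly (nleg n) x) = b n * poly (nleg n) x" for n
      proof -
        have "(real n + 1/2) powr r * (real n + 1/2) powr (- r) = 1"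
          by (subst powr_add[symmetric]) simp
        then show ?thesis by (metis (no_types, lifting) mult.assoc mult.commute mult.left_neutral)
      qed
      show ?thesis by (simp only: p poly_sum poly_smult eq)
    qed
    then have "(poly p x)\<^sup>2 \<le> (\<Sum>n\<in>?I. ((real n + 1/2) powr r * b n)\<^sup>2) * (\<Sum>n\<in>?I. ((real n + 1/2) powr (- r) * poly (nleg n) x)\<^sup>2)"
      by (simp only: Cauchy_Schwarz_ineq_sum)
    also have "(\<Sum>n\<in>?I. ((real n + 1/2) powr r * b n)\<^sup>2) = (\<Sum>n\<in>?I. (real n + 1/2) powr (2 * r) * (b n)\<^sup>2)"
      by (intro sum.cong refl) (simp add: power_mult_distrib powr_power mult.commute)
    also have "(\<Sum>n\<in>?I. ((real n + 1/2) powr (- r) * poly (nleg n) x)\<^sup>2) = (\<Sum>n\<in>?I. (real n + 1/2) powr (1 - 2 * r))"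
    proof (intro sum.cong refl)
      fix n
      have "((real n + 1/2) powr (- r) * poly (nleg n) x)\<^sup>2 = (real n + 1/2) powr (2 * (- r)) * (real n + 1/2) powr 1"
        unfolding power_mult_distrib n powr_square
        by (subst powr_one) simp_all
      also have "\<dots> = (real n + 1/2) powr (2 * (- r) + 1)" by (rule powr_add[symmetric])
      also have "2 * (- r) + 1 = 1 - 2 * r" by simp
      finally show "((real n + 1/2) powr (- r) * poly (nleg n) x)\<^sup>2 = (real n + 1/2) powr (1 - 2 * r)" .
    qed
    also have "(\<Sum>n\<in>?I. (real n + 1/2) powr (2 * r) * (b n)\<^sup>2) * \<dots> \<le> A\<^sup>2 * real N powr (2 - 2 * r)"
      using assms A by (intro mult_mono sum_powr_tail sum_nonneg) auto
    finally show ?thesis by (simp add: mult.commute)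
  qed
  have "(dnorm N p)\<^sup>2 \<le> 76 / (real N)\<^sup>2 * (real N powr (2 - 2 * r) * A\<^sup>2)
      + 2 / (real N)\<^sup>2 * (real N powr (2 - 2 * r) * A\<^sup>2 + real N powr (2 - 2 * r) * A\<^sup>2)"
    by (rule order_trans[OF dnorm_square_le[OF assms(2)]]) (intro add_mono 1 mult_left_mono e, auto)
  also have "\<dots> = 80 * ((real N powr (2 - 2 * r) / (real N)\<^sup>2) * A\<^sup>2)" by (simp add: field_simps)
  also have "real N powr (2 - 2 * r) / (real N)\<^sup>2 = (real N powr (- r))\<^sup>2"
  proof -
    have "(real N)\<^sup>2 = real N powr 2" using N by simp
    then have "real N powr (2 - 2 * r) / (real N)\<^sup>2 = real N powr (2 - 2 * r - 2)" by (simp only: powr_diff)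
    then show ?thesis using N by (simp add: powr_power)
  qed
  also have "80 * ((real N powr (- r))\<^sup>2 * A\<^sup>2) \<le> (9 * real N powr (- r) * A)\<^sup>2"
    by (simp add: power_mult_distrib mult_right_mono)
  finally show "(dnorm N (zonal_tail N M a))\<^sup>2 \<le> (9 * real N powr (- r) * A)\<^sup>2" by (simp add: p_def)
qed (use assms in simp)

text \<open>End point terms vanish since \<open>sqw\<close> divides every
  \<open>aleg (N * j) n\<close>. The degrees are at least \<open>2 N j\<close>, so the decay is in
  \<open>N j\<close>, and this yields the summable factor in \<open>j\<close>.\<close>

lemma dnorm_alias_poly:
  assumes "r > 3/2" "N \<ge> 1" "j \<ge> 1"
  shows "dnorm N (alias_poly N M a j) \<le> 7 * real N powr (- r) * (real j powr (1 - r) *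
    sqrt (\<Sum>n\<in>{2 * N * j..M}. (real n + 1/2) powr (2 * r) *
      ((a n (int (2 * N * j)))\<^sup>2 + (a n (- int (2 * N * j)))\<^sup>2)))"
proof (rule power2_le_imp_le)
  let ?I = "{2 * N * j..M}"
  define B where "B = (\<Sum>n\<in>?I. (real n + 1/2) powr (2 * r) *
      ((a n (int (2 * N * j)))\<^sup>2 + (a n (- int (2 * N * j)))\<^sup>2))"
  define b where "b n = a n (int (2 * N * j)) + a n (- int (2 * N * j))" for n
  define p where "p = alias_poly N M a j"
  have B0: "0 \<le> B" unfolding B_def by (intro sum_nonneg) auto
  have N: "1 \<le> real N" "1 \<le> real j" using assms by auto
  have k: "N * j \<ge> 1" using assms by simp
  have p: "p = (\<Sum>n\<in>?I. smult (b n) (aleg (N * j) n))" by (simp add: p_def alias_poly_def b_def)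
  have "(\<Sum>n\<in>?I. (real n + 1/2) powr (2 * r) * (b n)\<^sup>2) \<le> (\<Sum>n\<in>?I. 2 * ((real n + 1/2) powr (2 * r) *
      ((a n (int (2 * N * j)))\<^sup>2 + (a n (- int (2 * N * j)))\<^sup>2)))"
  proof (rule sum_mono)
    fix n
    have "(b n)\<^sup>2 \<le> 2 * ((a n (int (2 * N * j)))\<^sup>2 + (a n (- int (2 * N * j)))\<^sup>2)"
      unfolding b_def using sum_squares_bound[of "a n (int (2 * N * j))" "a n (- int (2 * N * j))"]
      by (simp add: power2_sum)
    then show "(real n + 1/2) powr (2 * r) * (b n)\<^sup>2 \<le> 2 * ((real n + 1/2) powr (2 * r) *
      ((a n (int (2 * N * j)))\<^sup>2 + (a n (- int (2 * N * j)))\<^sup>2))"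
      using mult_left_mono[of "(b n)\<^sup>2" _ "(real n + 1/2) powr (2 * r)"] by (simp add: mult.left_commute)
  qed
  then have Bb: "(\<Sum>n\<in>?I. (real n + 1/2) powr (2 * r) * (b n)\<^sup>2) \<le> 2 * B"
    by (simp add: B_def sum_distrib_left)
  have I: "2 * (N * j) \<le> n" if "n \<in> ?I" for n using that by simp
  have ends: "poly p x = 0" if "x \<in> {-1, 1}" for x
    using that k by (auto simp: p aleg_def poly_sum poly_power power2_eq_square intro!: sum.neutral)
  have "qint (p * p) = (\<Sum>n\<in>?I. (b n)\<^sup>2)"
    unfolding p by (rule aleg_sum_square) (use I in auto)
  moreover have "qint (sqw * pderiv p * pderiv p) \<le> (\<Sum>n\<in>?I. real n * (real n + 1) * (b n)\<^sup>2)"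
    unfolding p by (rule aleg_sum_energy) (use I k in auto)
  then have "2 / (real N)\<^sup>2 * qint (sqw * pderiv p * pderiv p) \<le> 2 / (real N)\<^sup>2 * (\<Sum>n\<in>?I. real n * (real n + 1) * (b n)\<^sup>2)"
    by (intro mult_left_mono) auto
  ultimately have "(dnorm N p)\<^sup>2 \<le> 72 * (\<Sum>n\<in>?I. (b n)\<^sup>2) + 2 / (real N)\<^sup>2 * (\<Sum>n\<in>?I. real n * (real n + 1) * (b n)\<^sup>2)"
    using dnorm_square_le[OF assms(2), of p] ends[of 1] ends[of "-1"] by simp
  also have "\<dots> = (\<Sum>n\<in>?I. (72 + 2 / (real N)\<^sup>2 * (real n * (real n + 1))) * (b n)\<^sup>2)"
    by (simp add: sum_distrib_left sum.distrib distrib_right mult.assoc)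
  also have "\<dots> \<le> (\<Sum>n\<in>?I. 22 / (real N)\<^sup>2 * ((real N * real j) powr (2 - 2 * r) * ((real n + 1/2) powr (2 * r) * (b n)\<^sup>2)))"
  proof (rule sum_mono)
    fix n assume n: "n \<in> ?I"
    have "1 * 1 \<le> real N * real j" using N by (intro mult_mono) auto
    have le: "2 * real N * real j \<le> real n" using n of_nat_mono[of "2 * N * j" n, where 'a = real] by simp
    have "2 * real N * 1 \<le> 2 * real N * real j" using N by (intro mult_left_mono) auto
    then have "2 * real N \<le> real n" using le by linarith
    then have "(2 * real N)\<^sup>2 \<le> (real n)\<^sup>2" using N by (intro power_mono) auto
    then have "72 \<le> 18 / (real N)\<^sup>2 * (real n)\<^sup>2" using N by (simp add: field_simps)
    moreover have "2 / (real N)\<^sup>2 * (real n * (real n + 1)) \<le> 2 / (real N)\<^sup>2 * (2 * (real n)\<^sup>2)"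
      using \<open>2 * real N \<le> real n\<close> N by (intro mult_left_mono) (auto simp: power2_eq_square)
    moreover have "22 / (real N)\<^sup>2 * (real n)\<^sup>2 = 18 / (real N)\<^sup>2 * (real n)\<^sup>2 + 2 / (real N)\<^sup>2 * (2 * (real n)\<^sup>2)"
      by (simp add: field_simps)
    ultimately have "72 + 2 / (real N)\<^sup>2 * (real n * (real n + 1)) \<le> 22 / (real N)\<^sup>2 * (real n)\<^sup>2"
      by linarith
    then have "(72 + 2 / (real N)\<^sup>2 * (real n * (real n + 1))) * (b n)\<^sup>2 \<le> 22 / (real N)\<^sup>2 * (real n)\<^sup>2 * (b n)\<^sup>2"
      by (intro mult_right_mono) auto
    also have "\<dots> = 22 / (real N)\<^sup>2 * ((real n)\<^sup>2 * (b n)\<^sup>2)" by simp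
    also have "\<dots> \<le> 22 / (real N)\<^sup>2 * ((real N * real j) powr (2 - 2 * r) * ((real n + 1/2) powr (2 * r) * (b n)\<^sup>2))"
      using le N assms(1) \<open>1 * 1 \<le> real N * real j\<close> by (intro mult_left_mono square_le_weighted) auto
    finally show "(72 + 2 / (real N)\<^sup>2 * (real n * (real n + 1))) * (b n)\<^sup>2 \<le> \<dots>" .
  qed
  also have "\<dots> \<le> 22 / (real N)\<^sup>2 * ((real N * real j) powr (2 - 2 * r) * (2 * B))"
    unfolding sum_distrib_left[symmetric] using Bb by (intro mult_left_mono) auto
  also have "\<dots> = 44 * ((real N powr (2 - 2 * r) / (real N)\<^sup>2) * real j powr (2 - 2 * r) * B)"
    by (simp add: powr_mult)
  also have "real N powr (2 - 2 * r) / (real N)\<^sup>2 = (real N powr (- r))\<^sup>2"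
  proof -
    have "(real N)\<^sup>2 = real N powr 2" using N by simp
    then have "real N powr (2 - 2 * r) / (real N)\<^sup>2 = real N powr (2 - 2 * r - 2)" by (simp only: powr_diff)
    then show ?thesis using N by (simp add: powr_power)
  qed
  also have "real j powr (2 - 2 * r) = (real j powr (1 - r))\<^sup>2"
    using N by (simp add: powr_power algebra_simps)
  also have "44 * ((real N powr (- r))\<^sup>2 * (real j powr (1 - r))\<^sup>2 * B) \<le> 49 * ((real N powr (- r))\<^sup>2 * (real j powr (1 - r))\<^sup>2 * B)"
    using B0 by (intro mult_right_mono) auto
  also have "\<dots> = (7 * real N powr (- r) * (real j powr (1 - r) * sqrt B))\<^sup>2"
    using B0 by (simp add: power_mult_distrib mult.assoc)
  finally show "(dnorm N (alias_poly N M a j))\<^sup>2 \<le> (7 * real N powr (- r) * (real j powr (1 - r) * sqrt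
      (\<Sum>n\<in>?I. (real n + 1/2) powr (2 * r) * ((a n (int (2 * N * j)))\<^sup>2 + (a n (- int (2 * N * j)))\<^sup>2))))\<^sup>2"
    by (simp only: p_def B_def)
qed (auto intro!: mult_nonneg_nonneg sum_nonneg)

text \<open>Cauchy-Schwarz over \<open>j\<close>; the series of \<open>j powr (2 - 2 r)\<close>
  converges because \<open>r > 3/2\<close>. Its term at \<open>j = 0\<close> is
  \<open>0 powr _ = 0\<close>.\<close>

lemma dnorm_alias_sum:
  assumes "r > 3/2" "N \<ge> 1" "sobolev_sum r M a \<le> A\<^sup>2" "0 \<le> A"
  shows "dnorm N (\<Sum>j\<in>{1..M}. alias_poly N M a j) \<le>
    7 * sqrt (\<Sum>j. real j powr (2 - 2 * r)) * real N powr (- r) * A"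
proof -
  define B where "B j = (\<Sum>n\<in>{2 * N * j..M}. (real n + 1/2) powr (2 * r) *
      ((a n (int (2 * N * j)))\<^sup>2 + (a n (- int (2 * N * j)))\<^sup>2))" for j
  define Z where "Z = (\<Sum>j. real j powr (2 - 2 * r))"
  have B0: "0 \<le> B j" for j unfolding B_def by (intro sum_nonneg) auto
  have sm: "summable (\<lambda>j. real j powr (2 - 2 * r))"
    using assms(1) by (subst summable_real_powr_iff) auto
  have BA: "(\<Sum>j\<in>{1..M}. B j) \<le> A\<^sup>2"
    using alias_le_sobolev_sum[OF assms(2), of r a M] assms(3) by (simp add: B_def)
  have "(\<Sum>j\<in>{1..M}. real j powr (1 - r) * sqrt (B j))\<^sup>2 \<le> (\<Sum>j\<in>{1..M}. (real j powr (1 - r))\<^sup>2) * (\<Sum>j\<in>{1..M}. (sqrt (B j))\<^sup>2)"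
    by (rule Cauchy_Schwarz_ineq_sum)
  also have "(\<Sum>j\<in>{1..M}. (real j powr (1 - r))\<^sup>2) = (\<Sum>j\<in>{1..M}. real j powr (2 - 2 * r))"
    by (intro sum.cong refl) (simp add: powr_power algebra_simps)
  also have "(\<Sum>j\<in>{1..M}. (sqrt (B j))\<^sup>2) = (\<Sum>j\<in>{1..M}. B j)" using B0 by simp
  also have "(\<Sum>j\<in>{1..M}. real j powr (2 - 2 * r)) * (\<Sum>j\<in>{1..M}. B j) \<le> Z * A\<^sup>2"
    unfolding Z_def using BA B0 sm
    by (intro mult_mono sum_le_suminf suminf_nonneg sum_nonneg) auto
  finally have "(\<Sum>j\<in>{1..M}. real j powr (1 - r) * sqrt (B j)) \<le> sqrt (Z * A\<^sup>2)"
    by (rule real_le_rsqrt)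
  also have "\<dots> = sqrt Z * A" using assms(4) by (simp add: real_sqrt_mult)
  finally have 1: "(\<Sum>j\<in>{1..M}. real j powr (1 - r) * sqrt (B j)) \<le> sqrt Z * A" .
  have "dnorm N (\<Sum>j\<in>{1..M}. alias_poly N M a j) \<le> (\<Sum>j\<in>{1..M}. dnorm N (alias_poly N M a j))"
    by (rule dnorm_sum)
  also have "\<dots> \<le> (\<Sum>j\<in>{1..M}. 7 * real N powr (- r) * (real j powr (1 - r) * sqrt (B j)))"
    unfolding B_def by (intro sum_mono dnorm_alias_poly assms) auto
  also have "\<dots> \<le> 7 * real N powr (- r) * (sqrt Z * A)"
    unfolding sum_distrib_left[symmetric] by (intro mult_left_mono 1) auto
  finally show ?thesis by (simp add: Z_def mult_ac)
qed

lemma alias_poly_endpoint: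
  assumes "N \<ge> 1" "j \<ge> 1" "x \<in> {-1, 1}"
  shows "poly (alias_poly N M a j) x = 0"
  using assms by (auto simp: alias_poly_def aleg_def poly_sum poly_power power2_eq_square intro!: sum.neutral)

text \<open>Integration by parts comes before splitting, as only the difference \<open>t - q\<close>
  vanishes at both end points. Afterwards \<open>q\<close> is estimated by its degree
  \<open>N\<close>, and \<open>t\<close>, whose degree depends on \<open>M\<close>, by dyadic
  blocks.\<close>

lemma zonal_error_bound:
  fixes r :: real
  assumes "r > 3/2" "l \<le> 2" "r > loss_exponent l"
  obtains C where "C > 0"
    and "\<And>\<kappa> N M a A. \<lbrakk>\<kappa> > 0; N \<ge> 1; sobolev_sum r M a \<le> A\<^sup>2; 0 \<le> A\<rbrakk> \<Longrightarrow>
      cmod (oint \<kappa> (zonal_tail N M a - linterp N (poly (zonal_tail N M a + (\<Sum>j\<in>{1..M}. alias_poly N M a j)))))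
        \<le> C * \<kappa> powr (- real l) * real N powr (loss_exponent l - r) * A"
proof -
  let ?\<eta> = "loss_exponent l"
  define C1 where "C1 = 20 * 2 powr ?\<eta> / (1 - 2 powr (?\<eta> - r))"
  define C2 where "C2 = 9 + 7 * sqrt (\<Sum>j. real j powr (2 - 2 * r))"
  have sm: "summable (\<lambda>j. real j powr (2 - 2 * r))"
    using assms(1) by (subst summable_real_powr_iff) auto
  have "2 powr (?\<eta> - r) < 1" using assms by (simp add: powr_less_one)
  then have C1: "C1 > 0" by (simp add: C1_def)
  have C2: "C2 > 0" unfolding C2_def using suminf_nonneg[OF sm] by (auto intro: add_pos_nonneg)
  show ?thesis
  proof (rule that[of "C1 + 20 * C2"])
    fix \<kappa> A :: real and N M :: nat and a :: "nat \<Rightarrow> int \<Rightarrow> real"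
    assume *: "\<kappa> > 0" "N \<ge> 1" "sobolev_sum r M a \<le> A\<^sup>2" "0 \<le> A"
    define t where "t = zonal_tail N M a"
    define h where "h = t + (\<Sum>j\<in>{1..M}. alias_poly N M a j)"
    define q where "q = linterp N (poly h)"
    have N: "1 \<le> real N" using * by simp
    have "dnorm N h \<le> dnorm N t + dnorm N (\<Sum>j\<in>{1..M}. alias_poly N M a j)"
      unfolding h_def by (rule dnorm_triangle)
    also have "\<dots> \<le> 9 * real N powr (- r) * A + 7 * sqrt (\<Sum>j. real j powr (2 - 2 * r)) * real N powr (- r) * A"
      unfolding t_def by (intro add_mono dnorm_zonal_tail dnorm_alias_sum assms *)
    also have "\<dots> = C2 * (real N powr (- r) * A)" by (simp add: C2_def algebra_simps)
    finally have "pnorm q \<le> C2 * (real N powr (- r) * A)"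
      unfolding q_def using pnorm_linterp_le[OF *(2), of h] by linarith
    then have "20 * real N powr ?\<eta> * pnorm q \<le> 20 * real N powr ?\<eta> * (C2 * (real N powr (- r) * A))"
      by (intro mult_left_mono) auto
    moreover have "osc_seminorm l q \<le> 20 * real N powr ?\<eta> * pnorm q"
      unfolding q_def by (intro osc_seminorm_le degree_linterp * assms)
    moreover have "20 * real N powr ?\<eta> * (C2 * (real N powr (- r) * A)) = 20 * C2 * (real N powr (?\<eta> - r) * A)"
      by (simp add: powr_diff powr_minus_divide)
    ultimately have q: "osc_seminorm l q \<le> 20 * C2 * (real N powr (?\<eta> - r) * A)" by linarith
    have t: "osc_seminorm l t \<le> C1 * real N powr (?\<eta> - r) * A"
      unfolding t_def zonal_tail_def C1_def
      by (intro osc_seminorm_tail assms *(2,4) order_trans[OF zonal_le_sobolev_sum *(3)])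
    have ends: "poly (t - q) x = 0" if "x \<in> {-1, 1}" for x
    proof -
      have "x \<in> lobatto_nodes N" using that by (auto simp: lobatto_nodes_eq)
      then have "poly q x = poly h x" unfolding q_def by (rule poly_linterp[OF *(2)])
      moreover have "poly h x = poly t x"
        using alias_poly_endpoint[OF *(2) _ that] by (simp add: h_def poly_sum)
      ultimately show ?thesis by simp
    qed
    have "cmod (oint \<kappa> (t - q)) \<le> \<kappa> powr (- real l) * osc_seminorm l (t - q)"
      using ends by (intro norm_oint_le_osc_seminorm * assms) auto
    also have "osc_seminorm l (t - q) \<le> osc_seminorm l t + osc_seminorm l q"
      using osc_seminorm_triangle[of l t "- q"] by (simp add: osc_seminorm_minus)
    then have "\<kappa> powr (- real l) * osc_seminorm l (t - q) \<le> \<kappa> powr (- real l) * ((C1 + 20 * C2) * (real N powr (?\<eta> - r) * A))"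
      using q t by (intro mult_left_mono) (auto simp: algebra_simps)
    finally show "cmod (oint \<kappa> (zonal_tail N M a - linterp N (poly (zonal_tail N M a + (\<Sum>j\<in>{1..M}. alias_poly N M a j)))))
        \<le> (C1 + 20 * C2) * \<kappa> powr (- real l) * real N powr (?\<eta> - r) * A"
      by (simp add: q_def h_def t_def mult_ac)
  qed (use C1 C2 in simp)
qed

section \<open>Spherical harmonics\<close>

abbreviation sph_rect :: "(real \<times> real) set" where
  "sph_rect \<equiv> {0..pi} \<times> {0..2 * pi}"

lemma sph_rect_cbox: "sph_rect = cbox (0, 0) (pi, 2 * pi)"
  by (simp add: cbox_Pair_eq)

lemma sph_rect_lebesgue: "sph_rect \<in> sets lebesgue"
  unfolding sph_rect_cbox by simp

lemma compact_sph_rect: "compact sph_rect"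
  unfolding sph_rect_cbox by simp

definition sph_integrable :: "(real \<times> real \<Rightarrow> complex) \<Rightarrow> bool" where
  "sph_integrable F \<longleftrightarrow> set_integrable lebesgue sph_rect (\<lambda>x. F x * of_real (sin (fst x)))"

lemma sph_integral_add:
  "\<lbrakk>sph_integrable F; sph_integrable G\<rbrakk> \<Longrightarrow> sph_integral (\<lambda>x. F x + G x) = sph_integral F + sph_integral G"
  unfolding sph_integrable_def sph_integral_def distrib_right by (rule set_integral_add)

lemma sph_integral_diff:
  "\<lbrakk>sph_integrable F; sph_integrable G\<rbrakk> \<Longrightarrow> sph_integral (\<lambda>x. F x - G x) = sph_integral F - sph_integral G"
  unfolding sph_integrable_def sph_integral_def left_diff_distrib by (rule set_integral_diff)

lemma sph_integrable_add:
  "\<lbrakk>sph_integrable F; sph_integrable G\<rbrakk> \<Longrightarrow> sph_integrable (\<lambda>x. F x + G x)"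
  unfolding sph_integrable_def distrib_right by (rule set_integral_add)

lemma sph_integrable_diff:
  "\<lbrakk>sph_integrable F; sph_integrable G\<rbrakk> \<Longrightarrow> sph_integrable (\<lambda>x. F x - G x)"
  unfolding sph_integrable_def left_diff_distrib by (rule set_integral_diff)

lemma sph_integral_cmult: "sph_integral (\<lambda>x. c * F x) = c * sph_integral F"
  unfolding sph_integral_def mult.assoc by simp

lemma sph_integrable_cmult: "sph_integrable F \<Longrightarrow> sph_integrable (\<lambda>x. c * F x)"
  unfolding sph_integrable_def mult.assoc by simp

lemma sph_integrable_0: "sph_integrable (\<lambda>x. 0)"
  by (simp add: sph_integrable_def set_integrable_def)

lemma sph_integrable_sum:
  "(\<And>i. i \<in> I \<Longrightarrow> sph_integrable (f i)) \<Longrightarrow> sph_integrable (\<lambda>x. \<Sum>i\<in>I. f i x)"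
  by (induction I rule: infinite_finite_induct) (auto intro: sph_integrable_add sph_integrable_0)

lemma sph_integral_0: "sph_integral (\<lambda>x. 0) = 0"
  by (simp add: sph_integral_def)

lemma sph_integral_sum:
  "(\<And>i. i \<in> I \<Longrightarrow> sph_integrable (f i)) \<Longrightarrow> sph_integral (\<lambda>x. \<Sum>i\<in>I. f i x) = (\<Sum>i\<in>I. sph_integral (f i))"
  by (induction I rule: infinite_finite_induct)
     (auto simp: sph_integral_0 sph_integral_add sph_integrable_sum)

lemma sph_integral_cong: "(\<And>x. x \<in> sph_rect \<Longrightarrow> F x = G x) \<Longrightarrow> sph_integral F = sph_integral G"
  unfolding sph_integral_def by (intro set_lebesgue_integral_cong sph_rect_lebesgue) auto

lemma sph_integrable_mult_continuous:
  assumes "sph_integrable F" "continuous_on sph_rect g"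
  shows "sph_integrable (\<lambda>x. g x * F x)"
proof -
  have "(\<lambda>x. g x * (F x * of_real (sin (fst x)))) absolutely_integrable_on sph_rect"
    by (rule absolutely_integrable_bounded_measurable_product[OF bilinear_times])
       (use assms in \<open>auto intro!: continuous_imp_measurable_on_sets_lebesgue sph_rect_lebesgue
         compact_imp_bounded compact_continuous_image compact_sph_rect simp: sph_integrable_def\<close>)
  then show ?thesis by (simp add: sph_integrable_def mult.assoc)
qed

lemma sph_integrable_continuous: "continuous_on sph_rect F \<Longrightarrow> sph_integrable F"
  unfolding sph_integrable_def sph_rect_cbox
  by (intro absolutely_integrable_continuous continuous_intros)

lemma sph_integral_iterated:
  assumes "continuous_on sph_rect F"
  shows "sph_integral F = integral {0..pi} (\<lambda>\<theta>. integral {0..2 * pi} (\<lambda>\<phi>. F (\<theta>, \<phi>)) * of_real (sin \<theta>))"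
proof -
  have c: "continuous_on (cbox (0, 0) (pi, 2 * pi)) (\<lambda>x. F x * of_real (sin (fst x)))"
    using assms unfolding sph_rect_cbox by (intro continuous_intros)
  have "sph_integral F = integral (cbox (0, 0) (pi, 2 * pi)) (\<lambda>x. F x * of_real (sin (fst x)))"
    unfolding sph_integral_def sph_rect_cbox
    by (intro set_lebesgue_integral_eq_integral absolutely_integrable_continuous c)
  also have "\<dots> = integral {0..pi} (\<lambda>\<theta>. integral {0..2 * pi} (\<lambda>\<phi>. F (\<theta>, \<phi>) * of_real (sin \<theta>)))"
    using integral_prod_continuous[OF c] by simp
  finally show ?thesis by simp
qed

lemma sph_integral_product:
  assumes "continuous_on {0..pi} f" "continuous_on {0..2 * pi} g"
  shows "sph_integral (\<lambda>x. f (fst x) * g (snd x)) =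
    integral {0..pi} (\<lambda>\<theta>. f \<theta> * of_real (sin \<theta>)) * integral {0..2 * pi} g"
proof -
  have "continuous_on sph_rect (\<lambda>x. f (fst x) * g (snd x))"
    by (intro continuous_intros continuous_on_compose2[OF assms(1)] continuous_on_compose2[OF assms(2)]) auto
  then have "sph_integral (\<lambda>x. f (fst x) * g (snd x)) =
     integral {0..pi} (\<lambda>\<theta>. integral {0..2 * pi} (\<lambda>\<phi>. f \<theta> * g \<phi>) * of_real (sin \<theta>))"
    by (simp add: sph_integral_iterated)
  also have "\<dots> = integral {0..pi} (\<lambda>\<theta>. (f \<theta> * of_real (sin \<theta>)) * integral {0..2 * pi} g)"
    by (simp add: integral_mult_right mult_ac)
  finally show ?thesis by (simp add: integral_mult_left)
qed

text \<open>\<open>2 \<pi>^2\<close> is the area of the parameter rectangle; the factor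
  \<open>sin\<close> is bounded by 1.\<close>

lemma norm_sph_integral_le:
  assumes "sph_integrable F" "\<And>x. x \<in> sph_rect \<Longrightarrow> cmod (F x) \<le> B"
  shows "cmod (sph_integral F) \<le> 2 * pi\<^sup>2 * B"
proof -
  have i: "set_integrable lebesgue sph_rect (\<lambda>x. F x * complex_of_real (sin (fst x)))"
    using assms(1) by (simp add: sph_integrable_def)
  have "sph_integral F = integral sph_rect (\<lambda>x. F x * complex_of_real (sin (fst x)))"
    unfolding sph_integral_def by (rule set_lebesgue_integral_eq_integral(2)[OF i])
  also have "cmod \<dots> \<le> integral sph_rect (\<lambda>x. B)"
  proof (rule Henstock_Kurzweil_Integration.integral_norm_bound_integral[OF set_lebesgue_integral_eq_integral(1)[OF i]])
    show "(\<lambda>x. B) integrable_on sph_rect" unfolding sph_rect_cbox by (rule integrable_const)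
    fix x :: "real \<times> real" assume x: "x \<in> sph_rect"
    have "cmod (F x) * \<bar>sin (fst x)\<bar> \<le> B * 1"
      by (intro mult_mono assms(2)[OF x] order_trans[OF norm_ge_zero assms(2)[OF x]]) auto
    then show "norm (F x * complex_of_real (sin (fst x))) \<le> B" by (simp add: norm_mult)
  qed
  also have "\<dots> = 2 * pi\<^sup>2 * B"
    unfolding sph_rect_cbox by (simp add: content_Pair power2_eq_square)
  finally show ?thesis .
qed

lemma sph_integral_uniform_limit:
  assumes "uniform_limit sph_rect F G sequentially"
    and "\<And>k. sph_integrable (F k)" "sph_integrable G"
  shows "(\<lambda>k. sph_integral (F k)) \<longlonglongrightarrow> sph_integral G"
proof (rule LIMSEQ_I)
  fix e :: real assume e: "e > 0"
  define d where "d = e / (4 * pi\<^sup>2)"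
  have d: "d > 0" using e by (simp add: d_def)
  from uniform_limitD[OF assms(1) d] obtain K where
    K: "\<And>k x. k \<ge> K \<Longrightarrow> x \<in> sph_rect \<Longrightarrow> dist (F k x) (G x) < d"
    unfolding eventually_sequentially by blast
  show "\<exists>no. \<forall>n\<ge>no. norm (sph_integral (F n) - sph_integral G) < e"
  proof (intro exI[of _ K] allI impI)
    fix k assume k: "K \<le> k"
    have "norm (sph_integral (\<lambda>x. F k x - G x)) \<le> 2 * pi\<^sup>2 * d"
      by (intro norm_sph_integral_le sph_integrable_diff assms)
         (use K[OF k] in \<open>auto simp: dist_norm less_imp_le\<close>)
    also have "\<dots> < e" using e by (simp add: d_def)
    finally show "norm (sph_integral (F k) - sph_integral G) < e"
      by (simp add: sph_integral_diff assms)
  qed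
qed

section \<open>Integrals in \<open>\<phi>\<close> and the substitution
  \<open>x = cos \<theta>\<close>\<close>

lemma integral_exp_period:
  "integral {0..2 * pi} (\<lambda>\<phi>. exp (\<i> * of_int m * of_real \<phi>)) = (if m = 0 then of_real (2 * pi) else 0)"
proof (cases "m = 0")
  case False
  let ?f = "\<lambda>z. exp (\<i> * of_int m * z) / (\<i> * of_int m)"
  have "((\<lambda>\<phi>. exp (\<i> * of_int m * of_real \<phi>)) has_integral (?f (of_real (2 * pi)) - ?f (of_real 0))) {0..2 * pi}"
  proof (rule fundamental_theorem_of_calculus)
    fix x
    have "(?f has_field_derivative exp (\<i> * of_int m * of_real x)) (at (of_real x))"
      using False by (auto intro!: derivative_eq_intros)
    then show "((\<lambda>x. ?f (of_real x)) has_vector_derivative exp (\<i> * of_int m * of_real x)) (at x within {0..2 * pi})"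
      by (rule has_vector_derivative_real_field)
  qed simp
  moreover have "exp (\<i> * of_int m * of_real (2 * pi)) = 1"
    using exp_integer_2pi[of "of_int m"] by (simp add: mult_ac)
  ultimately show ?thesis using False by (simp add: integral_unique)
qed (simp add: scaleR_conv_of_real)

lemma integral_cos_substitution:
  fixes f :: "real \<Rightarrow> complex"
  assumes "continuous_on {-1..1} f"
  shows "integral {0..pi} (\<lambda>\<theta>. f (cos \<theta>) * of_real (sin \<theta>)) = integral {-1..1} f"
proof -
  \<comment> \<open>The cosine reverses the orientation: the first interval on the right is empty,
    and the second integral enters with a minus sign.\<close>
  have "((\<lambda>x. (- sin x) *\<^sub>R f (cos x)) has_integral (integral {cos 0..cos pi} f - integral {cos pi..cos 0} f)) {0..pi}"
    by (rule has_integral_substitution_general[where s = "{}" and c = "-1" and d = 1])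
       (auto intro!: continuous_intros assms derivative_eq_intros)
  then have "((\<lambda>x. - ((- sin x) *\<^sub>R f (cos x))) has_integral - (- integral {-1..1} f)) {0..pi}"
    by (intro has_integral_neg) simp
  then show ?thesis by (simp add: scaleR_conv_of_real mult.commute integral_unique)
qed

text \<open>\<open>(x + i y)^m\<close>, or \<open>(x - i y)^(-m)\<close> for negative
  \<open>m\<close>: the factor \<open>sin^(\<bar>m\<bar>) \<theta> exp (i m \<phi>)\<close> as a
  polynomial in Cartesian coordinates, continuous at the poles as well.\<close>

definition zpow :: "int \<Rightarrow> real ^ 3 \<Rightarrow> complex" where
  "zpow m v = (if m \<ge> 0 then Complex (v $ 1) (v $ 2) else Complex (v $ 1) (- (v $ 2))) ^ nat \<bar>m\<bar>"

definition harm_const :: "nat \<Rightarrow> int \<Rightarrow> real" where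
  "harm_const n m = (-1) ^ nat ((m + \<bar>m\<bar>) div 2) *
     sqrt ((real n + 1/2) * (fact (n - nat \<bar>m\<bar>) / fact (n + nat \<bar>m\<bar>))) / sqrt (2 * pi)"

definition harm :: "nat \<Rightarrow> int \<Rightarrow> real ^ 3 \<Rightarrow> complex" where
  "harm n m v = of_real (harm_const n m * poly (dleg (nat \<bar>m\<bar>) n) (v $ 3)) * zpow m v"

lemma sph_param_nth:
  "sph_param (\<theta>, \<phi>) $ 1 = sin \<theta> * cos \<phi>"
  "sph_param (\<theta>, \<phi>) $ 2 = sin \<theta> * sin \<phi>"
  "sph_param (\<theta>, \<phi>) $ 3 = cos \<theta>"
  by (simp_all add: sph_param_def)

lemma zpow_sph_param: "zpow m (sph_param (\<theta>, \<phi>)) = of_real (sin \<theta> ^ nat \<bar>m\<bar>) * exp (\<i> * of_int m * of_real \<phi>)"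
proof (cases "m \<ge> 0")
  case True
  then obtain k where m: "m = int k" using nonneg_int_cases by blast
  have "Complex (sin \<theta> * cos \<phi>) (sin \<theta> * sin \<phi>) = of_real (sin \<theta>) * exp (\<i> * of_real \<phi>)"
    by (simp add: complex_eq_iff Re_exp Im_exp)
  then show ?thesis by (simp add: zpow_def sph_param_nth m power_mult_distrib exp_of_nat_mult[symmetric] mult_ac)
next
  case False
  then obtain k where m: "m = - int k" by (metis int_cases2 of_nat_0_le_iff)
  have "Complex (sin \<theta> * cos \<phi>) (- (sin \<theta> * sin \<phi>)) = of_real (sin \<theta>) * exp (- \<i> * of_real \<phi>)"
    by (simp add: complex_eq_iff Re_exp Im_exp)
  moreover have "exp (- \<i> * of_real \<phi>) ^ k = exp (\<i> * of_int m * of_real \<phi>)"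
    by (simp add: m exp_of_nat_mult[symmetric] mult_ac)
  ultimately show ?thesis using False by (simp add: zpow_def sph_param_nth power_mult_distrib m)
qed

text \<open>The restriction on \<open>\<theta>\<close> enters through
  \<open>sqrt (1 - cos^2 \<theta>) = sin \<theta>\<close>, which requires a nonnegative
  sine.\<close>

lemma sph_harm_eq_harm:
  assumes "\<theta> \<in> {0..pi}"
  shows "sph_harm n m (\<theta>, \<phi>) = harm n m (sph_param (\<theta>, \<phi>))"
proof -
  have 1: "sqrt (1 - (cos \<theta>)\<^sup>2) = sin \<theta>"
    using assms sin_ge_zero[of \<theta>] by (simp add: sin_squared_eq[symmetric])
  have 2: "assoc_legendre n k x = sqrt (1 - x\<^sup>2) ^ k * poly (dleg k n) x" for k x
    by (simp add: assoc_legendre_def dleg_eq_rodrigues)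
  have 3: "(2 * real n + 1) / 2 = real n + 1/2" by simp
  have "Q_fun n k \<theta> = sqrt ((real n + 1/2) * (fact (n - k) / fact (n + k))) * (sin \<theta> ^ k * poly (dleg k n) (cos \<theta>))" for k
    unfolding Q_fun_def 2 1 3 ..
  then show ?thesis
    by (simp add: sph_harm_def harm_def harm_const_def zpow_sph_param e_fun_def sph_param_nth mult_ac)
qed

lemma cmod_zpow: "v \<in> sphere 0 1 \<Longrightarrow> (cmod (zpow m v))\<^sup>2 = (1 - (v $ 3)\<^sup>2) ^ nat \<bar>m\<bar>"
proof -
  assume "v \<in> sphere 0 1"
  then have "(v $ 1)\<^sup>2 + (v $ 2)\<^sup>2 + (v $ 3)\<^sup>2 = 1"
    by (simp add: norm_eq_1 inner_vec_def sum_3 power2_eq_square)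
  then have "(v $ 1)\<^sup>2 + (v $ 2)\<^sup>2 = 1 - (v $ 3)\<^sup>2" by simp
  then have "(cmod (Complex (v $ 1) (v $ 2)))\<^sup>2 = 1 - (v $ 3)\<^sup>2" "(cmod (Complex (v $ 1) (- (v $ 2))))\<^sup>2 = 1 - (v $ 3)\<^sup>2"
    by (simp_all add: cmod_power2)
  then show ?thesis
    by (simp add: zpow_def norm_power power_mult[symmetric] mult.commute[of _ 2])
       (simp add: power_mult)
qed

lemma sum_abs_int:
  fixes f :: "nat \<Rightarrow> real"
  shows "(\<Sum>m=- int n..int n. f (nat \<bar>m\<bar>)) = f 0 + 2 * (\<Sum>m=1..n. f m)"
proof (induction n)
  case (Suc n)
  have "{- int (Suc n)..int (Suc n)} = insert (int (Suc n)) (insert (- int (Suc n)) {- int n..int n})" by auto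
  then show ?case using Suc by (simp add: nat_add_distrib)
qed simp

lemma harm_const_square:
  "(harm_const n m)\<^sup>2 = (real n + 1/2) / (2 * pi) * (fact (n - nat \<bar>m\<bar>) / fact (n + nat \<bar>m\<bar>))"
  by (simp add: harm_const_def power_mult_distrib power_divide power_mult[symmetric])

text \<open>The orders \<open>m\<close> and \<open>- m\<close> contribute equally, and
  \<open>legendre_addition\<close> evaluates the sum. The value bounds partial sums uniformly on the
  sphere.\<close>

lemma harm_addition:
  assumes "v \<in> sphere 0 1"
  shows "(\<Sum>m=- int n..int n. (cmod (harm n m v))\<^sup>2) = (2 * real n + 1) / (4 * pi)"
proof -
  define c where "c = (real n + 1/2) / (2 * pi)"
  define g where "g k = fact (n - k) / fact (n + k) * (1 - (v $ 3)\<^sup>2) ^ k * (poly (dleg k n) (v $ 3))\<^sup>2" for k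
  define f where "f k = c * g k" for k
  have "(cmod (harm n m v))\<^sup>2 = f (nat \<bar>m\<bar>)" for m
  proof -
    note harm_const_square[of n m]
    then show ?thesis
      by (simp add: harm_def norm_mult power_mult_distrib cmod_zpow[OF assms] f_def c_def g_def mult_ac)
  qed
  then have "(\<Sum>m=- int n..int n. (cmod (harm n m v))\<^sup>2) = f 0 + 2 * (\<Sum>m=1..n. f m)"
    using sum_abs_int[where f = f] by simp
  also have "\<dots> = c * (g 0 + 2 * (\<Sum>m=1..n. g m))"
    by (simp add: f_def sum_distrib_left[symmetric] algebra_simps)
  also have "g 0 + 2 * (\<Sum>m=1..n. g m) = 1"
    using legendre_addition[of n "v $ 3"] by (simp add: g_def dleg_0)
  finally show ?thesis by (simp add: c_def field_simps)
qed

lemma continuous_on_sph_param: "continuous_on S sph_param"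
proof -
  have e: "sph_param = (\<lambda>x. \<chi> i. if i = 1 then sin (fst x) * cos (snd x)
     else if i = 2 then sin (fst x) * sin (snd x) else cos (fst x))"
    by (auto simp: fun_eq_iff vec_eq_iff forall_3 sph_param_nth)
  have "continuous_on S (\<lambda>x. if i = 1 then sin (fst x) * cos (snd x)
     else if i = 2 then sin (fst x) * sin (snd x) else cos (fst x))" for i :: 3
    by (cases "i = 1"; cases "i = 2") (auto intro!: continuous_intros)
  then show ?thesis unfolding e by (rule continuous_on_vec_lambda)
qed

lemma sph_param_sphere: "sph_param x \<in> sphere 0 1"
proof -
  obtain \<theta> \<phi> where x: "x = (\<theta>, \<phi>)" by (cases x)
  have "(sin \<theta> * cos \<phi>)\<^sup>2 + (sin \<theta> * sin \<phi>)\<^sup>2 + (cos \<theta>)\<^sup>2 = (sin \<theta>)\<^sup>2 * ((cos \<phi>)\<^sup>2 + (sin \<phi>)\<^sup>2) + (cos \<theta>)\<^sup>2"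
    by (simp only: power_mult_distrib distrib_left)
  also have "\<dots> = 1" by simp
  finally have "(sin \<theta> * cos \<phi>)\<^sup>2 + (sin \<theta> * sin \<phi>)\<^sup>2 + (cos \<theta>)\<^sup>2 = 1" .
  then have "inner (sph_param x) (sph_param x) = 1"
    by (simp add: x inner_vec_def sum_3 sph_param_nth power2_eq_square)
  then show ?thesis by (simp add: norm_eq_1)
qed

lemma continuous_on_zpow: "continuous_on S (zpow m)"
  unfolding zpow_def Complex_eq by (cases "m \<ge> 0") (auto intro!: continuous_intros)

lemma continuous_on_harm: "continuous_on S (harm n m)"
  unfolding harm_def by (intro continuous_intros continuous_on_zpow)

lemma continuous_on_harm_param: "continuous_on S (\<lambda>x. harm n m (sph_param x))"
  by (rule continuous_on_compose2[OF continuous_on_harm continuous_on_sph_param subset_UNIV])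

lemma sph_harm_eq: "x \<in> sph_rect \<Longrightarrow> sph_harm n m x = harm n m (sph_param x)"
  using sph_harm_eq_harm by (cases x) auto

lemma harm_product:
  "harm n m (sph_param x) * cnj (harm k l (sph_param x)) =
    of_real (harm_const n m * harm_const k l * (poly (dleg (nat \<bar>m\<bar>) n) (cos (fst x)) * poly (dleg (nat \<bar>l\<bar>) k) (cos (fst x))
      * sin (fst x) ^ (nat \<bar>m\<bar> + nat \<bar>l\<bar>))) * exp (\<i> * of_int (m - l) * of_real (snd x))"
proof -
  obtain \<theta> \<phi> where x: "x = (\<theta>, \<phi>)" by (cases x)
  have "exp (\<i> * of_int m * of_real \<phi>) * cnj (exp (\<i> * of_int l * of_real \<phi>)) = exp (\<i> * of_int (m - l) * of_real \<phi>)"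
    by (simp add: exp_cnj exp_add[symmetric] algebra_simps)
  then show ?thesis
    by (simp add: x harm_def zpow_sph_param sph_param_nth power_add mult_ac)
qed

text \<open>The integral over \<open>\<phi>\<close> leaves only \<open>m = l\<close>; then
  \<open>x = cos \<theta>\<close> reduces the claim to \<open>dleg_orth\<close>.\<close>

lemma harm_orthonormal:
  assumes "\<bar>m\<bar> \<le> int n"
  shows "sph_integral (\<lambda>x. harm n m (sph_param x) * cnj (harm k l (sph_param x))) = (if n = k \<and> m = l then 1 else 0)"
proof -
  define \<mu> where "\<mu> = nat \<bar>m\<bar>"
  define f where "f \<theta> = complex_of_real (harm_const n m * harm_const k l * (poly (dleg (nat \<bar>m\<bar>) n) (cos \<theta>)
      * poly (dleg (nat \<bar>l\<bar>) k) (cos \<theta>) * sin \<theta> ^ (nat \<bar>m\<bar> + nat \<bar>l\<bar>)))" for \<theta>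
  have e: "sph_integral (\<lambda>x. harm n m (sph_param x) * cnj (harm k l (sph_param x))) =
    integral {0..pi} (\<lambda>\<theta>. f \<theta> * of_real (sin \<theta>)) * (if m - l = 0 then of_real (2 * pi) else 0)"
    unfolding harm_product integral_exp_period[symmetric] f_def
    by (rule sph_integral_product[where f = f, unfolded f_def]) (auto intro!: continuous_intros)
  show ?thesis
  proof (cases "m = l")
    case True
    have f: "f \<theta> = of_real (harm_const n m * harm_const k m * poly (sqw ^ \<mu> * dleg \<mu> n * dleg \<mu> k) (cos \<theta>))" for \<theta>
    proof -
      have 1: "sin \<theta> ^ (\<mu> + \<mu>) = (1 - (cos \<theta>)\<^sup>2) ^ \<mu>"
        by (simp only: sin_squared_eq[symmetric] power_mult[symmetric] mult_2)
      have 2: "nat \<bar>l\<bar> = \<mu>" using True by (simp add: \<mu>_def)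
      have 3: "poly (sqw ^ \<mu> * dleg \<mu> n * dleg \<mu> k) (cos \<theta>) = poly (dleg \<mu> n) (cos \<theta>) * poly (dleg \<mu> k) (cos \<theta>) * (1 - (cos \<theta>)\<^sup>2) ^ \<mu>"
        by (simp add: poly_power power2_eq_square)
      show ?thesis
        unfolding f_def \<mu>_def[symmetric] 2 1 3 using True by (simp only:)
    qed
    have "integral {0..pi} (\<lambda>\<theta>. f \<theta> * of_real (sin \<theta>)) =
       integral {-1..1} (\<lambda>x. complex_of_real (harm_const n m * harm_const k m * poly (sqw ^ \<mu> * dleg \<mu> n * dleg \<mu> k) x))"
      unfolding f by (rule integral_cos_substitution) (intro continuous_intros)
    also have "\<dots> = of_real (harm_const n m * harm_const k m * qint (sqw ^ \<mu> * dleg \<mu> n * dleg \<mu> k))"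
      unfolding pint_def
      by (intro integral_unique has_integral_of_real has_integral_mult_right integrable_integral poly_integrable)
    also have "qint (sqw ^ \<mu> * dleg \<mu> n * dleg \<mu> k) =
        (if n = k then 2 / (2 * real n + 1) * (fact (n + \<mu>) / fact (n - \<mu>)) else 0)"
      using assms by (intro dleg_orth) (auto simp: \<mu>_def)
    finally have I: "integral {0..pi} (\<lambda>\<theta>. f \<theta> * of_real (sin \<theta>)) = of_real (harm_const n m * harm_const k m *
        (if n = k then 2 / (2 * real n + 1) * (fact (n + \<mu>) / fact (n - \<mu>)) else 0))" .
    show ?thesis
    proof (cases "n = k")
      case nk: True
      have "harm_const n m * harm_const n m = (real n + 1/2) * (fact (n - \<mu>) / fact (n + \<mu>)) / (2 * pi)"
        using harm_const_square[of n m] by (simp add: \<mu>_def power2_eq_square)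
      moreover have "(real n + 1/2) * (2 / (2 * real n + 1)) = 1" by (simp add: field_simps)
      moreover have "(real n + 1/2) * (fact (n - \<mu>) / fact (n + \<mu>)) / (2 * pi) * (2 / (2 * real n + 1) * (fact (n + \<mu>) / fact (n - \<mu>))) * (2 * pi)
        = ((real n + 1/2) * (2 / (2 * real n + 1)))" by simp
      ultimately have "harm_const n m * harm_const n m * (2 / (2 * real n + 1) * (fact (n + \<mu>) / fact (n - \<mu>))) * (2 * pi) = 1"
        by (simp only:)
      then have "complex_of_real (harm_const n m * harm_const n m * (2 / (2 * real n + 1) * (fact (n + \<mu>) / fact (n - \<mu>)))) * of_real (2 * pi) = 1"
        unfolding of_real_mult[symmetric] by (simp only: of_real_1)
      then show ?thesis
        unfolding e I by (simp only: nk[symmetric] True[symmetric] diff_self simp_thms if_True)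
    next
      case False
      then show ?thesis unfolding e I by simp
    qed
  qed (simp add: e)
qed

section \<open>Completeness of the spherical harmonics\<close>

text \<open>The sets over which \<open>f\<close> integrates to 0 form a Dynkin system, complements
  being covered by \<open>total\<close>; it contains the intersection-stable generator of boxes,
  hence all Borel sets.\<close>

lemma AE_zero_if_box_integrals_zero:
  fixes f :: "'a::euclidean_space \<Rightarrow> real"
  assumes f: "integrable lborel f" and total: "(\<integral>x. f x \<partial>lborel) = 0"
    and box: "\<And>a b. (LINT x:box a b|lborel. f x) = 0"
  shows "AE x in lborel. f x = 0"
proof (rule density_unique_real[OF f])
  have si: "set_integrable lborel A f" if "A \<in> sets borel" for A
    unfolding set_integrable_def using f that by (intro integrable_mult_indicator) auto
  have G: "sigma_sets UNIV (range (\<lambda>(a, b). box a b :: 'a set)) = sets borel"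
    by (simp add: borel_eq_box)
  have G1: "Int_stable (range (\<lambda>(a, b). box a b :: 'a set))"
    by (force simp: Int_stable_def box_Int_box)
  have G2: "range (\<lambda>(a, b). box a b :: 'a set) \<subseteq> Pow UNIV" by simp
  fix A :: "'a set" assume "A \<in> sets lborel"
  then have G3: "A \<in> sigma_sets UNIV (range (\<lambda>(a, b). box a b))"
    using G by simp
  have "(LINT x:A|lborel. f x) = 0"
    using G1 G2 G3
  proof (induction A rule: sigma_sets_induct_disjoint)
    case (compl A)
    then have A: "A \<in> sets borel" using G by simp
    have "(LINT x:UNIV - A|lborel. f x) + (LINT x:A|lborel. f x) = (LINT x:(UNIV - A) \<union> A|lborel. f x)"
      by (intro set_integral_Un[symmetric] si) (use A in auto)
    then show ?case using compl total by (simp add: set_lebesgue_integral_def)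
  next
    case (union A)
    then have A: "A i \<in> sets borel" for i using G by blast
    have "(LINT x:(\<Union>i. A i)|lborel. f x) = (\<Sum>i. LINT x:A i|lborel. f x)"
      using union(1) A by (intro lebesgue_integral_countable_add si) (auto simp: disjoint_family_on_def)
    then show ?case using union by simp
  next
    case (basic A)
    then show ?case using box by auto
  qed (simp add: set_lebesgue_integral_def)
  then show "(LINT x:A|lborel. f x) = (LINT x:A|lborel. 0)" by (simp add: set_lebesgue_integral_def)
qed simp

text \<open>The Borel case applied to a Borel measurable modification of \<open>f\<close>.\<close>

lemma AE_zero_if_box_integrals_zero_lebesgue:
  fixes f :: "'a::euclidean_space \<Rightarrow> real"
  assumes f: "integrable lebesgue f" and total: "(\<integral>x. f x \<partial>lebesgue) = 0"
    and box: "\<And>a b. (LINT x:box a b|lebesgue. f x) = 0"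
  shows "AE x in lebesgue. f x = 0"
proof -
  obtain g where g: "g \<in> borel_measurable lborel" and AE: "AE x in lborel. f x = g x"
    using completion_ex_borel_measurable_real[of f lborel] f by auto
  have AE': "AE x in lebesgue. f x = g x" using AE by (rule AE_completion)
  have gm: "g \<in> borel_measurable lebesgue" using g by (rule measurable_completion)
  have "integrable lebesgue g" using f gm AE' by (subst integrable_cong_AE[symmetric]) auto
  then have gi: "integrable lborel g" using g by (simp add: integrable_completion)
  have "(\<integral>x. g x \<partial>lborel) = (\<integral>x. f x \<partial>lebesgue)"
  proof -
    have "(\<integral>x. g x \<partial>lborel) = (\<integral>x. g x \<partial>lebesgue)" using g by (rule integral_completion[symmetric])
    also have "\<dots> = (\<integral>x. f x \<partial>lebesgue)" using f gm AE' by (intro integral_cong_AE) auto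
    finally show ?thesis .
  qed
  moreover have "(LINT x:box a b|lborel. g x) = 0" for a b
  proof -
    have "(LINT x:box a b|lborel. g x) = (\<integral>x. indicator (box a b) x *\<^sub>R g x \<partial>lebesgue)"
      unfolding set_lebesgue_integral_def using g by (intro integral_completion[symmetric]) auto
    also have "\<dots> = (LINT x:box a b|lebesgue. f x)"
      unfolding set_lebesgue_integral_def real_scaleR_def
    proof (rule integral_cong_AE)
      show "(\<lambda>x. indicator (box a b) x * g x) \<in> borel_measurable lebesgue"
        "(\<lambda>x. indicator (box a b) x * f x) \<in> borel_measurable lebesgue"
        by (intro borel_measurable_times borel_measurable_indicator gm borel_measurable_integrable f; simp)+
    qed (use AE' in auto)
    finally show ?thesis using box by simp
  qed
  ultimately have "AE x in lborel. g x = 0"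
    using AE_zero_if_box_integrals_zero[OF gi] total by simp
  then have "AE x in lebesgue. g x = 0" by (rule AE_completion)
  with AE' show ?thesis by eventually_elim simp
qed

text \<open>Restrictions of polynomials to the sphere, sorted by order in \<open>\<phi>\<close>: the
  order fixes the factor \<open>zpow m\<close>, and the rest is a polynomial in the third
  coordinate. This is the form in which harmonic coefficients can be applied.\<close>

inductive sph_poly :: "(real \<times> real \<Rightarrow> complex) \<Rightarrow> bool" where
  mono: "sph_poly (\<lambda>x. c * of_real (poly p (cos (fst x))) * zpow m (sph_param x))"
| add: "sph_poly f \<Longrightarrow> sph_poly g \<Longrightarrow> sph_poly (\<lambda>x. f x + g x)"

text \<open>Factors of opposite sign combine to \<open>z\<close> times its conjugate, which on the
  sphere is \<open>1 - cos^2 \<theta>\<close>. This makes \<open>sph_poly\<close> closed under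
  products.\<close>

lemma zpow_mult:
  "\<exists>j. \<forall>x. zpow m (sph_param x) * zpow l (sph_param x) = of_real (poly (sqw ^ j) (cos (fst x))) * zpow (m + l) (sph_param x)"
proof -
  obtain j where j: "nat \<bar>m\<bar> + nat \<bar>l\<bar> = nat \<bar>m + l\<bar> + 2 * j"
  proof -
    have "even (\<bar>m\<bar> + \<bar>l\<bar> - \<bar>m + l\<bar>)" by (auto simp: abs_if)
    then obtain i where i: "\<bar>m\<bar> + \<bar>l\<bar> - \<bar>m + l\<bar> = 2 * i" by (elim evenE)
    then have "nat \<bar>m\<bar> + nat \<bar>l\<bar> = nat \<bar>m + l\<bar> + 2 * nat i" by linarith
    then show ?thesis using that by blast
  qed
  have "zpow m (sph_param x) * zpow l (sph_param x) = of_real (poly (sqw ^ j) (cos (fst x))) * zpow (m + l) (sph_param x)" for x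
  proof -
    obtain \<theta> \<phi> where x: "x = (\<theta>, \<phi>)" by (cases x)
    have 1: "sin \<theta> ^ nat \<bar>m\<bar> * sin \<theta> ^ nat \<bar>l\<bar> = (1 - (cos \<theta>)\<^sup>2) ^ j * sin \<theta> ^ nat \<bar>m + l\<bar>"
      unfolding power_add[symmetric] j sin_squared_eq[symmetric] by (simp add: power_add power_mult)
    have 2: "exp (\<i> * of_int m * of_real \<phi>) * exp (\<i> * of_int l * of_real \<phi>) = exp (\<i> * of_int (m + l) * of_real \<phi>)"
      by (simp add: exp_add[symmetric] algebra_simps)
    have 3: "poly (sqw ^ j) (cos \<theta>) = (1 - (cos \<theta>)\<^sup>2) ^ j" by (simp add: poly_power power2_eq_square)
    have 4: "of_real A * E * (of_real B * E') = of_real (A * B) * (E * E')" for A B :: real and E E' :: complex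
      by (simp only: of_real_mult mult_ac)
    show ?thesis
      unfolding x zpow_sph_param fst_conv 3 by (subst 4, simp only: 1 2) (simp only: of_real_mult mult.assoc)
  qed
  then show ?thesis by blast
qed

lemma sph_poly_mult:
  assumes "sph_poly f" "sph_poly g"
  shows "sph_poly (\<lambda>x. f x * g x)"
  using assms(1)
proof (induction rule: sph_poly.induct)
  case (mono c p m)
  show ?case using assms(2)
  proof (induction rule: sph_poly.induct)
    case (mono d q l)
    obtain j where j: "\<And>x. zpow m (sph_param x) * zpow l (sph_param x) = of_real (poly (sqw ^ j) (cos (fst x))) * zpow (m + l) (sph_param x)"
      using zpow_mult[of m l] by blast
    have "(c * of_real (poly p (cos (fst x))) * zpow m (sph_param x)) * (d * of_real (poly q (cos (fst x))) * zpow l (sph_param x))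
      = (c * d) * of_real (poly (p * q * sqw ^ j) (cos (fst x))) * zpow (m + l) (sph_param x)" for x
    proof -
      have "(c * of_real (poly p (cos (fst x))) * zpow m (sph_param x)) * (d * of_real (poly q (cos (fst x))) * zpow l (sph_param x))
        = (c * d) * (of_real (poly p (cos (fst x))) * of_real (poly q (cos (fst x)))) * (zpow m (sph_param x) * zpow l (sph_param x))"
        by (simp only: mult_ac)
      then show ?thesis unfolding j by (simp only: poly_mult of_real_mult mult_ac)
    qed
    then show ?case by (simp only: sph_poly.mono)
  next
    case (add f g)
    then show ?case by (simp only: distrib_left sph_poly.add)
  qed
next
  case (add f g)
  then show ?case by (simp only: distrib_right sph_poly.add)
qed

lemma sph_poly_const: "sph_poly (\<lambda>x. c)"
  using sph_poly.mono[of c 1 0] by (simp add: zpow_def)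

lemma sph_poly_real_polynomial:
  assumes "real_polynomial_function (g :: real ^ 3 \<Rightarrow> real)"
  shows "sph_poly (\<lambda>x. of_real (g (sph_param x)))"
  using assms
proof (induction rule: real_polynomial_function.induct)
  case (linear f)
  interpret f: bounded_linear f by fact
  define a where "a i = f (axis i 1)" for i :: 3
  have f: "f v = v $ 1 * a 1 + v $ 2 * a 2 + v $ 3 * a 3" for v
  proof -
    have "v = v $ 1 *\<^sub>R axis 1 1 + v $ 2 *\<^sub>R axis 2 1 + v $ 3 *\<^sub>R axis 3 1"
      by (simp add: vec_eq_iff forall_3 axis_def)
    then have "f v = f (v $ 1 *\<^sub>R axis 1 1 + v $ 2 *\<^sub>R axis 2 1 + v $ 3 *\<^sub>R axis 3 1)" by simp
    then show ?thesis by (simp add: f.add f.scale a_def)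
  qed
  have c1: "of_real (v $ 1) = (1/2) * zpow 1 v + (1/2) * zpow (-1) v"
    and c2: "of_real (v $ 2) = (- \<i> / 2) * zpow 1 v + (\<i> / 2) * zpow (-1) v" for v
    by (simp_all add: zpow_def complex_eq_iff)
  have c3: "sph_param x $ 3 = cos (fst x)" for x by (cases x) (simp add: sph_param_nth)
  have "complex_of_real (f (sph_param x)) = ((a 1 / 2 - \<i> * a 2 / 2) * of_real (poly 1 (cos (fst x))) * zpow 1 (sph_param x)
     + (a 1 / 2 + \<i> * a 2 / 2) * of_real (poly 1 (cos (fst x))) * zpow (-1) (sph_param x))
     + of_real (a 3) * of_real (poly [:0, 1:] (cos (fst x))) * zpow 0 (sph_param x)" for x
    unfolding f of_real_add of_real_mult c1 c2 c3 by (simp add: zpow_def[of 0] algebra_simps)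
  then show ?case
    by (simp only:) (intro sph_poly.intros)
next
  case (const c)
  show ?case by (rule sph_poly_const)
qed (auto intro: sph_poly.add sph_poly_mult)

lemma continuous_on_sph_poly:
  assumes "sph_poly f"
  shows "continuous_on S f"
  using assms
proof (induction rule: sph_poly.induct)
  case (mono c p m)
  show ?case
    by (intro continuous_intros continuous_on_compose2[OF continuous_on_zpow continuous_on_sph_param subset_UNIV])
qed (intro continuous_intros)

lemma cnj_zpow: "cnj (zpow m v) = zpow (- m) v"
  by (cases "m = 0") (auto simp: zpow_def complex_eq_iff complex_cnj)

text \<open>For fixed order the polynomials \<open>dleg \<mu> (\<mu> + j)\<close> have degree
  \<open>j\<close> and span all polynomials, so each moment is a combination of coefficients. The
  order is \<open>- m\<close> because the coefficients involve conjugates.\<close>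

lemma sph_integral_poly_eq_0:
  assumes H: "sph_integrable H"
    and coeff: "\<And>n m. \<bar>m\<bar> \<le> int n \<Longrightarrow> sph_integral (\<lambda>x. H x * cnj (harm n m (sph_param x))) = 0"
    and f: "sph_poly f"
  shows "sph_integral (\<lambda>x. f x * H x) = 0"
  using f
proof (induction rule: sph_poly.induct)
  case (mono c p m)
  define \<mu> where "\<mu> = nat \<bar>m\<bar>"
  define T where "T q x = of_real (poly q (cos (fst x))) * zpow m (sph_param x) * H x" for q x
  have Ti: "sph_integrable (T q)" for q
    unfolding T_def
    by (intro sph_integrable_mult_continuous H continuous_intros
        continuous_on_compose2[OF continuous_on_zpow continuous_on_sph_param subset_UNIV])
  have basis: "sph_integral (T (dleg \<mu> (\<mu> + j))) = 0" for j
  proof -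
    have "harm_const (\<mu> + j) (- m) \<noteq> 0" by (simp add: harm_const_def)
    moreover have "sph_integral (\<lambda>x. H x * cnj (harm (\<mu> + j) (- m) (sph_param x))) =
       of_real (harm_const (\<mu> + j) (- m)) * sph_integral (T (dleg \<mu> (\<mu> + j)))"
    proof -
      have "H x * cnj (harm (\<mu> + j) (- m) (sph_param x)) = of_real (harm_const (\<mu> + j) (- m)) * T (dleg \<mu> (\<mu> + j)) x" for x
        by (cases x) (simp add: harm_def T_def cnj_zpow sph_param_nth \<mu>_def mult_ac)
      then show ?thesis by (simp only: sph_integral_cmult)
    qed
    moreover have "\<bar>- m\<bar> \<le> int (\<mu> + j)" by (simp add: \<mu>_def)
    ultimately show ?thesis using coeff[of "- m" "\<mu> + j"] by simp
  qed
  have "\<exists>b. p = (\<Sum>j\<le>degree p. smult (b j) (dleg \<mu> (\<mu> + j)))"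
    by (rule poly_graded_basis) (simp_all add: degree_dleg dleg_nonzero)
  then obtain b where b: "p = (\<Sum>j\<le>degree p. smult (b j) (dleg \<mu> (\<mu> + j)))" by blast
  have "T p x = (\<Sum>j\<le>degree p. of_real (b j) * T (dleg \<mu> (\<mu> + j)) x)" for x
  proof -
    have "poly p (cos (fst x)) = (\<Sum>j\<le>degree p. b j * poly (dleg \<mu> (\<mu> + j)) (cos (fst x)))"
      using arg_cong[OF b, of "\<lambda>q. poly q (cos (fst x))"] by (simp add: poly_sum)
    then show ?thesis by (simp add: T_def sum_distrib_right sum_distrib_left mult_ac)
  qed
  then have "T p = (\<lambda>x. \<Sum>j\<le>degree p. of_real (b j) * T (dleg \<mu> (\<mu> + j)) x)" by (rule ext)
  then have "sph_integral (T p) = sph_integral (\<lambda>x. \<Sum>j\<le>degree p. of_real (b j) * T (dleg \<mu> (\<mu> + j)) x)" by simp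
  also have "\<dots> = (\<Sum>j\<le>degree p. sph_integral (\<lambda>x. of_real (b j) * T (dleg \<mu> (\<mu> + j)) x))"
    by (intro sph_integral_sum sph_integrable_cmult Ti)
  finally have "sph_integral (T p) = 0" by (simp add: sph_integral_cmult basis)
  moreover have "(\<lambda>x. c * of_real (poly p (cos (fst x))) * zpow m (sph_param x) * H x) = (\<lambda>x. c * T p x)"
    by (simp add: T_def mult.assoc)
  ultimately show ?case by (simp only: sph_integral_cmult mult_zero_right)
next
  case (add f g)
  then show ?case
    by (simp add: distrib_right sph_integral_add sph_integrable_mult_continuous H continuous_on_sph_poly)
qed

lemma norm_sph_integral_mult_le:
  assumes H: "sph_integrable H" and u: "continuous_on sph_rect u" and B: "\<And>x. x \<in> sph_rect \<Longrightarrow> cmod (u x) \<le> B"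
  shows "cmod (sph_integral (\<lambda>x. u x * H x)) \<le> B * (LINT x:sph_rect|lebesgue. cmod (H x * of_real (sin (fst x))))"
proof -
  have i: "set_integrable lebesgue sph_rect (\<lambda>x. u x * H x * complex_of_real (sin (fst x)))"
    using sph_integrable_mult_continuous[OF H u] by (simp add: sph_integrable_def)
  have i2: "set_integrable lebesgue sph_rect (\<lambda>x. B * cmod (H x * complex_of_real (sin (fst x))))"
    using H by (intro set_integrable_mult_right set_integrable_norm) (auto simp: sph_integrable_def)
  have "cmod (sph_integral (\<lambda>x. u x * H x)) \<le> (LINT x:sph_rect|lebesgue. cmod (u x * H x * of_real (sin (fst x))))"
    unfolding sph_integral_def by (rule set_integral_norm_bound[OF i])
  also have "\<dots> \<le> (LINT x:sph_rect|lebesgue. B * cmod (H x * of_real (sin (fst x))))"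
    by (intro set_integral_mono set_integrable_norm i i2)
       (auto simp: norm_mult mult.assoc intro!: mult_right_mono B)
  finally show ?thesis by simp
qed

text \<open>Stone-Weierstrass: \<open>f\<close> is uniformly approximated by a polynomial, whose
  integral against \<open>H\<close> is 0, and the error is bounded by the \<open>L^1\<close> norm of
  \<open>H\<close> with weight \<open>sin \<theta>\<close>.\<close>

lemma sph_integral_continuous_eq_0:
  assumes H: "sph_integrable H"
    and coeff: "\<And>n m. \<bar>m\<bar> \<le> int n \<Longrightarrow> sph_integral (\<lambda>x. H x * cnj (harm n m (sph_param x))) = 0"
    and f: "continuous_on (sphere 0 1) (f :: real ^ 3 \<Rightarrow> real)"
  shows "sph_integral (\<lambda>x. of_real (f (sph_param x)) * H x) = 0"
proof -
  let ?K = "LINT x:sph_rect|lebesgue. cmod (H x * of_real (sin (fst x)))"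
  have K: "0 \<le> ?K" by (simp add: set_lebesgue_integral_def)
  have fc: "continuous_on S (\<lambda>x. f (sph_param x))" for S
    by (rule continuous_on_compose2[OF f continuous_on_sph_param]) (use sph_param_sphere in auto)
  have le: "cmod (sph_integral (\<lambda>x. of_real (f (sph_param x)) * H x)) \<le> e * ?K" if e: "e > 0" for e
  proof -
    obtain g where g: "real_polynomial_function g" "\<And>v. v \<in> sphere 0 1 \<Longrightarrow> \<bar>f v - g v\<bar> < e"
      using Stone_Weierstrass_real_polynomial_function[OF compact_sphere f e] by blast
    have sg: "sph_poly (\<lambda>x. of_real (g (sph_param x)))" by (rule sph_poly_real_polynomial[OF g(1)])
    have c1: "continuous_on sph_rect (\<lambda>x. complex_of_real (f (sph_param x)))"
      by (intro continuous_intros fc)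
    have "sph_integral (\<lambda>x. of_real (f (sph_param x)) * H x) =
       sph_integral (\<lambda>x. of_real (f (sph_param x)) * H x) - sph_integral (\<lambda>x. of_real (g (sph_param x)) * H x)"
      using sph_integral_poly_eq_0[OF H coeff sg] by simp
    also have "\<dots> = sph_integral (\<lambda>x. of_real (f (sph_param x)) * H x - of_real (g (sph_param x)) * H x)"
      by (intro sph_integral_diff[symmetric] sph_integrable_mult_continuous H c1 continuous_on_sph_poly[OF sg])
    also have "\<dots> = sph_integral (\<lambda>x. (of_real (f (sph_param x)) - of_real (g (sph_param x))) * H x)"
      by (simp only: left_diff_distrib)
    also have "cmod \<dots> \<le> e * ?K"
    proof (rule norm_sph_integral_mult_le[OF H])
      show "continuous_on sph_rect (\<lambda>x. complex_of_real (f (sph_param x)) - of_real (g (sph_param x)))"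
        by (intro continuous_intros c1 continuous_on_sph_poly[OF sg])
      show "cmod (of_real (f (sph_param x)) - of_real (g (sph_param x))) \<le> e" for x
        using g(2)[OF sph_param_sphere[of x]] by (simp add: of_real_diff[symmetric] del: of_real_diff)
    qed
    finally show ?thesis .
  qed
  have "cmod (sph_integral (\<lambda>x. of_real (f (sph_param x)) * H x)) \<le> 0"
  proof (rule field_le_epsilon)
    fix e :: real assume e: "e > 0"
    \<comment> \<open>Adding 1 guards against \<open>?K = 0\<close>.\<close>
    have "e / (?K + 1) * ?K \<le> e" using e K by (simp add: field_simps)
    moreover have "e / (?K + 1) > 0" using e K by simp
    ultimately show "cmod (sph_integral (\<lambda>x. of_real (f (sph_param x)) * H x)) \<le> 0 + e"
      using le[of "e / (?K + 1)"] by linarith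
  qed
  then show ?thesis by simp
qed

text \<open>Only one point has to be interior: in the application the other one ranges over the
  whole rectangle outside an open set.\<close>

lemma sph_param_inj_interior:
  assumes "x \<in> {0<..<pi} \<times> {0<..<2 * pi}" "y \<in> sph_rect" "sph_param x = sph_param y"
  shows "x = y"
proof -
  obtain \<theta> \<phi> where x: "x = (\<theta>, \<phi>)" by (cases x)
  obtain \<theta>' \<phi>' where y: "y = (\<theta>', \<phi>')" by (cases y)
  have "cos \<theta> = cos \<theta>'" using arg_cong[OF assms(3), of "\<lambda>v. v $ 3"] by (simp add: x y sph_param_nth)
  then have t: "\<theta> = \<theta>'" using assms(1,2) cos_inj_pi[of \<theta> \<theta>'] by (auto simp: x y)
  have "sin \<theta> > 0" using assms(1) by (auto simp: x sin_gt_zero)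
  then have "cos \<phi>' = cos \<phi>" "sin \<phi>' = sin \<phi>"
    using arg_cong[OF assms(3), of "\<lambda>v. v $ 1"] arg_cong[OF assms(3), of "\<lambda>v. v $ 2"] t
    by (auto simp: x y sph_param_nth)
  then obtain k :: int where k: "\<phi>' = \<phi> + 2 * pi * k" using sin_cos_eq_iff[of \<phi>' \<phi>] by auto
  have p: "0 < 2 * pi" by simp
  have "0 \<le> \<phi>'" "\<phi>' \<le> 2 * pi" "0 < \<phi>" "\<phi> < 2 * pi" using assms(1,2) by (auto simp: x y)
  then have "2 * pi * (-1) < 2 * pi * real_of_int k" "2 * pi * real_of_int k < 2 * pi * 1"
    unfolding k by linarith+
  then have "-1 < real_of_int k" "real_of_int k < 1"
    using mult_less_cancel_left_pos[OF p] by blast+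
  then have "k = 0" by linarith
  then show ?thesis using k t x y by simp
qed

text \<open>The indicator of \<open>B\<close> is the limit of the cut-off functions
  \<open>min 1 (k * dist)\<close>, with the distance to the compact image \<open>K\<close> of the
  complement of \<open>B\<close>. Points of \<open>B\<close> are mapped outside \<open>K\<close> by
  injectivity. Dominated convergence concludes.\<close>

lemma sph_box_integral_eq_0:
  assumes H: "sph_integrable H"
    and coeff: "\<And>n m. \<bar>m\<bar> \<le> int n \<Longrightarrow> sph_integral (\<lambda>x. H x * cnj (harm n m (sph_param x))) = 0"
    and B: "open B" "B \<subseteq> {0<..<pi} \<times> {0<..<2 * pi}"
  shows "sph_integral (\<lambda>x. indicator B x * H x) = 0"
proof -
  define K where "K = sph_param ` (sph_rect - B)"
  have "compact (sph_rect - B)" using B(1) by (intro compact_diff compact_sph_rect)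
  then have K: "closed K" unfolding K_def
    by (intro compact_imp_closed compact_continuous_image continuous_on_sph_param)
  \<comment> \<open>\<open>K\<close> must be nonempty, since \<open>infdist\<close> to the empty set
    is 0 by convention.\<close>
  have "(0, 0) \<in> sph_rect - B" using B(2) by auto
  then have K0: "K \<noteq> {}" unfolding K_def by blast
  define V where "V k v = min 1 (real k * infdist v K)" for k v
  have V: "(\<lambda>k. V k (sph_param x)) \<longlonglongrightarrow> indicator B x" if x: "x \<in> sph_rect" for x
  proof (cases "x \<in> B")
    case False
    then have "sph_param x \<in> K" using x by (auto simp: K_def)
    then show ?thesis using False by (simp add: V_def)
  next
    case True
    have "sph_param x \<notin> K"
    proof
      assume "sph_param x \<in> K"
      then obtain y where "y \<in> sph_rect - B" "sph_param x = sph_param y" by (auto simp: K_def)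
      then show False using sph_param_inj_interior[of x y] B(2) True by auto
    qed
    then have d: "infdist (sph_param x) K > 0" using K K0 by (intro infdist_pos_not_in_closed)
    obtain k0 :: nat where k0: "1 / infdist (sph_param x) K < real k0" using reals_Archimedean2 by blast
    have "V k (sph_param x) = 1" if "k \<ge> k0" for k
    proof -
      have "1 / infdist (sph_param x) K < real k" using k0 that by linarith
      then show ?thesis using d by (simp add: V_def field_simps min_def)
    qed
    then have "\<forall>\<^sub>F k in sequentially. V k (sph_param x) = 1" by (auto simp: eventually_sequentially)
    then show ?thesis using True by (simp add: tendsto_eventually)
  qed
  have Vc: "continuous_on S (V k)" for k S unfolding V_def by (intro continuous_intros)
  have z: "sph_integral (\<lambda>x. of_real (V k (sph_param x)) * H x) = 0" for k
    by (rule sph_integral_continuous_eq_0[OF H coeff Vc])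
  let ?h = "\<lambda>x. indicator sph_rect x *\<^sub>R (H x * complex_of_real (sin (fst x)))"
  have hi: "integrable lebesgue ?h" using H by (simp add: sph_integrable_def set_integrable_def)
  have Bm: "B \<in> sets lebesgue" using B(1) by (simp add: borel_open sets_completionI_sets)
  have "(\<lambda>k. \<integral>x. of_real (V k (sph_param x)) * ?h x \<partial>lebesgue) \<longlonglongrightarrow> (\<integral>x. indicator B x * ?h x \<partial>lebesgue)"
  proof (rule integral_dominated_convergence[where w = "\<lambda>x. cmod (?h x)"])
    show "(\<lambda>x. indicator B x * ?h x) \<in> borel_measurable lebesgue"
      using hi Bm by (intro borel_measurable_times borel_measurable_indicator) auto
    show "(\<lambda>x. of_real (V k (sph_param x)) * ?h x) \<in> borel_measurable lebesgue" for k
    proof (intro borel_measurable_times borel_measurable_integrable[OF hi])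
      have "continuous_on UNIV (\<lambda>x. complex_of_real (V k (sph_param x)))"
        by (intro continuous_intros continuous_on_compose2[OF Vc continuous_on_sph_param subset_UNIV])
      then show "(\<lambda>x. complex_of_real (V k (sph_param x))) \<in> borel_measurable lebesgue"
        by (intro measurable_completion) (simp add: borel_measurable_continuous_onI)
    qed
    show "integrable lebesgue (\<lambda>x. cmod (?h x))" using hi by (rule integrable_norm)
    show "AE x in lebesgue. (\<lambda>k. of_real (V k (sph_param x)) * ?h x) \<longlonglongrightarrow> indicator B x * ?h x"
    proof (rule AE_I2)
      fix x
      show "(\<lambda>k. of_real (V k (sph_param x)) * ?h x) \<longlonglongrightarrow> indicator B x * ?h x"
      proof (cases "x \<in> sph_rect")
        case True
        have "(\<lambda>k. complex_of_real (V k (sph_param x))) \<longlonglongrightarrow> of_real (indicator B x)"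
          by (rule tendsto_of_real[OF V[OF True]])
        then show ?thesis by (intro tendsto_mult tendsto_const) (simp add: of_real_indicator)
      qed simp
    qed
    show "AE x in lebesgue. norm (of_real (V k (sph_param x)) * ?h x) \<le> cmod (?h x)" for k
    proof (rule AE_I2)
      fix x
      have "\<bar>V k (sph_param x)\<bar> \<le> 1" by (auto simp: V_def infdist_nonneg min_def abs_le_iff intro: order_trans[of "-1" 0])
      then have "norm (of_real (V k (sph_param x)) * z) \<le> cmod z" for z
        using mult_right_mono[of _ 1 "cmod z"] by (simp add: norm_mult)
      then show "norm (of_real (V k (sph_param x)) * ?h x) \<le> cmod (?h x)" .
    qed
  qed
  moreover have "(\<integral>x. of_real (V k (sph_param x)) * ?h x \<partial>lebesgue) = 0" for k
    using z[of k] by (simp add: sph_integral_def set_lebesgue_integral_def mult_ac)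
  ultimately have "(\<integral>x. indicator B x * ?h x \<partial>lebesgue) = 0"
    by (simp add: LIMSEQ_const_iff)
  then show ?thesis by (simp add: sph_integral_def set_lebesgue_integral_def mult_ac)
qed

section \<open>Spherical harmonic series\<close>

text \<open>Zero integrals over open sets make \<open>H sin \<theta>\<close> vanish almost
  everywhere inside the rectangle, where the sine is positive; the boundary of the rectangle is a
  null set.\<close>

lemma negligible_nonzero_on_rect:
  assumes H: "sph_integrable H"
    and coeff: "\<And>n m. \<bar>m\<bar> \<le> int n \<Longrightarrow> sph_integral (\<lambda>x. H x * cnj (harm n m (sph_param x))) = 0"
  shows "negligible {x \<in> sph_rect. H x \<noteq> 0}"
proof -
  let ?R = "box (0, 0) (pi, 2 * pi) :: (real \<times> real) set"
  have R: "?R = {0<..<pi} \<times> {0<..<2 * pi}" by (auto simp: box_def Basis_prod_def)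
  have Rsub: "?R \<subseteq> sph_rect" by (auto simp: R)
  define g where "g = (\<lambda>x. indicator sph_rect x *\<^sub>R (H x * complex_of_real (sin (fst x))))"
  define h where "h = (\<lambda>x. indicator ?R x *\<^sub>R g x)"
  have g: "integrable lebesgue g" using H by (simp add: g_def sph_integrable_def set_integrable_def)
  have h: "integrable lebesgue h" unfolding h_def
    by (intro integrable_mult_indicator g) simp
  have zero: "(\<integral>x. indicator B x *\<^sub>R h x \<partial>lebesgue) = 0" if "open B" for B
  proof -
    have "sph_integral (\<lambda>x. indicator (B \<inter> ?R) x * H x) = 0"
      by (rule sph_box_integral_eq_0[OF H coeff open_Int[OF that open_box]]) (auto simp: R)
    moreover have "indicator sph_rect x *\<^sub>R (indicator (B \<inter> ?R) x * H x * complex_of_real (sin (fst x))) = indicator B x *\<^sub>R h x" for x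
      by (auto simp: h_def g_def indicator_def)
    ultimately show ?thesis by (simp add: sph_integral_def set_lebesgue_integral_def)
  qed
  have Re: "AE x in lebesgue. Re (h x) = 0"
  proof (rule AE_zero_if_box_integrals_zero_lebesgue)
    show "integrable lebesgue (\<lambda>x. Re (h x))" using h by simp
    have "(\<integral>x. Re (h x) \<partial>lebesgue) = Re (\<integral>x. h x \<partial>lebesgue)" using h by simp
    then show "(\<integral>x. Re (h x) \<partial>lebesgue) = 0" using zero[of UNIV] by simp
    fix a b
    have i: "integrable lebesgue (\<lambda>x. indicator (box a b) x *\<^sub>R h x)" by (intro integrable_mult_indicator h) simp
    have "(LINT x:box a b|lebesgue. Re (h x)) = Re (\<integral>x. indicator (box a b) x *\<^sub>R h x \<partial>lebesgue)"
      unfolding set_lebesgue_integral_def using integral_Re[OF i] by simp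
    then show "(LINT x:box a b|lebesgue. Re (h x)) = 0" using zero[OF open_box[of a b]] by simp
  qed
  have Im: "AE x in lebesgue. Im (h x) = 0"
  proof (rule AE_zero_if_box_integrals_zero_lebesgue)
    show "integrable lebesgue (\<lambda>x. Im (h x))" using h by simp
    have "(\<integral>x. Im (h x) \<partial>lebesgue) = Im (\<integral>x. h x \<partial>lebesgue)" using h by simp
    then show "(\<integral>x. Im (h x) \<partial>lebesgue) = 0" using zero[of UNIV] by simp
    fix a b
    have i: "integrable lebesgue (\<lambda>x. indicator (box a b) x *\<^sub>R h x)" by (intro integrable_mult_indicator h) simp
    have "(LINT x:box a b|lebesgue. Im (h x)) = Im (\<integral>x. indicator (box a b) x *\<^sub>R h x \<partial>lebesgue)"
      unfolding set_lebesgue_integral_def using integral_Im[OF i] by simp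
    then show "(LINT x:box a b|lebesgue. Im (h x)) = 0" using zero[OF open_box[of a b]] by simp
  qed
  have "AE x in lebesgue. h x = 0"
    using Re Im by eventually_elim (simp add: complex_eq_iff)
  then have "negligible {x. h x \<noteq> 0}"
    by (auto simp: negligible_iff_null_sets AE_iff_null_sets completion.AE_iff_null_sets eventually_ae_filter null_sets_completion_subset)
  moreover have "negligible (sph_rect - ?R)"
    using negligible_frontier_interval[of "(0, 0)" "(pi, 2 * pi)"] by (simp add: sph_rect_cbox)
  moreover have "{x \<in> sph_rect. H x \<noteq> 0} \<subseteq> {x. h x \<noteq> 0} \<union> (sph_rect - ?R)"
  proof (safe, goal_cases)
    case (1 \<theta> \<phi>)
    then have "sin \<theta> > 0" by (auto simp: R sin_gt_zero)
    with 1 show False using Rsub by (auto simp: h_def g_def indicator_def split: if_splits)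
  qed
  ultimately show ?thesis by (meson negligible_Un negligible_subset)
qed

section \<open>Extension from the rectangle to the plane\<close>

lemma sph_symmetric_periodic:
  assumes "sph_symmetric H"
  shows "H (\<theta> + 2 * pi * real_of_int k, \<phi> + 2 * pi * real_of_int l) = H (\<theta>, \<phi>)"
proof -
  have a: "H (\<theta> + 2 * pi, \<phi>) = H (\<theta>, \<phi>)" "H (\<theta>, \<phi> + 2 * pi) = H (\<theta>, \<phi>)" for \<theta> \<phi>
    using assms by (auto simp: sph_symmetric_def)
  have 1: "H (\<theta> + 2 * pi * real n, \<phi>) = H (\<theta>, \<phi>)" for n :: nat and \<theta> \<phi>
  proof (induction n)
    case (Suc n)
    then show ?case using a(1)[of "\<theta> + 2 * pi * real n" \<phi>] by (simp add: algebra_simps)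
  qed simp
  have 2: "H (\<theta>, \<phi> + 2 * pi * real n) = H (\<theta>, \<phi>)" for n :: nat and \<theta> \<phi>
  proof (induction n)
    case (Suc n)
    then show ?case using a(2)[of \<theta> "\<phi> + 2 * pi * real n"] by (simp add: algebra_simps)
  qed simp
  have 3: "H (\<theta> + 2 * pi * real_of_int k, \<phi>) = H (\<theta>, \<phi>)" for k :: int and \<theta> \<phi>
    using 1[of \<theta> "nat k" \<phi>] 1[of "\<theta> + 2 * pi * real_of_int k" "nat (- k)" \<phi>]
    by (cases "k \<ge> 0") auto
  have 4: "H (\<theta>, \<phi> + 2 * pi * real_of_int k) = H (\<theta>, \<phi>)" for k :: int and \<theta> \<phi>
    using 2[of \<theta> \<phi> "nat k"] 2[of \<theta> "\<phi> + 2 * pi * real_of_int k" "nat (- k)"]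
    by (cases "k \<ge> 0") auto
  show ?thesis by (simp add: 3 4)
qed

lemma real_mod_2pi:
  fixes x a :: real
  obtains k :: int where "a \<le> x - 2 * pi * real_of_int k" "x - 2 * pi * real_of_int k < a + 2 * pi"
proof
  let ?k = "\<lfloor>(x - a) / (2 * pi)\<rfloor>"
  have p: "0 < 2 * pi" by simp
  have "real_of_int ?k \<le> (x - a) / (2 * pi)" "(x - a) / (2 * pi) < real_of_int ?k + 1" by linarith+
  then have "real_of_int ?k * (2 * pi) \<le> x - a" "x - a < (real_of_int ?k + 1) * (2 * pi)"
    by (simp_all only: pos_le_divide_eq[OF p] pos_divide_less_eq[OF p])
  then show "a \<le> x - 2 * pi * real_of_int ?k" "x - 2 * pi * real_of_int ?k < a + 2 * pi"
    by (simp_all add: algebra_simps)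
qed

text \<open>Periods reduce \<open>\<theta>\<close> to one period around 0, and the reflection
  handles its negative half. So the exceptional set is covered by countably many translates of a
  null set and of its reflected image.\<close>

lemma negligible_nonzero_everywhere:
  assumes sym: "sph_symmetric H" and neg: "negligible {x \<in> sph_rect. H x \<noteq> 0}"
  shows "negligible {x. H x \<noteq> 0}"
proof -
  define Z where "Z = {x \<in> sph_rect. H x \<noteq> 0}"
  \<comment> \<open>The inverse of the identification of \<open>(\<theta>, \<phi>)\<close> with
    \<open>(- \<theta>, \<phi> + \<pi>)\<close>.\<close>
  define \<sigma> where "\<sigma> x = (- fst x, snd x - pi)" for x :: "real \<times> real"
  define c where "c k l = (2 * pi * real_of_int k, 2 * pi * real_of_int l)" for k l
  have Z: "negligible Z" using neg by (simp add: Z_def)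
  have "\<sigma> differentiable_on Z" unfolding \<sigma>_def
    by (intro differentiable_at_imp_differentiable_on)
       (auto intro!: differentiableI derivative_eq_intros)
  then have sZ: "negligible (\<sigma> ` Z)" by (intro negligible_differentiable_image_negligible Z) auto
  have "negligible (\<Union>(k, l)\<in>UNIV. (+) (c k l) ` Z \<union> (+) (c k l) ` \<sigma> ` Z)"
    by (intro negligible_countable_Union) (auto intro!: negligible_Un negligible_translation Z sZ countableI_type)
  moreover have "{x. H x \<noteq> 0} \<subseteq> (\<Union>(k, l)\<in>UNIV. (+) (c k l) ` Z \<union> (+) (c k l) ` \<sigma> ` Z)"
  proof
    fix x assume "x \<in> {x. H x \<noteq> 0}"
    moreover obtain \<theta> \<phi> where x: "x = (\<theta>, \<phi>)" by (cases x)
    ultimately have nz: "H (\<theta>, \<phi>) \<noteq> 0" by simp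
    obtain k :: int where k: "- pi \<le> \<theta> - 2 * pi * real_of_int k" "\<theta> - 2 * pi * real_of_int k < - pi + 2 * pi"
      by (rule real_mod_2pi)
    define t where "t = \<theta> - 2 * pi * real_of_int k"
    show "x \<in> (\<Union>(k, l)\<in>UNIV. (+) (c k l) ` Z \<union> (+) (c k l) ` \<sigma> ` Z)"
    proof (cases "t \<ge> 0")
      case True
      obtain l :: int where l: "0 \<le> \<phi> - 2 * pi * real_of_int l" "\<phi> - 2 * pi * real_of_int l < 0 + 2 * pi"
        by (rule real_mod_2pi)
      have "H (t, \<phi> - 2 * pi * real_of_int l) \<noteq> 0"
        using nz sph_symmetric_periodic[OF sym, of t k "\<phi> - 2 * pi * real_of_int l" l] by (simp add: t_def)
      then have "(t, \<phi> - 2 * pi * real_of_int l) \<in> Z" using True k l by (auto simp: Z_def t_def)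
      then have "x \<in> (+) (c k l) ` Z"
        by (intro image_eqI[of _ _ "(t, \<phi> - 2 * pi * real_of_int l)"]) (auto simp: x c_def t_def)
      then show ?thesis by blast
    next
      case False
      obtain l :: int where l: "0 \<le> (\<phi> + pi) - 2 * pi * real_of_int l" "(\<phi> + pi) - 2 * pi * real_of_int l < 0 + 2 * pi"
        by (rule real_mod_2pi)
      define p where "p = (\<phi> + pi) - 2 * pi * real_of_int l"
      have "H (t, \<phi> - 2 * pi * real_of_int l) \<noteq> 0"
        using nz sph_symmetric_periodic[OF sym, of t k "\<phi> - 2 * pi * real_of_int l" l] by (simp add: t_def)
      moreover have "H (- t, (\<phi> - 2 * pi * real_of_int l) + pi) = H (t, \<phi> - 2 * pi * real_of_int l)"
        using sym by (auto simp: sph_symmetric_def)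
      moreover have "(\<phi> - 2 * pi * real_of_int l) + pi = p" by (simp add: p_def)
      ultimately have "H (- t, p) \<noteq> 0" by simp
      then have "(- t, p) \<in> Z" using False k l by (auto simp: Z_def t_def p_def)
      then have "x \<in> (+) (c k l) ` \<sigma> ` Z"
        unfolding image_image
        by (intro image_eqI[of _ _ "(- t, p)"]) (auto simp: x c_def t_def \<sigma>_def p_def)
      then show ?thesis by blast
    qed
  qed
  ultimately show ?thesis by (rule negligible_subset)
qed

lemma sph_param_periodic:
  "sph_param (\<theta> + 2 * pi, \<phi>) = sph_param (\<theta>, \<phi>)"
  "sph_param (\<theta>, \<phi> + 2 * pi) = sph_param (\<theta>, \<phi>)"
  "sph_param (- \<theta>, \<phi> + pi) = sph_param (\<theta>, \<phi>)"
  by (simp_all add: sph_param_def)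

lemma sph_cont_continuous:
  assumes "G \<in> sph_cont"
  shows "continuous_on S G"
proof -
  obtain G0 where G0: "continuous_on (sphere 0 1) G0" "G = G0 \<circ> sph_param"
    using assms by (auto simp: sph_cont_def)
  have "continuous_on S (\<lambda>x. G0 (sph_param x))"
    by (rule continuous_on_compose2[OF G0(1) continuous_on_sph_param image_subsetI]) (rule sph_param_sphere)
  then show ?thesis by (simp add: G0(2) comp_def)
qed

lemma sph_cont_symmetric: "G \<in> sph_cont \<Longrightarrow> sph_symmetric G"
  by (auto simp: sph_cont_def sph_symmetric_def sph_param_periodic)

lemma continuous_AE_eq_imp_eq:
  fixes f g :: "real \<times> real \<Rightarrow> complex"
  assumes "continuous_on UNIV f" "continuous_on UNIV g" "AE x in lebesgue. f x = g x"
  shows "f = g"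
proof -
  let ?S = "{x. f x \<noteq> g x}"
  have "open ?S" using assms(1,2) by (rule open_Collect_neq)
  moreover have "negligible ?S"
    using assms(3) by (auto simp: negligible_iff_null_sets eventually_ae_filter null_sets_completion_subset)
  ultimately have "?S = {}" using open_not_negligible by blast
  then show ?thesis by auto
qed

text \<open>The elementary bound of a modulus by 1 plus its square, on a region of finite
  measure.\<close>

lemma L2_sphere_sph_integrable:
  assumes "F \<in> L2_sphere"
  shows "sph_integrable F"
proof -
  have F: "F \<in> borel_measurable lebesgue"
    "set_integrable lebesgue sph_rect (\<lambda>x. (cmod (F x))\<^sup>2 * sin (fst x))"
    using assms by (auto simp: L2_sphere_def)
  have s: "(\<lambda>x :: real \<times> real. complex_of_real (sin (fst x))) \<in> borel_measurable lebesgue"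
    by (intro measurable_completion) (simp add: borel_measurable_continuous_onI continuous_intros)
  have c: "set_integrable lebesgue sph_rect (\<lambda>x. sin (fst x))"
    unfolding sph_rect_cbox by (intro absolutely_integrable_continuous continuous_intros)
  show ?thesis
    unfolding sph_integrable_def
  proof (rule set_integrable_bound[OF set_integral_add(1)[OF c F(2)]])
    show "set_borel_measurable lebesgue sph_rect (\<lambda>x. F x * complex_of_real (sin (fst x)))"
      unfolding set_borel_measurable_def
      by (intro borel_measurable_scaleR borel_measurable_times borel_measurable_indicator sph_rect_lebesgue
          F s)
    show "AE x in lebesgue. x \<in> sph_rect \<longrightarrow> norm (F x * complex_of_real (sin (fst x))) \<le> norm (sin (fst x) + (cmod (F x))\<^sup>2 * sin (fst x))"
    proof (intro AE_I2 impI)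
      fix x :: "real \<times> real" assume "x \<in> sph_rect"
      then have s: "0 \<le> sin (fst x)" by (auto intro: sin_ge_zero)
      have "0 \<le> (cmod (F x) - 1)\<^sup>2 + cmod (F x)" by simp
      then have "cmod (F x) \<le> 1 + (cmod (F x))\<^sup>2" by (simp add: power2_eq_square algebra_simps)
      then have "cmod (F x) * sin (fst x) \<le> (1 + (cmod (F x))\<^sup>2) * sin (fst x)" using s by (rule mult_right_mono)
      then show "norm (F x * complex_of_real (sin (fst x))) \<le> norm (sin (fst x) + (cmod (F x))\<^sup>2 * sin (fst x))"
        using s by (simp add: norm_mult distrib_right)
    qed
  qed
qed

section \<open>Uniform convergence of the harmonic series and the continuous representative\<close>

lemma sph_coeff_eq: "sph_coeff F n m = sph_integral (\<lambda>x. F x * cnj (harm n m (sph_param x)))"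
  unfolding sph_coeff_def by (rule sph_integral_cong) (simp add: sph_harm_eq)

definition harm_sum :: "(real \<times> real \<Rightarrow> complex) \<Rightarrow> nat \<Rightarrow> real ^ 3 \<Rightarrow> complex" where
  "harm_sum F n v = (\<Sum>m=- int n..int n. sph_coeff F n m * harm n m v)"

definition harm_partial :: "(real \<times> real \<Rightarrow> complex) \<Rightarrow> nat \<Rightarrow> real \<times> real \<Rightarrow> complex" where
  "harm_partial F M x = (\<Sum>n<M. harm_sum F n (sph_param x))"

definition harm_series :: "(real \<times> real \<Rightarrow> complex) \<Rightarrow> real \<times> real \<Rightarrow> complex" where
  "harm_series F x = (\<Sum>n. harm_sum F n (sph_param x))"

lemma continuous_on_harm_sum: "continuous_on S (harm_sum F n)"
  unfolding harm_sum_def by (intro continuous_intros continuous_on_harm)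

text \<open>Cauchy-Schwarz in the order and the addition theorem bound the block by a geometric
  mean. Passing to the arithmetic mean separates the Sobolev term from a power of \<open>n\<close>,
  both summable for \<open>r > 1\<close>, as Weierstrass' test requires.\<close>

lemma harm_sum_bound:
  assumes "v \<in> sphere 0 1"
  shows "cmod (harm_sum F n v) \<le> (sobolev_term r F n + (real n + 1/2) powr (1 - 2 * r)) / 2"
proof -
  let ?I = "{- int n..int n}" and ?a = "\<lambda>m. cmod (sph_coeff F n m)" and ?x = "real n + 1/2"
  have "cmod (harm_sum F n v) \<le> (\<Sum>m\<in>?I. ?a m * cmod (harm n m v))"
    unfolding harm_sum_def by (rule sum_norm_le) (simp add: norm_mult)
  also have "\<dots> \<le> sqrt ((\<Sum>m\<in>?I. (?a m)\<^sup>2) * (\<Sum>m\<in>?I. (cmod (harm n m v))\<^sup>2))"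
    by (rule real_le_rsqrt[OF Cauchy_Schwarz_ineq_sum])
  also have "\<dots> \<le> sqrt ((\<Sum>m\<in>?I. (?a m)\<^sup>2) * ?x)"
  proof (intro real_sqrt_le_mono mult_left_mono sum_nonneg)
    have "(2 * real n + 1) / (4 * pi) = ?x * (1 / (2 * pi))" by (simp add: field_simps)
    also have "\<dots> \<le> ?x * 1" using pi_gt3 by (intro mult_left_mono) auto
    finally show "(\<Sum>m\<in>?I. (cmod (harm n m v))\<^sup>2) \<le> ?x" unfolding harm_addition[OF assms] by simp
  qed simp
  also have "(\<Sum>m\<in>?I. (?a m)\<^sup>2) * ?x = sobolev_term r F n * ?x powr (1 - 2 * r)"
  proof -
    have "?x powr (2 * r) * ?x powr (1 - 2 * r) = ?x powr (2 * r + (1 - 2 * r))" by (rule powr_add[symmetric])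
    also have "2 * r + (1 - 2 * r) = 1" by simp
    also have "?x powr 1 = ?x" by (rule powr_one) simp
    finally have e: "?x powr (2 * r) * ?x powr (1 - 2 * r) = ?x" .
    have "sobolev_term r F n = ?x powr (2 * r) * (\<Sum>m\<in>?I. (?a m)\<^sup>2)"
      by (simp only: sobolev_term_def sum_distrib_left)
    then have "sobolev_term r F n * ?x powr (1 - 2 * r) = (\<Sum>m\<in>?I. (?a m)\<^sup>2) * (?x powr (2 * r) * ?x powr (1 - 2 * r))"
      by (simp only: mult_ac)
    then show ?thesis unfolding e by (rule sym)
  qed
  also have "sqrt (sobolev_term r F n * ?x powr (1 - 2 * r)) \<le> (sobolev_term r F n + ?x powr (1 - 2 * r)) / 2"
    by (intro arith_geo_mean_sqrt) (auto simp: sobolev_term_def intro!: sum_nonneg)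
  finally show ?thesis .
qed

lemma summable_harm_bound:
  assumes "r > 1" "summable (sobolev_term r F)"
  shows "summable (\<lambda>n. (sobolev_term r F n + (real n + 1/2) powr (1 - 2 * r)) / 2)"
proof (intro summable_divide summable_add assms(2))
  have "summable (\<lambda>n. real n powr (1 - 2 * r))"
    using assms(1) by (subst summable_real_powr_iff) auto
  then show "summable (\<lambda>n. (real n + 1/2) powr (1 - 2 * r))"
    by (rule summable_comparison_test'[where N = 1]) (use assms(1) in \<open>auto intro!: powr_mono2'\<close>)
qed

lemma uniform_limit_harm_sum:
  assumes "r > 1" "summable (sobolev_term r F)"
  shows "uniform_limit (sphere 0 1) (\<lambda>M v. \<Sum>n<M. harm_sum F n v) (\<lambda>v. \<Sum>n. harm_sum F n v) sequentially"
  by (rule Weierstrass_m_test[OF harm_sum_bound summable_harm_bound[OF assms]])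

lemma harm_series_sph_cont:
  assumes "r > 1" "summable (sobolev_term r F)"
  shows "harm_series F \<in> sph_cont"
proof -
  have "continuous_on (sphere 0 1) (\<lambda>v. \<Sum>n. harm_sum F n v)"
    by (rule uniform_limit_theorem[OF _ uniform_limit_harm_sum[OF assms]])
       (auto intro!: always_eventually continuous_intros continuous_on_harm_sum)
  moreover have "harm_series F = (\<lambda>v. \<Sum>n. harm_sum F n v) \<circ> sph_param"
    by (simp add: fun_eq_iff harm_series_def)
  ultimately show ?thesis by (auto simp: sph_cont_def)
qed

lemma uniform_limit_harm_partial:
  assumes "r > 1" "summable (sobolev_term r F)"
  shows "uniform_limit S (harm_partial F) (harm_series F) sequentially"
  unfolding harm_partial_def harm_series_def
  by (rule uniform_limit_compose'[OF uniform_limit_harm_sum[OF assms]]) (simp add: sph_param_sphere[simplified])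

lemma continuous_on_harm_partial: "continuous_on S (harm_partial F M)"
  unfolding harm_partial_def
  by (intro continuous_intros continuous_on_compose2[OF continuous_on_harm_sum continuous_on_sph_param subset_UNIV])

lemma sph_coeff_harm_partial:
  assumes "\<bar>m\<bar> \<le> int n" "n < M"
  shows "sph_integral (\<lambda>x. harm_partial F M x * cnj (harm n m (sph_param x))) = sph_coeff F n m"
proof -
  let ?T = "\<lambda>k l x. sph_coeff F k l * (harm k l (sph_param x) * cnj (harm n m (sph_param x)))"
  have c: "sph_integrable (?T k l)" for k l
    by (intro sph_integrable_continuous continuous_intros continuous_on_harm_param)
  have "harm_partial F M x * cnj (harm n m (sph_param x)) = (\<Sum>k<M. \<Sum>l=- int k..int k. ?T k l x)" for x
    by (simp add: harm_partial_def harm_sum_def sum_distrib_right mult.assoc)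
  then have "sph_integral (\<lambda>x. harm_partial F M x * cnj (harm n m (sph_param x))) = (\<Sum>k<M. \<Sum>l=- int k..int k. sph_integral (?T k l))"
    by (simp only:) (simp add: sph_integral_sum sph_integrable_sum c)
  also have "\<dots> = (\<Sum>k<M. \<Sum>l=- int k..int k. if k = n then (if l = m then sph_coeff F n m else 0) else 0)"
  proof (intro sum.cong refl)
    fix k l assume "k \<in> {..<M}" "l \<in> {- int k..int k}"
    then have "\<bar>l\<bar> \<le> int k" by auto
    then show "sph_integral (?T k l) = (if k = n then (if l = m then sph_coeff F n m else 0) else 0)"
      by (simp add: sph_integral_cmult harm_orthonormal)
  qed
  also have "\<dots> = (\<Sum>k<M. if k = n then sph_coeff F n m else 0)"
    using assms(1) by (intro sum.cong refl) (auto simp: sum.delta)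
  also have "\<dots> = sph_coeff F n m" using assms(2) by simp
  finally show ?thesis .
qed

lemma sph_coeff_harm_series:
  assumes "r > 1" "summable (sobolev_term r F)" "\<bar>m\<bar> \<le> int n"
  shows "sph_integral (\<lambda>x. harm_series F x * cnj (harm n m (sph_param x))) = sph_coeff F n m"
proof -
  let ?h = "\<lambda>x. cnj (harm n m (sph_param x))"
  have hc: "continuous_on S ?h" for S by (intro continuous_intros continuous_on_harm_param)
  have "uniform_limit sph_rect (\<lambda>M x. harm_partial F M x * ?h x) (\<lambda>x. harm_series F x * ?h x) sequentially"
  proof (rule uniform_lim_mult[OF uniform_limit_harm_partial[OF assms(1,2)] uniform_limit_const])
    show "bounded (harm_series F ` sph_rect)"
      by (intro compact_imp_bounded compact_continuous_image compact_sph_rect sph_cont_continuous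
          harm_series_sph_cont[OF assms(1,2)])
    show "bounded (?h ` sph_rect)"
      by (intro compact_imp_bounded compact_continuous_image compact_sph_rect hc)
  qed
  then have "(\<lambda>M. sph_integral (\<lambda>x. harm_partial F M x * ?h x)) \<longlonglongrightarrow> sph_integral (\<lambda>x. harm_series F x * ?h x)"
    by (rule sph_integral_uniform_limit)
       (intro sph_integrable_continuous continuous_intros hc continuous_on_harm_partial
          sph_cont_continuous harm_series_sph_cont[OF assms(1,2)])+
  moreover have "(\<lambda>M. sph_integral (\<lambda>x. harm_partial F M x * ?h x)) \<longlonglongrightarrow> sph_coeff F n m"
    using sph_coeff_harm_partial[OF assms(3)]
    by (intro tendsto_eventually) (auto simp: eventually_sequentially intro!: exI[of _ "Suc n"])
  ultimately show ?thesis by (rule LIMSEQ_unique)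
qed

text \<open>All coefficients of the difference vanish, uniform convergence giving those of the
  series. Completeness acts on the rectangle, the symmetries extend the result to the plane.\<close>

lemma AE_eq_harm_series:
  assumes "r > 1" "F \<in> sobolev r"
  shows "AE x in lebesgue. harm_series F x = F x"
proof -
  have F: "F \<in> L2_sphere" "summable (sobolev_term r F)" using assms(2) by (auto simp: sobolev_def)
  define H where "H x = harm_series F x - F x" for x
  have G: "harm_series F \<in> sph_cont" by (rule harm_series_sph_cont[OF assms(1) F(2)])
  have Fi: "sph_integrable F" by (rule L2_sphere_sph_integrable[OF F(1)])
  have Gi: "sph_integrable (harm_series F)" by (intro sph_integrable_continuous sph_cont_continuous G)
  have "sph_symmetric H"
    using sph_cont_symmetric[OF G] F(1) by (auto simp: H_def sph_symmetric_def L2_sphere_def)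
  moreover have "negligible {x \<in> sph_rect. H x \<noteq> 0}"
  proof (rule negligible_nonzero_on_rect)
    show "sph_integrable H" unfolding H_def by (intro sph_integrable_diff Gi Fi)
    fix n :: nat and m :: int assume nm: "\<bar>m\<bar> \<le> int n"
    let ?h = "\<lambda>x. cnj (harm n m (sph_param x))"
    have hc: "continuous_on S ?h" for S by (intro continuous_intros continuous_on_harm_param)
    have "sph_integral (\<lambda>x. H x * ?h x) = sph_integral (\<lambda>x. ?h x * harm_series F x - ?h x * F x)"
      by (simp add: H_def algebra_simps)
    also have "\<dots> = sph_integral (\<lambda>x. ?h x * harm_series F x) - sph_integral (\<lambda>x. ?h x * F x)"
      by (intro sph_integral_diff sph_integrable_mult_continuous Gi Fi hc)
    also have "\<dots> = 0"
      using sph_coeff_harm_series[OF assms(1) F(2) nm] sph_coeff_eq[of F n m] by (simp add: mult.commute)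
    finally show "sph_integral (\<lambda>x. H x * ?h x) = 0" .
  qed
  ultimately have "negligible {x. H x \<noteq> 0}" by (rule negligible_nonzero_everywhere)
  then have "AE x in lebesgue. H x = 0"
    by (auto simp: negligible_iff_null_sets eventually_ae_filter)
  then show ?thesis by eventually_elim (simp add: H_def)
qed

lemma cont_rep_eq:
  assumes "r > 1" "F \<in> sobolev r"
  shows "cont_rep F = harm_series F"
  unfolding cont_rep_def
proof (rule the_equality)
  have G: "harm_series F \<in> sph_cont"
    using assms by (intro harm_series_sph_cont) (auto simp: sobolev_def)
  have AE: "AE x in lebesgue. harm_series F x = F x" by (rule AE_eq_harm_series[OF assms])
  show "harm_series F \<in> sph_cont \<and> (AE x in lebesgue. harm_series F x = F x)" using G AE by blast
  fix G' assume G': "G' \<in> sph_cont \<and> (AE x in lebesgue. G' x = F x)"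
  then have "AE x in lebesgue. G' x = F x" by blast
  with AE have "AE x in lebesgue. G' x = harm_series F x" by eventually_elim simp
  then show "G' = harm_series F"
    using G G' by (intro continuous_AE_eq_imp_eq sph_cont_continuous) auto
qed

section \<open>The interpolant and its oscillatory integral\<close>

text \<open>The interpolation conditions depend only on the set of angles, so the reversed numbering
  disappears.\<close>

lemma gl_angle_image:
  assumes "N \<ge> 1"
  shows "gl_angle N ` {0..N} = arccos ` lobatto_nodes N"
proof -
  let ?L = "sorted_list_of_set (lobatto_nodes N)"
  have len: "length ?L = Suc N" using card_lobatto_nodes[OF assms] by simp
  have set: "set ?L = lobatto_nodes N" using finite_lobatto_nodes[OF assms] by simp
  have "gl_angle N j = arccos (?L ! (N - j))" for j
    by (simp add: gl_angle_def gl_node_def lobatto_nodes_eq)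
  then have "gl_angle N ` {0..N} = arccos ` (!) ?L ` (\<lambda>j. N - j) ` {0..N}" by (simp add: image_image)
  moreover have "(\<lambda>j. N - j) ` {0..N} = {..<Suc N}"
  proof -
    have "i \<in> (\<lambda>j. N - j) ` {0..N}" if "i < Suc N" for i
      by (rule image_eqI[of _ _ "N - i"]) (use that in auto)
    then show ?thesis by auto
  qed
  moreover have "(!) ?L ` {..<Suc N} = lobatto_nodes N"
  proof -
    have "(!) xs ` {..<length xs} = set xs" for xs :: "real list" by (auto simp: set_conv_nth)
    from this[of ?L] show ?thesis by (simp only: len set)
  qed
  ultimately show ?thesis by simp
qed

section \<open>Cosine polynomials as polynomials in \<open>cos \<theta>\<close>\<close>

lemma D_evenI:
  "(\<And>\<theta>. f \<theta> = (\<Sum>n\<le>K. c n * of_real (cos (real n * \<theta>)))) \<Longrightarrow> f \<in> D_even K"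
  unfolding D_even_def by (intro CollectI exI ext)

lemma D_even_cmult_cos: "n \<le> K \<Longrightarrow> (\<lambda>\<theta>. c * of_real (cos (real n * \<theta>))) \<in> D_even K"
proof -
  assume n: "n \<le> K"
  have "c * of_real (cos (real n * \<theta>)) = (\<Sum>i\<le>K. (if i = n then c else 0) * of_real (cos (real i * \<theta>)))" for \<theta>
    using n by (simp add: if_distrib[of "\<lambda>z. z * _"] cong: if_cong)
  then show ?thesis by (rule D_evenI)
qed

lemma D_even_add:
  assumes "f \<in> D_even K" "g \<in> D_even K"
  shows "(\<lambda>\<theta>. f \<theta> + g \<theta>) \<in> D_even K"
proof -
  obtain c d where "f = (\<lambda>\<theta>. \<Sum>n\<le>K. c n * of_real (cos (real n * \<theta>)))"
    "g = (\<lambda>\<theta>. \<Sum>n\<le>K. d n * of_real (cos (real n * \<theta>)))"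
    using assms by (auto simp: D_even_def)
  then have "f \<theta> + g \<theta> = (\<Sum>n\<le>K. (c n + d n) * of_real (cos (real n * \<theta>)))" for \<theta>
    by (simp add: distrib_right sum.distrib)
  then show ?thesis by (rule D_evenI)
qed

lemma D_even_0: "(\<lambda>\<theta>. 0) \<in> D_even K"
  using D_even_cmult_cos[of 0 K 0] by simp

lemma D_even_sum:
  "(\<And>i. i \<in> I \<Longrightarrow> f i \<in> D_even K) \<Longrightarrow> (\<lambda>\<theta>. \<Sum>i\<in>I. f i \<theta>) \<in> D_even K"
  by (induction I rule: infinite_finite_induct) (auto intro: D_even_0 D_even_add)

lemma D_even_cmult:
  assumes "f \<in> D_even K"
  shows "(\<lambda>\<theta>. c * f \<theta>) \<in> D_even K"
proof -
  obtain d where "f = (\<lambda>\<theta>. \<Sum>n\<le>K. d n * of_real (cos (real n * \<theta>)))"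
    using assms by (auto simp: D_even_def)
  then have "c * f \<theta> = (\<Sum>n\<le>K. (c * d n) * of_real (cos (real n * \<theta>)))" for \<theta>
    by (simp add: sum_distrib_left mult.assoc)
  then show ?thesis by (rule D_evenI)
qed

lemma D_even_mult_cos:
  assumes "f \<in> D_even K"
  shows "(\<lambda>\<theta>. of_real (cos \<theta>) * f \<theta>) \<in> D_even (Suc K)"
proof -
  obtain d where f: "f = (\<lambda>\<theta>. \<Sum>n\<le>K. d n * of_real (cos (real n * \<theta>)))"
    using assms by (auto simp: D_even_def)
  have "(\<lambda>\<theta>. d n * of_real (cos \<theta> * cos (real n * \<theta>))) \<in> D_even (Suc K)" if "n \<le> K" for n
  proof (cases n)
    case 0
    then show ?thesis using D_even_cmult_cos[of 1 "Suc K" "d 0"] by simp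
  next
    case (Suc j)
    have "cos \<theta> * cos (real n * \<theta>) = cos (real (Suc n) * \<theta>) / 2 + cos (real j * \<theta>) / 2" for \<theta>
    proof -
      have "real (Suc n) * \<theta> = real n * \<theta> + \<theta>" "real j * \<theta> = real n * \<theta> - \<theta>"
        by (simp_all add: Suc algebra_simps)
      then show ?thesis by (simp only: cos_add cos_diff) (simp add: field_simps)
    qed
    then have "(\<lambda>\<theta>. d n * of_real (cos \<theta> * cos (real n * \<theta>))) =
       (\<lambda>\<theta>. d n / 2 * of_real (cos (real (Suc n) * \<theta>)) + d n / 2 * of_real (cos (real j * \<theta>)))"
      by (simp add: fun_eq_iff algebra_simps)
    then show ?thesis
      using D_even_add[OF D_even_cmult_cos[of "Suc n" "Suc K" "d n / 2"] D_even_cmult_cos[of j "Suc K" "d n / 2"]] that Suc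
      by simp
  qed
  then have "(\<lambda>\<theta>. \<Sum>n\<le>K. d n * of_real (cos \<theta> * cos (real n * \<theta>))) \<in> D_even (Suc K)"
    by (intro D_even_sum) auto
  then show ?thesis by (simp add: f sum_distrib_left mult_ac)
qed

lemma D_even_mono:
  assumes "f \<in> D_even K" "K \<le> L"
  shows "f \<in> D_even L"
proof -
  obtain d where f: "f = (\<lambda>\<theta>. \<Sum>n\<le>K. d n * of_real (cos (real n * \<theta>)))"
    using assms(1) by (auto simp: D_even_def)
  show ?thesis unfolding f using assms(2) by (intro D_even_sum D_even_cmult_cos) auto
qed

lemma D_even_cos_power: "i \<le> K \<Longrightarrow> (\<lambda>\<theta>. of_real (cos \<theta> ^ i)) \<in> D_even K"
proof (rule D_even_mono)
  show "(\<lambda>\<theta>. of_real (cos \<theta> ^ i)) \<in> D_even i"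
  proof (induction i)
    case 0
    then show ?case using D_even_cmult_cos[of 0 0 1] by simp
  next
    case (Suc i)
    then show ?case using D_even_mult_cos[OF Suc] by simp
  qed
qed

lemma D_even_poly_cos:
  assumes "degree p \<le> K"
  shows "(\<lambda>\<theta>. of_real (poly p (cos \<theta>))) \<in> D_even K"
proof -
  have "(\<lambda>\<theta>. complex_of_real (poly p (cos \<theta>))) = (\<lambda>\<theta>. \<Sum>i\<le>degree p. of_real (coeff p i) * of_real (cos \<theta> ^ i))"
    by (simp add: poly_altdef)
  then show ?thesis
    using assms by (simp only:) (intro D_even_sum D_even_cmult D_even_cos_power, auto)
qed

lemma cos_multiple_poly: "\<exists>p. degree p \<le> n \<and> (\<forall>\<theta>. cos (real n * \<theta>) = poly p (cos \<theta>))"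
proof (induction n rule: induct_nat_012)
  case 0
  show ?case by (intro exI[of _ 1]) simp
next
  case 1
  show ?case by (intro exI[of _ "[:0, 1:]"]) simp
next
  case (ge2 n)
  then obtain p q where p: "degree p \<le> n" "\<forall>\<theta>. cos (real n * \<theta>) = poly p (cos \<theta>)"
    and q: "degree q \<le> Suc n" "\<forall>\<theta>. cos (real (Suc n) * \<theta>) = poly q (cos \<theta>)" by auto
  show ?case
  proof (intro exI[of _ "[:0, 2:] * q - p"] conjI allI)
    have "degree ([:0, 2:] * q) \<le> Suc (Suc n)"
      using q(1) by (intro order_trans[OF degree_mult_le]) simp
    then show "degree ([:0, 2:] * q - p) \<le> Suc (Suc n)" using p(1) by (intro degree_diff_le) auto
    fix \<theta>
    have "real (Suc (Suc n)) * \<theta> = real (Suc n) * \<theta> + \<theta>" "real n * \<theta> = real (Suc n) * \<theta> - \<theta>"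
      by (simp_all add: algebra_simps)
    then have "cos (real (Suc (Suc n)) * \<theta>) = 2 * cos \<theta> * cos (real (Suc n) * \<theta>) - cos (real n * \<theta>)"
      by (simp only: cos_add cos_diff) simp
    then show "cos (real (Suc (Suc n)) * \<theta>) = poly ([:0, 2:] * q - p) (cos \<theta>)"
      using p(2) q(2) by simp
  qed
qed

lemma D_even_imp_poly:
  assumes "f \<in> D_even K"
  obtains p q where "degree p \<le> K" "degree q \<le> K" "\<And>\<theta>. Re (f \<theta>) = poly p (cos \<theta>)" "\<And>\<theta>. Im (f \<theta>) = poly q (cos \<theta>)"
proof -
  obtain T where T: "\<And>n. degree (T n) \<le> n" "\<And>n \<theta>. cos (real n * \<theta>) = poly (T n) (cos \<theta>)"
    using cos_multiple_poly by metis
  obtain c where c: "f = (\<lambda>\<theta>. \<Sum>n\<le>K. c n * of_real (cos (real n * \<theta>)))"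
    using assms by (auto simp: D_even_def)
  show ?thesis
  proof
    show "degree (\<Sum>n\<le>K. smult (Re (c n)) (T n)) \<le> K" "degree (\<Sum>n\<le>K. smult (Im (c n)) (T n)) \<le> K"
      using T(1) by (auto intro!: degree_sum_le order_trans[OF degree_smult_le] intro: order_trans)
    show "Re (f \<theta>) = poly (\<Sum>n\<le>K. smult (Re (c n)) (T n)) (cos \<theta>)"
      "Im (f \<theta>) = poly (\<Sum>n\<le>K. smult (Im (c n)) (T n)) (cos \<theta>)" for \<theta>
      by (simp_all add: c T(2) poly_sum)
  qed
qed

text \<open>Real and imaginary parts are real polynomials in \<open>cos \<theta>\<close> of degree
  at most \<open>K\<close>, determined by more than \<open>K\<close> values.\<close>

lemma D_even_eq_on_nodes:
  assumes "f \<in> D_even K" "g \<in> D_even K" "finite S" "K < card S" "S \<subseteq> {-1..1}"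
    and eq: "\<And>x. x \<in> S \<Longrightarrow> f (arccos x) = g (arccos x)"
  shows "f = g"
proof -
  obtain p q where f: "degree p \<le> K" "degree q \<le> K" "\<And>\<theta>. Re (f \<theta>) = poly p (cos \<theta>)" "\<And>\<theta>. Im (f \<theta>) = poly q (cos \<theta>)"
    using D_even_imp_poly[OF assms(1)] by blast
  obtain p' q' where g: "degree p' \<le> K" "degree q' \<le> K" "\<And>\<theta>. Re (g \<theta>) = poly p' (cos \<theta>)" "\<And>\<theta>. Im (g \<theta>) = poly q' (cos \<theta>)"
    using D_even_imp_poly[OF assms(2)] by blast
  have x: "cos (arccos x) = x" if "x \<in> S" for x using that assms(5) by (intro cos_arccos) auto
  have "p = p'"
    by (rule poly_eq_on_nodes[OF f(1) g(1) assms(3,4)]) (metis f(3) g(3) eq x)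
  moreover have "q = q'"
    by (rule poly_eq_on_nodes[OF f(2) g(2) assms(3,4)]) (metis f(4) g(4) eq x)
  ultimately show ?thesis using f g by (auto simp: fun_eq_iff complex_eq_iff)
qed

lemma D_odd_iff: "f \<in> D_odd K \<longleftrightarrow> (\<exists>g\<in>D_even K. f = (\<lambda>\<theta>. of_real (sin \<theta>) * g \<theta>))"
proof -
  have "(\<Sum>n\<le>K. c n * of_real (sin \<theta> * cos (real n * \<theta>))) = of_real (sin \<theta>) * (\<Sum>n\<le>K. c n * complex_of_real (cos (real n * \<theta>)))" for c \<theta>
    by (simp add: sum_distrib_left mult_ac)
  then show ?thesis unfolding D_odd_def D_even_def by auto
qed

section \<open>The discrete Fourier transform on the \<open>\<phi>\<close>-grid\<close>

lemma sum_roots_of_unity: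
  assumes "N \<ge> 1"
  shows "(\<Sum>k\<in>{- int N + 1..int N}. exp (\<i> * of_int m * of_real (of_int k * pi / real N))) =
    (if int (2 * N) dvd m then of_nat (2 * N) else 0)"
proof -
  define z where "z = exp (\<i> * of_real (of_int m * pi / real N))"
  have N: "real N > 0" using assms by simp
  \<comment> \<open>Factoring out the first grid point turns the sum into a geometric series in
    \<open>z\<close> with \<open>2 N\<close> terms.\<close>
  have tm: "exp (\<i> * of_int m * of_real (of_int (int j - int N + 1) * pi / real N)) =
      exp (\<i> * of_real (of_int m * (1 - real N) * pi / real N)) * z ^ j" for j
  proof -
    have "z ^ j = exp (of_nat j * (\<i> * of_real (of_int m * pi / real N)))" by (simp only: z_def exp_of_nat_mult)
    then show ?thesis using N
      by (simp add: exp_add[symmetric]) (simp add: field_simps)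
  qed
  have "(\<Sum>k\<in>{- int N + 1..int N}. exp (\<i> * of_int m * of_real (of_int k * pi / real N))) =
     (\<Sum>j<2 * N. exp (\<i> * of_int m * of_real (of_int (int j - int N + 1) * pi / real N)))"
    by (rule sum.reindex_bij_witness[of _ "\<lambda>j. int j - int N + 1" "\<lambda>k. nat (k + int N - 1)"]) auto
  also have "\<dots> = exp (\<i> * of_real (of_int m * (1 - real N) * pi / real N)) * (\<Sum>j<2 * N. z ^ j)"
    unfolding tm by (simp add: sum_distrib_left)
  finally have s: "(\<Sum>k\<in>{- int N + 1..int N}. exp (\<i> * of_int m * of_real (of_int k * pi / real N))) = \<dots>" .
  have z1: "z = 1 \<longleftrightarrow> int (2 * N) dvd m"
  proof -
    have "z = 1 \<longleftrightarrow> (\<exists>n::int. of_int m * pi / real N = of_int (2 * n) * pi)"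
      unfolding z_def exp_eq_1 by simp
    also have "\<dots> \<longleftrightarrow> (\<exists>n::int. m = int (2 * N) * n)"
    proof (intro ex_cong1)
      fix n :: int
      have "of_int m * pi / real N = of_int (2 * n) * pi \<longleftrightarrow> real_of_int m = real_of_int (int (2 * N) * n)"
        using N by (simp add: field_simps)
      then show "of_int m * pi / real N = of_int (2 * n) * pi \<longleftrightarrow> m = int (2 * N) * n"
        by (simp only: of_int_eq_iff)
    qed
    finally show ?thesis by (simp only: dvd_def)
  qed
  show ?thesis
  proof (cases "int (2 * N) dvd m")
    case True
    then obtain n where n: "m = int (2 * N) * n" by (elim dvdE)
    have "exp (\<i> * of_int m * of_real (of_int k * pi / real N)) = 1" for k
    proof -
      have "exp (\<i> * of_int m * of_real (of_int k * pi / real N)) = exp (2 * of_int (n * k) * of_real pi * \<i>)"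
        using N by (simp add: n mult_ac)
      then show ?thesis using exp_integer_2pi[of "of_int (n * k)"] by simp
    qed
    then show ?thesis using True by simp
  next
    case False
    then have "z \<noteq> 1" using z1 by simp
    have "z ^ (2 * N) = exp (of_nat (2 * N) * (\<i> * of_real (of_int m * pi / real N)))" by (simp only: z_def exp_of_nat_mult)
    also have "of_nat (2 * N) * (\<i> * of_real (of_int m * pi / real N)) = 2 * of_int m * of_real pi * \<i>"
      using N by (simp add: field_simps)
    also have "exp \<dots> = 1" using exp_integer_2pi[of "of_int m"] by simp
    finally have "(\<Sum>j<2 * N. z ^ j) = 0" using \<open>z \<noteq> 1\<close> by (simp add: geometric_sum)
    then show ?thesis using s False by simp
  qed
qed

text \<open>The interpolation condition in \<open>\<phi>\<close> is a discrete Fourier transform on \<open>2 N\<close> points; its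
  coefficients prescribe the values of the components \<open>p\<^sub>m\<close> at the nodes.\<close>

definition dft_coeff :: "nat \<Rightarrow> (real \<times> real \<Rightarrow> complex) \<Rightarrow> int \<Rightarrow> real \<Rightarrow> complex" where
  "dft_coeff N F m x = (\<Sum>k\<in>{- int N + 1..int N}. F (arccos x, of_int k * pi / real N) *
     exp (- (\<i> * of_int m * of_real (of_int k * pi / real N)))) / of_nat (2 * N)"

lemma dft_range: "{- int N<..int N} = {- int N + 1..int N}"
  by auto

lemma dft_of_trig_sum:
  assumes "N \<ge> 1" "m \<in> {- int N<..int N}"
    and F: "\<And>k. k \<in> {- int N + 1..int N} \<Longrightarrow> F (arccos x, of_int k * pi / real N) =
      (\<Sum>l\<in>{- int N<..int N}. p l * exp (\<i> * of_int l * of_real (of_int k * pi / real N)))"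
  shows "dft_coeff N F m x = p m"
proof -
  let ?K = "{- int N + 1..int N}"
  let ?e = "\<lambda>l k. exp (\<i> * of_int l * of_real (of_int k * pi / real N))"
  have "dft_coeff N F m x * of_nat (2 * N) = (\<Sum>k\<in>?K. F (arccos x, of_int k * pi / real N) * exp (- (\<i> * of_int m * of_real (of_int k * pi / real N))))"
    using assms(1) by (simp add: dft_coeff_def)
  also have "\<dots> = (\<Sum>k\<in>?K. \<Sum>l\<in>?K. p l * ?e (l - m) k)"
  proof (intro sum.cong refl)
    fix k assume k: "k \<in> ?K"
    have "?e l k * exp (- (\<i> * of_int m * of_real (of_int k * pi / real N))) = ?e (l - m) k" for l
      by (simp add: exp_add[symmetric] algebra_simps)
    then show "F (arccos x, of_int k * pi / real N) * exp (- (\<i> * of_int m * of_real (of_int k * pi / real N))) = (\<Sum>l\<in>?K. p l * ?e (l - m) k)"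
      by (simp only: F[OF k] dft_range sum_distrib_right mult.assoc)
  qed
  also have "\<dots> = (\<Sum>l\<in>?K. p l * (\<Sum>k\<in>?K. ?e (l - m) k))"
    by (subst sum.swap) (simp only: sum_distrib_left)
  also have "\<dots> = (\<Sum>l\<in>?K. if l = m then p m * of_nat (2 * N) else 0)"
  proof (intro sum.cong refl)
    fix l assume l: "l \<in> ?K"
    have "int (2 * N) dvd l - m \<longleftrightarrow> l = m"
    proof
      assume "int (2 * N) dvd l - m"
      moreover have "\<bar>l - m\<bar> < int (2 * N)" using l assms(2) by auto
      ultimately show "l = m" using dvd_imp_le_int[of "l - m" "int (2 * N)"] by auto
    qed simp
    then show "p l * (\<Sum>k\<in>?K. ?e (l - m) k) = (if l = m then p m * of_nat (2 * N) else 0)"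
      unfolding sum_roots_of_unity[OF assms(1)] by simp
  qed
  also have "\<dots> = p m * of_nat (2 * N)" using assms(2) by simp
  finally show ?thesis using assms(1) by simp
qed

lemma dft_inverse:
  assumes "N \<ge> 1" "k \<in> {- int N + 1..int N}"
  shows "(\<Sum>m\<in>{- int N<..int N}. dft_coeff N F m x * exp (\<i> * of_int m * of_real (of_int k * pi / real N))) =
    F (arccos x, of_int k * pi / real N)"
proof -
  let ?K = "{- int N + 1..int N}"
  let ?e = "\<lambda>l k. exp (\<i> * of_int l * of_real (of_int k * pi / real N))"
  let ?f = "\<lambda>j. F (arccos x, of_int j * pi / real N)"
  have "(\<Sum>m\<in>?K. dft_coeff N F m x * ?e m k) * of_nat (2 * N) = (\<Sum>m\<in>?K. \<Sum>j\<in>?K. ?f j * ?e (k - j) m)"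
    unfolding sum_distrib_right
  proof (intro sum.cong refl)
    fix m
    have "exp (- (\<i> * of_int m * of_real (of_int j * pi / real N))) * ?e m k = ?e (k - j) m" for j
      by (simp add: exp_add[symmetric] algebra_simps diff_divide_distrib)
    then have "(\<Sum>j\<in>?K. ?f j * ?e (k - j) m) = (\<Sum>j\<in>?K. ?f j * exp (- (\<i> * of_int m * of_real (of_int j * pi / real N)))) * ?e m k"
      by (simp only: sum_distrib_right mult.assoc)
    then show "dft_coeff N F m x * ?e m k * of_nat (2 * N) = (\<Sum>j\<in>?K. ?f j * ?e (k - j) m)"
      using assms(1) by (simp add: dft_coeff_def)
  qed
  also have "\<dots> = (\<Sum>j\<in>?K. ?f j * (\<Sum>m\<in>?K. ?e (k - j) m))"
    by (subst sum.swap) (simp only: sum_distrib_left)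
  also have "\<dots> = (\<Sum>j\<in>?K. if j = k then ?f k * of_nat (2 * N) else 0)"
  proof (intro sum.cong refl)
    fix j assume j: "j \<in> ?K"
    have "int (2 * N) dvd k - j \<longleftrightarrow> j = k"
    proof
      assume "int (2 * N) dvd k - j"
      moreover have "\<bar>k - j\<bar> < int (2 * N)" using j assms(2) by auto
      ultimately show "j = k" using dvd_imp_le_int[of "k - j" "int (2 * N)"] by auto
    qed simp
    then show "?f j * (\<Sum>m\<in>?K. ?e (k - j) m) = (if j = k then ?f k * of_nat (2 * N) else 0)"
      unfolding sum_roots_of_unity[OF assms(1)] by simp
  qed
  also have "\<dots> = ?f k * of_nat (2 * N)" using assms(2) by simp
  finally show ?thesis using assms(1) by (simp add: dft_range)
qed

text \<open>At a pole \<open>F\<close> does not depend on \<open>\<phi>\<close>, so every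
  nonconstant Fourier coefficient is 0. This matches the vanishing conditions built into
  \<open>X_space\<close>.\<close>

lemma dft_coeff_endpoint:
  assumes "F \<in> sph_cont" "N \<ge> 1" "x \<in> {-1, 1}" "m \<in> {- int N<..int N}" "m \<noteq> 0"
  shows "dft_coeff N F m x = 0"
proof -
  obtain F0 where F0: "F = F0 \<circ> sph_param" using assms(1) by (auto simp: sph_cont_def)
  have "sin (arccos x) = 0" using assms(3) by auto
  then have "sph_param (arccos x, \<phi>) = sph_param (arccos x, 0)" for \<phi> by (simp add: sph_param_def)
  then have F: "F (arccos x, \<phi>) = F (arccos x, 0)" for \<phi> unfolding F0 comp_apply by (rule arg_cong)
  have "\<not> int (2 * N) dvd - m"
  proof
    assume "int (2 * N) dvd - m"
    then have "int (2 * N) \<le> \<bar>m\<bar>" using assms(5) dvd_imp_le_int[of "- m" "int (2 * N)"] by auto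
    then show False using assms(2,4) by auto
  qed
  then have "(\<Sum>k\<in>{- int N + 1..int N}. exp (- (\<i> * of_int m * of_real (of_int k * pi / real N)))) = 0"
    using sum_roots_of_unity[OF assms(2), of "- m"] by simp
  then show ?thesis unfolding dft_coeff_def F[of "_ / _"] by (simp add: sum_distrib_left[symmetric])
qed

text \<open>For odd order the factor \<open>sin \<theta>\<close> is split off. What remains is
  interpolated at the \<open>N - 1\<close> interior nodes, with data divided by the sine there; the
  degree \<open>N - 2\<close> is the one in \<open>D_odd\<close>.\<close>

definition gl_component :: "nat \<Rightarrow> (real \<times> real \<Rightarrow> complex) \<Rightarrow> int \<Rightarrow> real \<Rightarrow> complex" where
  "gl_component N F m \<theta> = (if even m
     then \<Sum>x\<in>lobatto_nodes N. dft_coeff N F m x * of_real (poly (lagrange (lobatto_nodes N) x) (cos \<theta>))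
     else of_real (sin \<theta>) * (\<Sum>x\<in>lobatto_nodes N - {-1, 1}. dft_coeff N F m x / of_real (sqrt (1 - x\<^sup>2)) *
       of_real (poly (lagrange (lobatto_nodes N - {-1, 1}) x) (cos \<theta>))))"

definition gl_explicit :: "nat \<Rightarrow> (real \<times> real \<Rightarrow> complex) \<Rightarrow> real \<times> real \<Rightarrow> complex" where
  "gl_explicit N F = (\<lambda>(\<theta>, \<phi>). \<Sum>m\<in>{- int N<..int N}. gl_component N F m \<theta> * exp (\<i> * of_int m * of_real \<phi>))"

lemma card_interior_nodes: "N \<ge> 1 \<Longrightarrow> card (lobatto_nodes N - {-1, 1}) = N - 1"
proof -
  assume N: "N \<ge> 1"
  have "{-1, 1} \<subseteq> lobatto_nodes N" by (simp add: lobatto_nodes_eq)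
  then show ?thesis by (simp add: card_Diff_subset card_lobatto_nodes[OF N])
qed

lemma gl_component_at_node:
  assumes "F \<in> sph_cont" "N \<ge> 1" "m \<in> {- int N<..int N}" "x \<in> lobatto_nodes N"
  shows "gl_component N F m (arccos x) = dft_coeff N F m x"
proof -
  let ?S = "lobatto_nodes N" and ?I = "lobatto_nodes N - {-1, 1}"
  have fin: "finite ?S" by (rule finite_lobatto_nodes[OF assms(2)])
  have x: "-1 \<le> x" "x \<le> 1" using assms(4) lobatto_nodes_subset[OF assms(2)] by auto
  then have c: "cos (arccos x) = x" "sin (arccos x) = sqrt (1 - x\<^sup>2)" by (simp_all add: sin_arccos_abs abs_le_iff)
  show ?thesis
  proof (cases "even m")
    case True
    then show ?thesis using fin assms(4)
      by (simp add: gl_component_def c poly_lagrange if_distrib[of of_real] if_distrib[of "\<lambda>z. _ * z"] cong: if_cong)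
  next
    case False
    show ?thesis
    proof (cases "x \<in> {-1, 1}")
      case True
      moreover have "m \<noteq> 0" using False by auto
      ultimately show ?thesis using False c dft_coeff_endpoint[OF assms(1,2) _ assms(3), of x]
        by (auto simp: gl_component_def)
    next
      case nx: False
      then have "x\<^sup>2 < 1" using x by (auto simp: abs_square_less_1 abs_less_iff)
      then have s: "sqrt (1 - x\<^sup>2) \<noteq> 0" by simp
      have "(\<Sum>y\<in>?I. dft_coeff N F m y / of_real (sqrt (1 - y\<^sup>2)) * of_real (poly (lagrange ?I y) x)) =
         (\<Sum>y\<in>?I. if y = x then dft_coeff N F m x / of_real (sqrt (1 - x\<^sup>2)) else 0)"
        using fin nx assms(4) by (intro sum.cong refl) (auto simp: poly_lagrange)
      also have "\<dots> = dft_coeff N F m x / of_real (sqrt (1 - x\<^sup>2))"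
        using fin nx assms(4) by simp
      finally show ?thesis using False s by (simp add: gl_component_def c)
    qed
  qed
qed

lemma gl_explicit_in_X_space:
  assumes "F \<in> sph_cont" "N \<ge> 2"
  shows "gl_explicit N F \<in> X_space N"
  unfolding X_space_def
proof (rule CollectI, rule exI[of _ "gl_component N F"], intro conjI ballI impI)
  fix m assume m: "m \<in> {- int N<..int N}"
  have N: "N \<ge> 1" using assms(2) by simp
  let ?S = "lobatto_nodes N" and ?I = "lobatto_nodes N - {-1, 1}"
  have fin: "finite ?S" by (rule finite_lobatto_nodes[OF N])
  show "gl_component N F m \<in> D_even N" if "even m"
  proof -
    have "degree (lagrange ?S x) \<le> N" if "x \<in> ?S" for x
      using degree_lagrange[OF fin that] by (simp add: card_lobatto_nodes[OF N])
    then have "(\<lambda>\<theta>. \<Sum>x\<in>?S. dft_coeff N F m x * of_real (poly (lagrange ?S x) (cos \<theta>))) \<in> D_even N"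
      by (intro D_even_sum D_even_cmult D_even_poly_cos)
    then show ?thesis using that by (simp add: gl_component_def[abs_def])
  qed
  show "gl_component N F m \<in> D_odd (N - 2)" if "odd m"
  proof -
    have "degree (lagrange ?I x) \<le> N - 2" if "x \<in> ?I" for x
      using degree_lagrange[of ?I x] fin that card_interior_nodes[OF N] by simp
    then have "(\<lambda>\<theta>. \<Sum>x\<in>?I. dft_coeff N F m x / of_real (sqrt (1 - x\<^sup>2)) * of_real (poly (lagrange ?I x) (cos \<theta>))) \<in> D_even (N - 2)"
      by (intro D_even_sum D_even_cmult D_even_poly_cos)
    then show ?thesis using that by (auto simp: D_odd_iff gl_component_def[abs_def])
  qed
  show "gl_component N F m 0 = 0" if "even m \<and> m \<noteq> 0"
    using gl_component_at_node[OF assms(1) N m, of 1] dft_coeff_endpoint[OF assms(1) N _ m, of 1] that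
    by (simp add: lobatto_nodes_eq)
  show "gl_component N F m pi = 0" if "even m \<and> m \<noteq> 0"
    using gl_component_at_node[OF assms(1) N m, of "-1"] dft_coeff_endpoint[OF assms(1) N _ m, of "-1"] that
    by (simp add: lobatto_nodes_eq)
qed (simp add: gl_explicit_def)

text \<open>The transform in \<open>\<phi>\<close> recovers each component at the nodes. An even
  order has \<open>N + 1\<close> nodes for degree \<open>N\<close>; for an odd order the sine
  cancels at the \<open>N - 1\<close> interior nodes, enough for degree
  \<open>N - 2\<close>.\<close>

lemma X_space_eq_on_nodes:
  assumes "N \<ge> 2" "G \<in> X_space N" "G' \<in> X_space N"
    and eq: "\<And>x k. x \<in> lobatto_nodes N \<Longrightarrow> k \<in> {- int N + 1..int N} \<Longrightarrow>
      G (arccos x, of_int k * pi / real N) = G' (arccos x, of_int k * pi / real N)"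
  shows "G = G'"
proof -
  have N: "N \<ge> 1" using assms(1) by simp
  let ?S = "lobatto_nodes N" and ?I = "lobatto_nodes N - {-1, 1}"
  have fin: "finite ?S" by (rule finite_lobatto_nodes[OF N])
  obtain p where p: "\<forall>m \<in> {- int N<..int N}. (even m \<longrightarrow> p m \<in> D_even N) \<and> (odd m \<longrightarrow> p m \<in> D_odd (N - 2))"
    "G = (\<lambda>(\<theta>, \<phi>). \<Sum>m \<in> {- int N<..int N}. p m \<theta> * exp (\<i> * of_int m * of_real \<phi>))"
    using assms(2) unfolding X_space_def by blast
  obtain q where q: "\<forall>m \<in> {- int N<..int N}. (even m \<longrightarrow> q m \<in> D_even N) \<and> (odd m \<longrightarrow> q m \<in> D_odd (N - 2))"
    "G' = (\<lambda>(\<theta>, \<phi>). \<Sum>m \<in> {- int N<..int N}. q m \<theta> * exp (\<i> * of_int m * of_real \<phi>))"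
    using assms(3) unfolding X_space_def by blast
  have "p m = q m" if m: "m \<in> {- int N<..int N}" for m
  proof -
    have node: "p m (arccos x) = q m (arccos x)" if x: "x \<in> ?S" for x
    proof -
      have "dft_coeff N G m x = p m (arccos x)"
        by (rule dft_of_trig_sum[OF N m, where p = "\<lambda>l. p l (arccos x)"]) (simp add: p(2))
      moreover have "dft_coeff N G m x = q m (arccos x)"
        by (rule dft_of_trig_sum[OF N m, where p = "\<lambda>l. q l (arccos x)"]) (simp add: eq[OF x] q(2))
      ultimately show ?thesis by simp
    qed
    show ?thesis
    proof (cases "even m")
      case True
      then show ?thesis
        using p(1) q(1) m node fin card_lobatto_nodes[OF N] lobatto_nodes_subset[OF N]
        by (intro D_even_eq_on_nodes[of _ N _ ?S]) auto
    next
      case False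
      then obtain f g where f: "f \<in> D_even (N - 2)" "p m = (\<lambda>\<theta>. of_real (sin \<theta>) * f \<theta>)"
        and g: "g \<in> D_even (N - 2)" "q m = (\<lambda>\<theta>. of_real (sin \<theta>) * g \<theta>)"
      proof -
        have "p m \<in> D_odd (N - 2)" "q m \<in> D_odd (N - 2)" using p(1) q(1) m False by auto
        then show ?thesis using that by (auto simp: D_odd_iff)
      qed
      have "f = g"
      proof (rule D_even_eq_on_nodes[OF f(1) g(1)])
        show "finite ?I" using fin by simp
        show "N - 2 < card ?I" using card_interior_nodes[OF N] assms(1) by simp
        show "?I \<subseteq> {-1..1}" using lobatto_nodes_subset[OF N] by auto
        fix x assume x: "x \<in> ?I"
        then have "-1 < x" "x < 1" using interior_lobatto_nodes[OF N, of x] by auto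
        then have "sin (arccos x) \<noteq> 0" by (intro sin_arccos_nonzero)
        moreover have "of_real (sin (arccos x)) * f (arccos x) = of_real (sin (arccos x)) * g (arccos x)"
          using node[of x] x f(2) g(2) by simp
        ultimately show "f (arccos x) = g (arccos x)" by simp
      qed
      then show ?thesis using f g by simp
    qed
  qed
  then show ?thesis by (simp add: p(2) q(2))
qed

lemma gl_interp_eq:
  assumes "F \<in> sph_cont" "N \<ge> 2"
  shows "gl_interp N F = gl_explicit N F"
proof -
  have N: "N \<ge> 1" using assms(2) by simp
  have iff: "(\<forall>j\<in>{0..N}. \<forall>k\<in>{- int N + 1..int N}. G (gl_angle N j, of_int k * pi / real N) = F (gl_angle N j, of_int k * pi / real N))
     \<longleftrightarrow> (\<forall>x\<in>lobatto_nodes N. \<forall>k\<in>{- int N + 1..int N}. G (arccos x, of_int k * pi / real N) = F (arccos x, of_int k * pi / real N))" for G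
  proof -
    define P where "P t \<longleftrightarrow> (\<forall>k\<in>{- int N + 1..int N}. G (t, of_int k * pi / real N) = F (t, of_int k * pi / real N))" for t
    have "(\<forall>j\<in>{0..N}. P (gl_angle N j)) \<longleftrightarrow> (\<forall>t\<in>gl_angle N ` {0..N}. P t)" by simp
    also have "\<dots> \<longleftrightarrow> (\<forall>x\<in>lobatto_nodes N. P (arccos x))" unfolding gl_angle_image[OF N] by simp
    finally show ?thesis by (simp only: P_def)
  qed
  have nodes: "gl_explicit N F (arccos x, of_int k * pi / real N) = F (arccos x, of_int k * pi / real N)"
    if "x \<in> lobatto_nodes N" "k \<in> {- int N + 1..int N}" for x k
    using dft_inverse[OF N that(2), of F x] by (simp add: gl_explicit_def gl_component_at_node[OF assms(1) N _ that(1)])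
  show ?thesis
    unfolding gl_interp_def iff
  proof (rule the_equality)
    show "gl_explicit N F \<in> X_space N \<and> (\<forall>x\<in>lobatto_nodes N. \<forall>k\<in>{- int N + 1..int N}.
        gl_explicit N F (arccos x, of_int k * pi / real N) = F (arccos x, of_int k * pi / real N))"
      using gl_explicit_in_X_space[OF assms] nodes by blast
    fix G assume "G \<in> X_space N \<and> (\<forall>x\<in>lobatto_nodes N. \<forall>k\<in>{- int N + 1..int N}.
        G (arccos x, of_int k * pi / real N) = F (arccos x, of_int k * pi / real N))"
    then show "G = gl_explicit N F"
      using gl_explicit_in_X_space[OF assms] nodes by (intro X_space_eq_on_nodes[OF assms(2)]) auto
  qed
qed

text \<open>The integral of the interpolant as a finite linear combination of values of
  \<open>F\<close> on the grid. In this form it is linear and passes to pointwise limits.\<close>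

definition lobatto_osc :: "real \<Rightarrow> nat \<Rightarrow> (real \<times> real \<Rightarrow> complex) \<Rightarrow> complex" where
  "lobatto_osc \<kappa> N F = of_real (2 * pi) * (\<Sum>x\<in>lobatto_nodes N. dft_coeff N F 0 x * oint \<kappa> (lagrange (lobatto_nodes N) x))"

lemma sph_integral_zonal:
  "sph_integral (\<lambda>x. of_real (poly q (cos (fst x))) * exp (\<i> * of_real (\<kappa> * cos (fst x)))) = of_real (2 * pi) * oint \<kappa> q"
proof -
  have "sph_integral (\<lambda>x. (of_real (poly q (cos (fst x))) * exp (\<i> * of_real (\<kappa> * cos (fst x)))) * 1) =
    integral {0..pi} (\<lambda>\<theta>. of_real (poly q (cos \<theta>)) * exp (\<i> * of_real (\<kappa> * cos \<theta>)) * of_real (sin \<theta>)) * integral {0..2 * pi} (\<lambda>\<phi>. 1)"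
    by (rule sph_integral_product[where g = "\<lambda>_. 1"]) (intro continuous_intros)+
  also have "integral {0..pi} (\<lambda>\<theta>. of_real (poly q (cos \<theta>)) * exp (\<i> * of_real (\<kappa> * cos \<theta>)) * of_real (sin \<theta>)) = oint \<kappa> q"
    unfolding oint_def
    by (rule integral_cos_substitution[where f = "\<lambda>t. of_real (poly q t) * exp (\<i> * of_real (\<kappa> * t))"]) (intro continuous_intros)
  finally show ?thesis by (simp add: mult.commute scaleR_conv_of_real)
qed

lemma osc_integral_gl_explicit:
  assumes "N \<ge> 1"
  shows "osc_integral \<kappa> (gl_explicit N F) = lobatto_osc \<kappa> N F"
proof -
  let ?S = "lobatto_nodes N"
  let ?E = "\<lambda>\<theta>. exp (\<i> * complex_of_real (\<kappa> * cos \<theta>))"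
  have cc: "continuous_on A (gl_component N F m)" for A m
  proof -
    have "continuous_on A (\<lambda>\<theta>. \<Sum>x\<in>I. d x * complex_of_real (poly (f x) (cos \<theta>)))" for I :: "real set" and d f
      by (intro continuous_intros)
    then show ?thesis unfolding gl_component_def[abs_def]
      by (cases "even m") (simp_all only: if_True if_False, intro continuous_intros)
  qed
  have tm: "sph_integral (\<lambda>x. (gl_component N F m (fst x) * ?E (fst x)) * exp (\<i> * of_int m * of_real (snd x))) =
     integral {0..pi} (\<lambda>\<theta>. (gl_component N F m \<theta> * ?E \<theta>) * of_real (sin \<theta>)) * (if m = 0 then of_real (2 * pi) else 0)" for m
    unfolding integral_exp_period[symmetric]
    by (rule sph_integral_product) (intro continuous_intros cc)+
  have ti: "sph_integrable (\<lambda>x. (gl_component N F m (fst x) * ?E (fst x)) * exp (\<i> * of_int m * of_real (snd x)))" for m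
    by (intro sph_integrable_continuous continuous_intros continuous_on_compose2[OF cc[of UNIV]]) auto
  have "osc_integral \<kappa> (gl_explicit N F) = sph_integral (\<lambda>x. \<Sum>m\<in>{- int N<..int N}. (gl_component N F m (fst x) * ?E (fst x)) * exp (\<i> * of_int m * of_real (snd x)))"
    unfolding osc_integral_def gl_explicit_def by (simp add: case_prod_beta sum_distrib_right sum_distrib_left mult_ac)
  also have "\<dots> = (\<Sum>m\<in>{- int N<..int N}. sph_integral (\<lambda>x. (gl_component N F m (fst x) * ?E (fst x)) * exp (\<i> * of_int m * of_real (snd x))))"
    by (rule sph_integral_sum[OF ti])
  also have "\<dots> = (\<Sum>m\<in>{- int N<..int N}. if m = 0 then sph_integral (\<lambda>x. (gl_component N F 0 (fst x) * ?E (fst x)) * exp (\<i> * of_int 0 * of_real (snd x))) else 0)"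
  proof (intro sum.cong refl)
    fix m
    show "sph_integral (\<lambda>x. (gl_component N F m (fst x) * ?E (fst x)) * exp (\<i> * of_int m * of_real (snd x))) =
      (if m = 0 then sph_integral (\<lambda>x. (gl_component N F 0 (fst x) * ?E (fst x)) * exp (\<i> * of_int 0 * of_real (snd x))) else 0)"
      by (cases "m = 0") (simp_all only: tm if_True if_False mult_zero_right refl simp_thms)
  qed
  also have "\<dots> = sph_integral (\<lambda>x. gl_component N F 0 (fst x) * ?E (fst x))" using assms by simp
  also have "\<dots> = sph_integral (\<lambda>x. \<Sum>y\<in>?S. dft_coeff N F 0 y * (of_real (poly (lagrange ?S y) (cos (fst x))) * ?E (fst x)))"
    by (simp add: gl_component_def sum_distrib_right mult.assoc)
  also have "\<dots> = (\<Sum>y\<in>?S. sph_integral (\<lambda>x. dft_coeff N F 0 y * (of_real (poly (lagrange ?S y) (cos (fst x))) * ?E (fst x))))"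
    by (intro sph_integral_sum sph_integrable_continuous continuous_intros)
  also have "\<dots> = lobatto_osc \<kappa> N F"
    unfolding sph_integral_cmult sph_integral_zonal lobatto_osc_def by (simp add: sum_distrib_left mult_ac)
  finally show ?thesis .
qed

lemma gl_osc_integral_eq:
  assumes "F \<in> sph_cont" "N \<ge> 2"
  shows "gl_osc_integral \<kappa> N F = lobatto_osc \<kappa> N F"
  unfolding gl_osc_integral_def gl_interp_eq[OF assms] using assms(2) by (intro osc_integral_gl_explicit) simp

section \<open>The error bound\<close>

text \<open>The nonzero multiples of \<open>2 N\<close> up to \<open>n\<close> in modulus come in
  pairs of opposite sign. The range of \<open>j\<close> is taken up to \<open>M\<close>, independent
  of \<open>n\<close>, so that the sums over \<open>n\<close> and \<open>j\<close> can later be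
  exchanged.\<close>

lemma sum_multiples:
  fixes g :: "int \<Rightarrow> 'a::comm_monoid_add"
  assumes "N \<ge> 1" "n \<le> M"
  shows "(\<Sum>m=- int n..int n. if int (2 * N) dvd m then g m else 0) =
    g 0 + (\<Sum>j\<in>{j \<in> {1..M}. 2 * N * j \<le> n}. g (int (2 * N * j)) + g (- int (2 * N * j)))"
proof -
  let ?J = "{j \<in> {1..M}. 2 * N * j \<le> n}"
  let ?p = "\<lambda>j. int (2 * N * j)" and ?q = "\<lambda>j. - int (2 * N * j)"
  have inj: "inj_on ?p ?J" "inj_on ?q ?J" using assms by (auto simp: inj_on_def)
  have pq: "x > 0" "y < 0" if "x \<in> ?p ` ?J" "y \<in> ?q ` ?J" for x y
    using that assms by auto
  have set: "{m \<in> {- int n..int n}. int (2 * N) dvd m} = insert 0 (?p ` ?J \<union> ?q ` ?J)" (is "?A = ?B")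
  proof (intro equalityI subsetI)
    fix m assume "m \<in> ?A"
    then obtain i where i: "m = int (2 * N) * i" and m: "\<bar>m\<bar> \<le> int n" by (auto simp: abs_le_iff dvd_def)
    define j where "j = nat \<bar>i\<bar>"
    have mj: "\<bar>m\<bar> = int (2 * N * j)" by (simp add: i j_def abs_mult)
    then have le: "2 * N * j \<le> n" using m by linarith
    show "m \<in> ?B"
    proof (cases "i = 0")
      case False
      then have "1 \<le> j" by (simp add: j_def)
      moreover have "1 * j \<le> 2 * N * j" using assms by (intro mult_right_mono) auto
      then have "j \<le> M" using le assms(2) by linarith
      ultimately have "j \<in> ?J" using le by auto
      moreover have "m = ?p j \<or> m = ?q j" using mj by linarith
      ultimately show ?thesis by blast
    qed (simp add: i)
  next
    fix m assume "m \<in> ?B"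
    then consider "m = 0" | j where "j \<in> ?J" "m = ?p j" | j where "j \<in> ?J" "m = ?q j" by blast
    then show "m \<in> ?A"
    proof cases
      case 2
      then have "?p j \<le> int n" by (simp only: of_nat_le_iff mem_Collect_eq)
      moreover have "- int n \<le> ?p j" by (rule order_trans[of _ 0]) auto
      ultimately show ?thesis using 2 by simp
    next
      case 3
      then have "?p j \<le> int n" by (simp only: of_nat_le_iff mem_Collect_eq)
      moreover have "?q j \<le> int n" by (rule order_trans[of _ 0]) auto
      ultimately show ?thesis using 3 by simp
    qed simp
  qed
  have disj: "?p ` ?J \<inter> ?q ` ?J = {}"
  proof -
    have False if "x \<in> ?p ` ?J" "x \<in> ?q ` ?J" for x using pq[OF that] by simp
    then show ?thesis by blast
  qed
  have zero: "0 \<notin> ?p ` ?J \<union> ?q ` ?J" using assms by auto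
  have "(\<Sum>m=- int n..int n. if int (2 * N) dvd m then g m else 0) = sum g {m \<in> {- int n..int n}. int (2 * N) dvd m}"
    by (rule sum.inter_filter[symmetric]) simp
  also have "\<dots> = g 0 + sum g (?p ` ?J \<union> ?q ` ?J)" unfolding set using zero by (intro sum.insert) auto
  also have "sum g (?p ` ?J \<union> ?q ` ?J) = sum g (?p ` ?J) + sum g (?q ` ?J)"
    using disj by (intro sum.union_disjoint) auto
  also have "\<dots> = (\<Sum>j\<in>?J. g (?p j) + g (?q j))"
    by (simp only: sum.distrib sum.reindex[OF inj(1)] sum.reindex[OF inj(2)] comp_def)
  finally show ?thesis .
qed

definition zonal_part :: "nat \<Rightarrow> (nat \<Rightarrow> int \<Rightarrow> real) \<Rightarrow> real poly" where
  "zonal_part M b = (\<Sum>n\<le>M. smult (b n 0) (nleg n))"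

lemma aliased_values:
  assumes "N \<ge> 1"
  shows "(\<Sum>n\<le>M. \<Sum>m=- int n..int n. if int (2 * N) dvd m then b n m * poly (aleg (nat \<bar>m\<bar> div 2) n) x else 0) =
    poly (zonal_part M b + (\<Sum>j\<in>{1..M}. alias_poly N M b j)) x"
proof -
  let ?h = "\<lambda>n j. (b n (int (2 * N * j)) + b n (- int (2 * N * j))) * poly (aleg (N * j) n) x"
  have "(\<Sum>n\<le>M. \<Sum>m=- int n..int n. if int (2 * N) dvd m then b n m * poly (aleg (nat \<bar>m\<bar> div 2) n) x else 0) =
     (\<Sum>n\<le>M. b n 0 * poly (nleg n) x + (\<Sum>j\<in>{j \<in> {1..M}. 2 * N * j \<le> n}. ?h n j))"
  proof (intro sum.cong refl)
    fix n assume "n \<in> {..M}"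
    then have n: "n \<le> M" by simp
    have "nat \<bar>int (2 * N * j)\<bar> div 2 = N * j" "nat \<bar>- int (2 * N * j)\<bar> div 2 = N * j" for j
      by (simp_all only: abs_minus_cancel abs_of_nat nat_int mult.assoc nonzero_mult_div_cancel_left[OF zero_neq_numeral[symmetric]])
    then show "(\<Sum>m=- int n..int n. if int (2 * N) dvd m then b n m * poly (aleg (nat \<bar>m\<bar> div 2) n) x else 0) =
       b n 0 * poly (nleg n) x + (\<Sum>j\<in>{j \<in> {1..M}. 2 * N * j \<le> n}. ?h n j)"
      unfolding sum_multiples[OF assms n, of "\<lambda>m. b n m * poly (aleg (nat \<bar>m\<bar> div 2) n) x"]
      by (simp only: distrib_right) (simp add: aleg_0)
  qed
  also have "\<dots> = (\<Sum>n\<le>M. b n 0 * poly (nleg n) x) + (\<Sum>n\<le>M. \<Sum>j\<in>{j \<in> {1..M}. 2 * N * j \<le> n}. ?h n j)"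
    by (rule sum.distrib)
  also have "(\<Sum>n\<le>M. \<Sum>j\<in>{j \<in> {1..M}. 2 * N * j \<le> n}. ?h n j) = (\<Sum>j\<in>{1..M}. \<Sum>n\<in>{n \<in> {..M}. 2 * N * j \<le> n}. ?h n j)"
    by (rule sum.swap_restrict) auto
  also have "\<dots> = (\<Sum>j\<in>{1..M}. \<Sum>n\<in>{2 * N * j..M}. ?h n j)"
    by (intro sum.cong refl) auto
  finally show ?thesis by (simp add: zonal_part_def alias_poly_def poly_sum)
qed

lemma linterp_add: "linterp N (\<lambda>x. f x + g x) = linterp N f + linterp N g"
  by (simp add: linterp_def smult_add_left sum.distrib)

text \<open>The degrees up to \<open>N\<close> are reproduced by interpolation and cancel.\<close>

lemma zonal_error_eq:
  assumes "N \<ge> 1"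
  shows "zonal_part M b - linterp N (poly (zonal_part M b + A)) = zonal_tail N M b - linterp N (poly (zonal_tail N M b + A))"
proof -
  define P where "P = (\<Sum>n\<in>{n \<in> {..M}. n \<le> N}. smult (b n 0) (nleg n))"
  have split: "{..M} = {n \<in> {..M}. n \<le> N} \<union> {N<..M}" by auto
  have "zonal_part M b = P + zonal_tail N M b"
    unfolding zonal_part_def P_def zonal_tail_def by (subst split, rule sum.union_disjoint) auto
  moreover have "degree P \<le> N" unfolding P_def
    by (intro degree_sum_le) (auto simp: degree_nleg intro: order_trans[OF degree_smult_le])
  then have "linterp N (poly P) = P" using linterp_unique[OF assms, of P "poly P"] by simp
  moreover have "poly (P + zonal_tail N M b + A) = (\<lambda>x. poly P x + poly (zonal_tail N M b + A) x)"
    by (simp add: fun_eq_iff add.assoc)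
  ultimately show ?thesis by (simp only: linterp_add add_diff_add diff_self add_0_left)
qed

text \<open>For even \<open>m\<close> the exponent of the sign is \<open>m\<close> or 0, hence even,
  and positive and negative orders share one polynomial.\<close>

lemma harm_at_node:
  assumes "x \<in> {-1..1}" "even m"
  shows "harm n m (sph_param (arccos x, \<phi>)) =
    of_real (poly (aleg (nat \<bar>m\<bar> div 2) n) x / sqrt (2 * pi)) * exp (\<i> * of_int m * of_real \<phi>)"
proof -
  obtain i where "m = 2 * i" using assms(2) by (elim evenE)
  then obtain k where k: "nat \<bar>m\<bar> = 2 * k" by (intro that[of "nat \<bar>i\<bar>"]) (simp add: abs_mult nat_mult_distrib)
  have c: "cos (arccos x) = x" "sin (arccos x) = sqrt (1 - x\<^sup>2)"
    using assms(1) by (simp_all add: sin_arccos_abs abs_le_iff)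
  have "0 \<le> 1 - x\<^sup>2" using assms(1) by (auto simp: abs_square_le_1 abs_le_iff)
  then have s: "sqrt (1 - x\<^sup>2) ^ (2 * k) = (1 - x\<^sup>2) ^ k" by (simp add: power_mult)
  have "even (nat ((m + \<bar>m\<bar>) div 2))"
    using assms(2) by (cases "m \<ge> 0") (auto simp: even_nat_iff)
  then have h: "harm_const n m = sqrt ((real n + 1/2) * (fact (n - 2 * k) / fact (n + 2 * k))) / sqrt (2 * pi)"
    by (simp add: harm_const_def k)
  have a: "poly (aleg (nat \<bar>m\<bar> div 2) n) x = sqrt ((real n + 1/2) * (fact (n - 2 * k) / fact (n + 2 * k))) * ((1 - x\<^sup>2) ^ k * poly (dleg (2 * k) n) x)"
    by (simp add: aleg_def k poly_power power2_eq_square)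
  show ?thesis
    unfolding harm_def zpow_sph_param sph_param_nth c k s h a[unfolded k] by (simp add: mult_ac)
qed

text \<open>Aliasing: on the grid an order is indistinguishable from order 0 precisely if it is a
  multiple of \<open>2 N\<close>.\<close>

lemma dft_coeff_harm:
  assumes "N \<ge> 1" "x \<in> {-1..1}"
  shows "dft_coeff N (\<lambda>y. harm n m (sph_param y)) 0 x =
    (if int (2 * N) dvd m then of_real (poly (aleg (nat \<bar>m\<bar> div 2) n) x / sqrt (2 * pi)) else 0)"
proof -
  let ?K = "{- int N + 1..int N}"
  define c where "c = harm n m (sph_param (arccos x, 0))"
  have e: "harm n m (sph_param (arccos x, \<phi>)) = c * exp (\<i> * of_int m * of_real \<phi>)" for \<phi>
    by (simp add: c_def harm_def zpow_sph_param sph_param_nth)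
  have "dft_coeff N (\<lambda>y. harm n m (sph_param y)) 0 x = c * (\<Sum>k\<in>?K. exp (\<i> * of_int m * of_real (of_int k * pi / real N))) / of_nat (2 * N)"
    unfolding dft_coeff_def e by (simp add: sum_distrib_left)
  also have "\<dots> = (if int (2 * N) dvd m then c else 0)"
    unfolding sum_roots_of_unity[OF assms(1)] using assms(1) by simp
  also have "\<dots> = (if int (2 * N) dvd m then of_real (poly (aleg (nat \<bar>m\<bar> div 2) n) x / sqrt (2 * pi)) else 0)"
  proof (cases "int (2 * N) dvd m")
    case True
    then have "even m" by (metis dvd_trans dvd_triv_left of_nat_mult of_nat_numeral)
    then have "c = of_real (poly (aleg (nat \<bar>m\<bar> div 2) n) x / sqrt (2 * pi))"
      unfolding c_def by (subst harm_at_node[OF assms(2)]) auto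
    then show ?thesis using True by simp
  qed simp
  finally show ?thesis .
qed

section \<open>The quadrature error of partial sums\<close>

lemma dft_coeff_sum:
  "dft_coeff N (\<lambda>y. \<Sum>i\<in>I. f i y) m x = (\<Sum>i\<in>I. dft_coeff N (f i) m x)"
  unfolding dft_coeff_def sum_divide_distrib sum_distrib_right by (rule sum.swap)

lemma dft_coeff_cmult: "dft_coeff N (\<lambda>y. c * f y) m x = c * dft_coeff N f m x"
  unfolding dft_coeff_def by (simp add: sum_distrib_left mult.assoc)

lemma lobatto_osc_harm_partial:
  fixes F :: "real \<times> real \<Rightarrow> complex"
  assumes "N \<ge> 1"
  defines "R \<equiv> \<lambda>n m. Re (sph_coeff F n m)" and "I \<equiv> \<lambda>n m. Im (sph_coeff F n m)"
  shows "lobatto_osc \<kappa> N (harm_partial F (Suc M)) = of_real (sqrt (2 * pi)) *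
    (oint \<kappa> (linterp N (poly (zonal_part M R + (\<Sum>j\<in>{1..M}. alias_poly N M R j))))
      + \<i> * oint \<kappa> (linterp N (poly (zonal_part M I + (\<Sum>j\<in>{1..M}. alias_poly N M I j)))))"
proof -
  let ?S = "lobatto_nodes N"
  define pR where "pR = zonal_part M R + (\<Sum>j\<in>{1..M}. alias_poly N M R j)"
  define pI where "pI = zonal_part M I + (\<Sum>j\<in>{1..M}. alias_poly N M I j)"
  define s where "s = complex_of_real (sqrt (2 * pi))"
  \<comment> \<open>Of the factor \<open>2 \<pi>\<close> from the integral over
    \<open>\<phi>\<close>, one root cancels the normalisation of the exponentials and the other
    remains in front.\<close>
  have s: "s * s = of_real (2 * pi)" "s \<noteq> 0" by (simp_all add: s_def of_real_mult[symmetric] del: of_real_mult)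
  have val: "s * dft_coeff N (harm_partial F (Suc M)) 0 x = of_real (poly pR x) + \<i> * of_real (poly pI x)" if x: "x \<in> ?S" for x
  proof -
    have x1: "x \<in> {-1..1}" using x lobatto_nodes_subset[OF assms(1)] by auto
    let ?q = "\<lambda>n m. poly (aleg (nat \<bar>m\<bar> div 2) n) x"
    have "harm_partial F (Suc M) = (\<lambda>y. \<Sum>n\<le>M. \<Sum>m=- int n..int n. sph_coeff F n m * harm n m (sph_param y))"
      by (simp add: fun_eq_iff harm_partial_def harm_sum_def lessThan_Suc_atMost)
    then have "s * dft_coeff N (harm_partial F (Suc M)) 0 x = (\<Sum>n\<le>M. \<Sum>m=- int n..int n.
        s * (sph_coeff F n m * (if int (2 * N) dvd m then of_real (?q n m / sqrt (2 * pi)) else 0)))"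
      by (simp only: dft_coeff_sum dft_coeff_cmult dft_coeff_harm[OF assms(1) x1] sum_distrib_left)
    also have "\<dots> = (\<Sum>n\<le>M. \<Sum>m=- int n..int n. of_real (if int (2 * N) dvd m then R n m * ?q n m else 0)
        + \<i> * of_real (if int (2 * N) dvd m then I n m * ?q n m else 0))"
    proof (intro sum.cong refl)
      fix n m
      have "s * of_real (?q n m / sqrt (2 * pi)) = of_real (?q n m)" using s(2) by (simp add: s_def)
      then have "s * (sph_coeff F n m * of_real (?q n m / sqrt (2 * pi))) = sph_coeff F n m * of_real (?q n m)"
        by (metis mult.left_commute)
      also have "\<dots> = of_real (R n m * ?q n m) + \<i> * of_real (I n m * ?q n m)"
        by (simp add: complex_eq_iff R_def I_def)
      finally show "s * (sph_coeff F n m * (if int (2 * N) dvd m then of_real (?q n m / sqrt (2 * pi)) else 0)) =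
         of_real (if int (2 * N) dvd m then R n m * ?q n m else 0) + \<i> * of_real (if int (2 * N) dvd m then I n m * ?q n m else 0)"
        by simp
    qed
    also have "\<dots> = of_real (\<Sum>n\<le>M. \<Sum>m=- int n..int n. if int (2 * N) dvd m then R n m * ?q n m else 0)
        + \<i> * of_real (\<Sum>n\<le>M. \<Sum>m=- int n..int n. if int (2 * N) dvd m then I n m * ?q n m else 0)"
      by (simp only: sum.distrib sum_distrib_left[symmetric] of_real_sum)
    finally show ?thesis unfolding aliased_values[OF assms(1)] pR_def pI_def .
  qed
  have "lobatto_osc \<kappa> N (harm_partial F (Suc M)) = s * (\<Sum>x\<in>?S. (s * dft_coeff N (harm_partial F (Suc M)) 0 x) * oint \<kappa> (lagrange ?S x))"
    by (simp only: lobatto_osc_def s(1)[symmetric] sum_distrib_left mult.assoc)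
  also have "(\<Sum>x\<in>?S. (s * dft_coeff N (harm_partial F (Suc M)) 0 x) * oint \<kappa> (lagrange ?S x)) =
     (\<Sum>x\<in>?S. of_real (poly pR x) * oint \<kappa> (lagrange ?S x) + \<i> * (of_real (poly pI x) * oint \<kappa> (lagrange ?S x)))"
    by (intro sum.cong refl) (simp only: val distrib_right mult.assoc)
  also have "\<dots> = oint \<kappa> (linterp N (poly pR)) + \<i> * oint \<kappa> (linterp N (poly pI))"
    by (simp add: linterp_def oint_sum oint_smult sum.distrib sum_distrib_left)
  finally show ?thesis by (simp only: s_def pR_def pI_def)
qed

lemma osc_harm:
  "sph_integral (\<lambda>x. harm n m (sph_param x) * exp (\<i> * of_real (\<kappa> * cos (fst x)))) =
    (if m = 0 then of_real (sqrt (2 * pi)) * oint \<kappa> (nleg n) else 0)"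
proof (cases "m = 0")
  case True
  have h: "harm n 0 (sph_param x) = of_real (poly (smult (1 / sqrt (2 * pi)) (nleg n)) (cos (fst x)))" for x
    by (cases x) (simp add: harm_def harm_const_def zpow_def sph_param_nth nleg_def dleg_0)
  have "of_real (2 * pi) * (of_real (1 / sqrt (2 * pi)) * oint \<kappa> (nleg n)) = of_real (sqrt (2 * pi)) * oint \<kappa> (nleg n)"
  proof -
    have "2 * pi * (1 / sqrt (2 * pi)) = sqrt (2 * pi)" by (simp add: real_div_sqrt)
    then show ?thesis by (simp only: mult.assoc[symmetric] of_real_mult[symmetric])
  qed
  then show ?thesis unfolding True h sph_integral_zonal oint_smult by simp
next
  case False
  define f where "f \<theta> = of_real (harm_const n m * poly (dleg (nat \<bar>m\<bar>) n) (cos \<theta>) * sin \<theta> ^ nat \<bar>m\<bar>) *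
    exp (\<i> * complex_of_real (\<kappa> * cos \<theta>))" for \<theta>
  have "harm n m (sph_param x) * exp (\<i> * of_real (\<kappa> * cos (fst x))) = f (fst x) * exp (\<i> * of_int m * of_real (snd x))" for x
    by (cases x) (simp add: harm_def f_def zpow_sph_param sph_param_nth mult_ac)
  moreover have "sph_integral (\<lambda>x. f (fst x) * exp (\<i> * of_int m * of_real (snd x))) =
     integral {0..pi} (\<lambda>\<theta>. f \<theta> * of_real (sin \<theta>)) * integral {0..2 * pi} (\<lambda>\<phi>. exp (\<i> * of_int m * of_real \<phi>))"
    by (rule sph_integral_product) (auto simp: f_def intro!: continuous_intros)
  ultimately show ?thesis using False by (simp only: integral_exp_period) simp
qed

lemma osc_integral_harm_partial:
  "osc_integral \<kappa> (harm_partial F (Suc M)) = of_real (sqrt (2 * pi)) *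
    (oint \<kappa> (zonal_part M (\<lambda>n m. Re (sph_coeff F n m))) + \<i> * oint \<kappa> (zonal_part M (\<lambda>n m. Im (sph_coeff F n m))))"
proof -
  let ?E = "\<lambda>x :: real \<times> real. exp (\<i> * complex_of_real (\<kappa> * cos (fst x)))"
  let ?T = "\<lambda>n m x. sph_coeff F n m * (harm n m (sph_param x) * ?E x)"
  have c: "sph_integrable (?T n m)" for n m
    by (intro sph_integrable_continuous continuous_intros continuous_on_harm_param)
  have "osc_integral \<kappa> (harm_partial F (Suc M)) = sph_integral (\<lambda>x. \<Sum>n\<le>M. \<Sum>m=- int n..int n. ?T n m x)"
    by (simp add: osc_integral_def harm_partial_def harm_sum_def sum_distrib_right mult.assoc lessThan_Suc_atMost)
  also have "\<dots> = (\<Sum>n\<le>M. \<Sum>m=- int n..int n. sph_integral (?T n m))"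
    by (simp only: sph_integral_sum sph_integrable_sum c finite_atMost finite_atLeastAtMost_int)
  also have "\<dots> = (\<Sum>n\<le>M. sph_coeff F n 0 * (of_real (sqrt (2 * pi)) * oint \<kappa> (nleg n)))"
    unfolding sph_integral_cmult osc_harm
    by (intro sum.cong refl) (simp add: if_distrib[of "\<lambda>z. _ * z"] cong: if_cong)
  also have "\<dots> = of_real (sqrt (2 * pi)) * (\<Sum>n\<le>M. (of_real (Re (sph_coeff F n 0)) + \<i> * of_real (Im (sph_coeff F n 0))) * oint \<kappa> (nleg n))"
    unfolding complex_eq[symmetric] by (simp add: sum_distrib_left mult_ac)
  finally show ?thesis
    by (simp add: zonal_part_def oint_sum oint_smult algebra_simps sum.distrib sum_distrib_left)
qed

text \<open>Stated with an inequality so that it covers both the real and the imaginary parts of the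
  coefficients.\<close>

lemma sobolev_sum_le:
  assumes "summable (sobolev_term r F)" "\<And>n m. \<bar>b n m\<bar> \<le> cmod (sph_coeff F n m)"
  shows "sobolev_sum r M b \<le> (sobolev_norm r F)\<^sup>2"
proof -
  have nn: "0 \<le> sobolev_term r F n" for n unfolding sobolev_term_def by (intro sum_nonneg) auto
  have "sobolev_sum r M b \<le> (\<Sum>n\<le>M. sobolev_term r F n)"
    unfolding sobolev_sum_def sobolev_term_def
    using assms(2) by (intro sum_mono mult_left_mono) (auto simp: abs_le_square_iff[symmetric])
  also have "\<dots> \<le> (\<Sum>n. sobolev_term r F n)"
    using assms(1) nn by (intro sum_le_suminf) auto
  also have "\<dots> = (sobolev_norm r F)\<^sup>2"
    using suminf_nonneg[OF assms(1) nn] by (simp add: sobolev_norm_def)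
  finally show ?thesis .
qed

section \<open>Passage to the limit\<close>

lemma sph_integral_AE_eq:
  assumes "sph_integrable F" "sph_integrable G" "AE x in lebesgue. F x = G x"
  shows "sph_integral F = sph_integral G"
  unfolding sph_integral_def set_lebesgue_integral_def
proof (rule integral_cong_AE)
  show "(\<lambda>x. indicator sph_rect x *\<^sub>R (F x * complex_of_real (sin (fst x)))) \<in> borel_measurable lebesgue"
    "(\<lambda>x. indicator sph_rect x *\<^sub>R (G x * complex_of_real (sin (fst x)))) \<in> borel_measurable lebesgue"
    using assms(1,2) unfolding sph_integrable_def set_integrable_def by (simp_all only: borel_measurable_integrable)
  show "AE x in lebesgue. indicator sph_rect x *\<^sub>R (F x * complex_of_real (sin (fst x))) =
      indicator sph_rect x *\<^sub>R (G x * complex_of_real (sin (fst x)))"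
    using assms(3) by eventually_elim simp
qed

lemma osc_integral_limit:
  assumes "r > 1" "F \<in> sobolev r"
  shows "(\<lambda>M. osc_integral \<kappa> (harm_partial F M)) \<longlonglongrightarrow> osc_integral \<kappa> F"
proof -
  let ?E = "\<lambda>x :: real \<times> real. exp (\<i> * complex_of_real (\<kappa> * cos (fst x)))"
  have F: "F \<in> L2_sphere" "summable (sobolev_term r F)" using assms(2) by (auto simp: sobolev_def)
  have G: "harm_series F \<in> sph_cont" by (rule harm_series_sph_cont[OF assms(1) F(2)])
  have Ec: "continuous_on S ?E" for S by (intro continuous_intros)
  have "uniform_limit sph_rect (\<lambda>M x. harm_partial F M x * ?E x) (\<lambda>x. harm_series F x * ?E x) sequentially"
  proof (rule uniform_lim_mult[OF uniform_limit_harm_partial[OF assms(1) F(2)] uniform_limit_const])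
    show "bounded (harm_series F ` sph_rect)"
      by (intro compact_imp_bounded compact_continuous_image compact_sph_rect sph_cont_continuous G)
    show "bounded (?E ` sph_rect)"
      by (intro compact_imp_bounded compact_continuous_image compact_sph_rect Ec)
  qed
  then have "(\<lambda>M. sph_integral (\<lambda>x. harm_partial F M x * ?E x)) \<longlonglongrightarrow> sph_integral (\<lambda>x. harm_series F x * ?E x)"
    by (rule sph_integral_uniform_limit)
       (intro sph_integrable_continuous continuous_intros continuous_on_harm_partial sph_cont_continuous G)+
  moreover have "sph_integral (\<lambda>x. harm_series F x * ?E x) = sph_integral (\<lambda>x. F x * ?E x)"
  proof (rule sph_integral_AE_eq)
    show "sph_integrable (\<lambda>x. harm_series F x * ?E x)"
      by (intro sph_integrable_continuous continuous_intros sph_cont_continuous G)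
    show "sph_integrable (\<lambda>x. F x * ?E x)"
      using sph_integrable_mult_continuous[OF L2_sphere_sph_integrable[OF F(1)] Ec] by (simp add: mult.commute)
    show "AE x in lebesgue. harm_series F x * ?E x = F x * ?E x"
      using AE_eq_harm_series[OF assms] by eventually_elim simp
  qed
  ultimately show ?thesis by (simp add: osc_integral_def)
qed

lemma lobatto_osc_limit:
  assumes "r > 1" "F \<in> sobolev r"
  shows "(\<lambda>M. lobatto_osc \<kappa> N (harm_partial F M)) \<longlonglongrightarrow> lobatto_osc \<kappa> N (harm_series F)"
proof -
  have F: "summable (sobolev_term r F)" using assms(2) by (auto simp: sobolev_def)
  have "(\<lambda>M. harm_partial F M y) \<longlonglongrightarrow> harm_series F y" for y
    by (rule tendsto_uniform_limitI[OF uniform_limit_harm_partial[OF assms(1) F, of UNIV]]) simp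
  then show ?thesis
    unfolding lobatto_osc_def dft_coeff_def divide_inverse by (intro tendsto_intros)
qed

theorem theorem5p2:
  fixes l :: nat and r :: real
  assumes "(l \<in> {0, 1} \<and> r > 3/2) \<or> (l = 2 \<and> r > 4)"
  shows "\<exists>C>0. \<forall>\<kappa>>0. \<forall>N::nat. N \<ge> 2 \<longrightarrow> (\<forall>F \<in> sobolev r.
    cmod (osc_integral \<kappa> F - gl_osc_integral \<kappa> N (cont_rep F))
      \<le> C * \<kappa> powr (- real l) * real N powr (loss_exponent l - r) * sobolev_norm r F)"
proof -
  have r: "r > 3/2" "l \<le> 2" "r > loss_exponent l" and r1: "r > 1"
    using assms by (auto simp: loss_exponent_def)
  obtain C where C: "C > 0"
    and bound: "\<And>\<kappa> N M a A. \<lbrakk>\<kappa> > 0; N \<ge> 1; sobolev_sum r M a \<le> A\<^sup>2; 0 \<le> A\<rbrakk> \<Longrightarrow>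
      cmod (oint \<kappa> (zonal_tail N M a - linterp N (poly (zonal_tail N M a + (\<Sum>j\<in>{1..M}. alias_poly N M a j)))))
        \<le> C * \<kappa> powr (- real l) * real N powr (loss_exponent l - r) * A"
    using zonal_error_bound[OF r] by blast
  show ?thesis
  \<comment> \<open>The factor 2 adds the real and the imaginary part; \<open>sqrt (2 * pi)\<close>
    is the factor common to both integrals of a partial sum.\<close>
  proof (intro exI[of _ "sqrt (2 * pi) * (2 * C)"] conjI allI impI ballI)
    show "0 < sqrt (2 * pi) * (2 * C)" using C by simp
    fix \<kappa> :: real and N :: nat and F
    assume \<kappa>: "\<kappa> > 0" and N2: "N \<ge> 2" and F: "F \<in> sobolev r"
    have N: "N \<ge> 1" using N2 by simp
    have sm: "summable (sobolev_term r F)" using F by (simp add: sobolev_def)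
    let ?B = "C * \<kappa> powr (- real l) * real N powr (loss_exponent l - r) * sobolev_norm r F"
    have A: "0 \<le> sobolev_norm r F"
      unfolding sobolev_norm_def
      by (intro real_sqrt_ge_zero suminf_nonneg sm) (auto simp: sobolev_term_def intro!: sum_nonneg)
    have E: "cmod (osc_integral \<kappa> (harm_partial F (Suc M)) - lobatto_osc \<kappa> N (harm_partial F (Suc M))) \<le> sqrt (2 * pi) * (2 * ?B)" for M
    proof -
      define e where "e b = oint \<kappa> (zonal_tail N M b - linterp N (poly (zonal_tail N M b + (\<Sum>j\<in>{1..M}. alias_poly N M b j))))" for b
      define R where "R n m = Re (sph_coeff F n m)" for n m
      define I where "I n m = Im (sph_coeff F n m)" for n m
      have e: "oint \<kappa> (zonal_part M b) - oint \<kappa> (linterp N (poly (zonal_part M b + (\<Sum>j\<in>{1..M}. alias_poly N M b j)))) = e b" for b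
        unfolding e_def oint_diff[symmetric] zonal_error_eq[OF N] ..
      have "osc_integral \<kappa> (harm_partial F (Suc M)) - lobatto_osc \<kappa> N (harm_partial F (Suc M)) =
         of_real (sqrt (2 * pi)) * (e R + \<i> * e I)"
        unfolding osc_integral_harm_partial lobatto_osc_harm_partial[OF N] e[symmetric] R_def[abs_def] I_def[abs_def]
        by (simp add: algebra_simps)
      then have eq: "cmod (osc_integral \<kappa> (harm_partial F (Suc M)) - lobatto_osc \<kappa> N (harm_partial F (Suc M))) = sqrt (2 * pi) * cmod (e R + \<i> * e I)"
        by (simp only: norm_mult norm_of_real) simp
      have "cmod (e R + \<i> * e I) \<le> cmod (e R) + cmod (e I)"
        using norm_triangle_ineq[of "e R" "\<i> * e I"] by (simp add: norm_mult)
      also have "\<dots> \<le> ?B + ?B"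
        unfolding e_def
        by (intro add_mono bound \<kappa> N A sobolev_sum_le sm) (simp_all add: R_def I_def abs_Re_le_cmod abs_Im_le_cmod)
      finally have "cmod (e R + \<i> * e I) \<le> 2 * ?B" by (simp only: mult_2)
      then show ?thesis unfolding eq by (rule mult_left_mono) simp
    qed
    have "(\<lambda>M. cmod (osc_integral \<kappa> (harm_partial F M) - lobatto_osc \<kappa> N (harm_partial F M)))
       \<longlonglongrightarrow> cmod (osc_integral \<kappa> F - lobatto_osc \<kappa> N (harm_series F))"
      by (intro tendsto_norm tendsto_diff osc_integral_limit[OF r1 F] lobatto_osc_limit[OF r1 F])
    \<comment> \<open>The bound \<open>E\<close> is uniform in the cutoff and so survives the limit;
      it concerns indices \<open>Suc M\<close>, hence all indices from 1 on.\<close>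
    then have "cmod (osc_integral \<kappa> F - lobatto_osc \<kappa> N (harm_series F)) \<le> sqrt (2 * pi) * (2 * ?B)"
      by (rule LIMSEQ_le_const2) (metis E Suc_le_D)
    moreover have "gl_osc_integral \<kappa> N (cont_rep F) = lobatto_osc \<kappa> N (harm_series F)"
      unfolding cont_rep_eq[OF r1 F] by (rule gl_osc_integral_eq[OF harm_series_sph_cont[OF r1 sm] N2])
    ultimately show "cmod (osc_integral \<kappa> F - gl_osc_integral \<kappa> N (cont_rep F))
      \<le> sqrt (2 * pi) * (2 * C) * \<kappa> powr (- real l) * real N powr (loss_exponent l - r) * sobolev_norm r F"
      by (simp add: mult_ac)
  qed
qed

end
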